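(* Let $\mathbb{F}$ be a field and let $H=\mathbb{F}\langle x_n,\ n\ge 1\rangle$ be the free unital associative algebra with the algebra homomorphisms $\Delta,\delta_r,\delta_l:H\to H\amalg H$ and $\varepsilon:H\to\mathbb{F}$ given on generators by the formulas in the context (the Faà di Bruno coloop bialgebra). Then $H$ is a coloop in the category $\mathbf{As}_{\mathbb F}$ of unital associative $\mathbb{F}$-algebras, and it represents the loop of formal diffeomorphisms as a functor $\mathrm{Diff}:\mathbf{As}_{\mathbb F}\to\mathbf{Loop}$. As a consequence, given a unital associative algebra $A$, a series $a=\sum_{n\ge0}a_n\lambda^{n+1}\in\mathrm{Diff}(A)$ can be seen as the algebra homomorphism $a:H\to A$ with $a(x_n)=a_n$, and the right and left divisions of $a,b\in\mathrm{Diff}(A)$ are given, for every $n\ge 1$, by $$(a/b)_n=\mu_A(a\amalg b)\delta_r(x_n)=a_n-b_n+\sum_{\ell=1}^{n-1}(-1)^\ell\sum_{\mathbf n\in\mathcal C_n^{\ell+1}}d_\ell(n_1,\dots,n_\ell)\,(a_{n_1}-b_{n_1})\,b_{n_2}\cdots b_{n_{\ell+1}},$$ $$(a\backslash b)_n=\mu_A(a\amalg b)\delta_l(x_n)=b_n-a_n+\sum_{\ell=1}^{n-1}(-1)^\ell\sum_{\mathbf n\in\mathcal C_n^{\ell+1}}\sum_{\mathbf e\in\mathcal E_\ell}(-1)^{\mathbf e}\,d_\ell^{\mathbf e}(n_1,\dots,n_\ell)\,a_{n_1}c^{(e_2)}_{n_2}\cdots c^{(e_\ell)}_{n_\ell}\,(b_{n_{\ell+1}}-a_{n_{\ell+1}}),$$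 where $c^{(e_i)}_{n_i}=a_{n_i}$ if $e_i=1$ and $c^{(e_i)}_{n_i}=b_{n_i}$ if $e_i=2$.
   Context: **Loops.** A loop is a set $Q$ with a multiplication, a two-sided unit, a left division $\backslash$ and a right division $/$ such that $a\cdot(a\backslash b)=b$, $a\backslash(a\cdot b)=b$, $(a/b)\cdot b=a$, $(a\cdot b)/b=a$; $\mathbf{Loop}$ is the category of loops and multiplicative maps. **Coloops.** In a category with coproduct $\amalg$ and initial object $I$, write $u_A:I\to A$ for the unique map, $i_1,i_2$ for the canonical maps into a coproduct, $\langle f,g\rangle$ for the map out of a coproduct induced by $f,g$, $\mu_A=\langle \mathrm{id}_A,\mathrm{id}_A\rangle:A\amalg A\to A$ for the folding map, and $\varphi_1=i_1:H\to H\amalg I$, $\varphi_2=i_2:H\to I\amalg H$ for the canonical isomorphisms. A coloop is an object $H$ with maps $\Delta,\delta_r,\delta_l:H\to H\amalg H$, $\varepsilon:H\to I$ such that $(\varepsilon\amalg \mathrm{id})\Delta=\varphi_2$, $(\mathrm{id}\amalg\varepsilon)\Delta=\varphi_1$; $(\mathrm{id}\amalg\mu)(\delta_r\amalg \mathrm{id})\Delta=i_1=(\mathrm{id}\amalg\mu)(\Delta\amalg \mathrm{id})\delta_r$; $(\mu\amalg \mathrm{id})(\mathrm{id}\amalg\delta_l)\Delta=i_2=(\mu\amalg \mathrm{id})(\mathrm{id}\amalg\Delta)\delta_l$. A coloop $H$ represents a functor $Q$ in loops if $Q(A)\cong\mathrm{Hom}(H,A)$ naturally in $A$, with $\alpha\cdot\beta=\mu_A(\alpha\amalg\beta)\Delta$,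 $\alpha/\beta=\mu_A(\alpha\amalg\beta)\delta_r$, $\alpha\backslash\beta=\mu_A(\alpha\amalg\beta)\delta_l$ and unit $u_A\varepsilon$. In $\mathbf{As}_{\mathbb F}$ the initial object is $\mathbb F$ and $\amalg$ is the free product of unital algebras. **Formal diffeomorphisms.** For a unital associative $\mathbb F$-algebra $A$, $\mathrm{Diff}(A)=\{a=\sum_{n\ge0}a_n\lambda^{n+1}\mid a_0=1,\ a_n\in A\}$ with multiplication $(a\circ b)_n=\sum_{m=0}^n\ \sum_{k_0+\cdots+k_m=n-m,\ k_i\ge0}a_m b_{k_0}\cdots b_{k_m}$ and unit $e=\lambda$ (i.e. $e_0=1$, $e_n=0$ for $n\ge1$). **Combinatorial data.** $\mathcal C_n^{\ell}$ is the set of compositions $\mathbf n=(n_1,\dots,n_\ell)$ of $n$ into $\ell$ positive integers. For $\ell\ge1$, $\mathcal M_\ell$ is the set of sequences $\mathbf m=(m_1,\dots,m_\ell)$ of non-negative integers with $m_1+\cdots+m_\ell=\ell$ and $m_1+\cdots+m_j\ge j$ for $1\le j\le\ell-1$. Set $d_\ell(n_1,\dots,n_\ell)=\sum_{\mathbf m\in\mathcal M_\ell}\binom{n_1+1}{m_1}\cdots\binom{n_\ell+1}{m_\ell}$, $d_0=1$. $\mathcal E_\ell=\{1,2\}^\ell$; for $\mathbf e\in\mathcal E_\ell$, $\mathcal M_\ell^{\mathbf e}=\{\mathbf m\in\mathcal M_\ell\mid m_i=0\text{ whenever }e_i=2,\ 1\le i\le\ell\}$ (so it is empty if $e_1=2$,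 since $m_1\ge1$), $d_\ell^{\mathbf e}(n_1,\dots,n_\ell)=\sum_{\mathbf m\in\mathcal M^{\mathbf e}_\ell}\binom{n_1+1}{m_1}\cdots\binom{n_\ell+1}{m_\ell}$, and $(-1)^{\mathbf e}=(-1)^{e_1+\cdots+e_\ell-\ell}$. **Co-operations.** In $H\amalg H=\mathbb F\langle x_n,y_n,\ n\ge1\rangle$, $x_n$ and $y_n$ denote the generator $x_n$ in the first and second copy of $H$; $x^{(1)}_n=x_n$, $x^{(2)}_n=y_n$. For $n\ge1$: $\Delta(x_n)=x_n+y_n+\sum_{\ell=1}^{n-1}\sum_{\mathbf n\in\mathcal C_n^{\ell+1}}\binom{n_1+1}{\ell}x_{n_1}y_{n_2}\cdots y_{n_{\ell+1}}$; $\varepsilon(x_n)=0$; $\delta_r(x_n)=\sum_{\ell=0}^{n-1}(-1)^\ell\sum_{\mathbf n\in\mathcal C_n^{\ell+1}}d_\ell(n_1,\dots,n_\ell)(x_{n_1}-y_{n_1})y_{n_2}\cdots y_{n_{\ell+1}}$; $\delta_l(x_n)=(y_n-x_n)+\sum_{\ell=1}^{n-1}(-1)^\ell\sum_{\mathbf n\in\mathcal C_n^{\ell+1}}\sum_{\mathbf e\in\mathcal E_\ell}(-1)^{\mathbf e}d_\ell^{\mathbf e}(n_1,\dots,n_\ell)\,x^{(e_1)}_{n_1}x^{(e_2)}_{n_2}\cdots x^{(e_\ell)}_{n_\ell}(y_{n_{\ell+1}}-x_{n_{\ell+1}})$. *)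

theory Defs
  imports "HOL-Algebra.QuotRing" "HOL-Algebra.Module"
begin

section \<open>Loops\<close>

record 'a loop = "'a monoid" +
  ldiv :: "'a \<Rightarrow> 'a \<Rightarrow> 'a"
  rdiv :: "'a \<Rightarrow> 'a \<Rightarrow> 'a"

text \<open>\<^term>\<open>ldiv Q a b\<close> is $a \backslash b$ and \<^term>\<open>rdiv Q a b\<close> is $a / b$.  The morphisms of loops are
  the multiplicative maps \<^const>\<open>hom\<close>.\<close>

locale loop =
  fixes Q :: "('a, 'm) loop_scheme" (structure)
  assumes mult_closed: "\<lbrakk>a \<in> carrier Q; b \<in> carrier Q\<rbrakk> \<Longrightarrow> a \<otimes> b \<in> carrier Q"
    and one_closed: "\<one> \<in> carrier Q"
    and ldiv_closed: "\<lbrakk>a \<in> carrier Q; b \<in> carrier Q\<rbrakk> \<Longrightarrow> ldiv Q a b \<in> carrier Q"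
    and rdiv_closed: "\<lbrakk>a \<in> carrier Q; b \<in> carrier Q\<rbrakk> \<Longrightarrow> rdiv Q a b \<in> carrier Q"
    and l_one: "a \<in> carrier Q \<Longrightarrow> \<one> \<otimes> a = a"
    and r_one: "a \<in> carrier Q \<Longrightarrow> a \<otimes> \<one> = a"
    and mult_ldiv: "\<lbrakk>a \<in> carrier Q; b \<in> carrier Q\<rbrakk> \<Longrightarrow> a \<otimes> ldiv Q a b = b"
    and ldiv_mult: "\<lbrakk>a \<in> carrier Q; b \<in> carrier Q\<rbrakk> \<Longrightarrow> ldiv Q a (a \<otimes> b) = b"
    and rdiv_mult: "\<lbrakk>a \<in> carrier Q; b \<in> carrier Q\<rbrakk> \<Longrightarrow> rdiv Q a b \<otimes> b = a"
    and mult_rdiv: "\<lbrakk>a \<in> carrier Q; b \<in> carrier Q\<rbrakk> \<Longrightarrow> rdiv Q (a \<otimes> b) b = a"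

text \<open>Isomorphisms of loops as algebraic structures with all four operations.\<close>

definition loop_iso :: "('a, 'm) loop_scheme \<Rightarrow> ('b, 'n) loop_scheme \<Rightarrow> ('a \<Rightarrow> 'b) set" where
  "loop_iso Q R = {h \<in> hom Q R. bij_betw h (carrier Q) (carrier R) \<and> h \<one>\<^bsub>Q\<^esub> = \<one>\<^bsub>R\<^esub> \<and>
     (\<forall>a\<in>carrier Q. \<forall>b\<in>carrier Q. h (ldiv Q a b) = ldiv R (h a) (h b) \<and>
        h (rdiv Q a b) = rdiv R (h a) (h b))}"

section \<open>The category of unital associative algebras\<close>

text \<open>The locale \<^locale>\<open>algebra\<close> of the library is restricted to commutative algebras.  The zero
  algebra is not excluded here.\<close>

locale unital_algebra = field F + ring A + Module.module F A
  for F :: "('f, 'm) ring_scheme" and A :: "('f, 'a) module" +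
  assumes smult_mult_left: "\<lbrakk>c \<in> carrier F; x \<in> carrier A; y \<in> carrier A\<rbrakk> \<Longrightarrow>
      (c \<odot>\<^bsub>A\<^esub> x) \<otimes>\<^bsub>A\<^esub> y = c \<odot>\<^bsub>A\<^esub> (x \<otimes>\<^bsub>A\<^esub> y)"
    and smult_mult_right: "\<lbrakk>c \<in> carrier F; x \<in> carrier A; y \<in> carrier A\<rbrakk> \<Longrightarrow>
      x \<otimes>\<^bsub>A\<^esub> (c \<odot>\<^bsub>A\<^esub> y) = c \<odot>\<^bsub>A\<^esub> (x \<otimes>\<^bsub>A\<^esub> y)"

text \<open>Homomorphisms are taken extensional (undefined outside the carrier), so that equality of
  morphisms is equality of functions; accordingly they are composed with \<^const>\<open>compose\<close>.
  The set \<^const>\<open>ring_hom\<close> consists of unital maps.\<close>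

definition alg_hom ::
  "('f, 'm) ring_scheme \<Rightarrow> ('f, 'a) module \<Rightarrow> ('f, 'b) module \<Rightarrow> ('a \<Rightarrow> 'b) set" where
  "alg_hom F A B = {h \<in> ring_hom A B. h \<in> extensional (carrier A) \<and>
     (\<forall>c\<in>carrier F. \<forall>x\<in>carrier A. h (c \<odot>\<^bsub>A\<^esub> x) = c \<odot>\<^bsub>B\<^esub> h x)}"

definition alg_id :: "('f, 'a) module \<Rightarrow> 'a \<Rightarrow> 'a" where
  "alg_id A = (\<lambda>x\<in>carrier A. x)"

subsection \<open>The initial object\<close>

definition base_algebra :: "('f, 'm) ring_scheme \<Rightarrow> ('f, 'f) module" where
  "base_algebra F = \<lparr>carrier = carrier F, mult = mult F, one = \<one>\<^bsub>F\<^esub>, zero = \<zero>\<^bsub>F\<^esub>,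
     add = add F, smult = mult F\<rparr>"

definition alg_unit :: "('f, 'm) ring_scheme \<Rightarrow> ('f, 'a) module \<Rightarrow> 'f \<Rightarrow> 'a" where
  "alg_unit F A = (\<lambda>c\<in>carrier F. c \<odot>\<^bsub>A\<^esub> \<one>\<^bsub>A\<^esub>)"

subsection \<open>Free algebras\<close>

text \<open>Noncommutative polynomials in the variables \<open>X\<close>: finitely supported functions from words
  in \<open>X\<close> to \<open>F\<close>, with the convolution product over all ways to cut a word in two.\<close>

definition free_algebra :: "('f, 'm) ring_scheme \<Rightarrow> 'x set \<Rightarrow> ('f, 'x list \<Rightarrow> 'f) module" where
  "free_algebra F X =
    \<lparr>carrier = {p. (\<forall>w. p w \<in> carrier F) \<and> finite {w. p w \<noteq> \<zero>\<^bsub>F\<^esub>} \<and>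
                  {w. p w \<noteq> \<zero>\<^bsub>F\<^esub>} \<subseteq> lists X},
     mult = (\<lambda>p q w. \<Oplus>\<^bsub>F\<^esub>i\<in>{..length w}. p (take i w) \<otimes>\<^bsub>F\<^esub> q (drop i w)),
     one = (\<lambda>w. if w = [] then \<one>\<^bsub>F\<^esub> else \<zero>\<^bsub>F\<^esub>),
     zero = (\<lambda>w. \<zero>\<^bsub>F\<^esub>),
     add = (\<lambda>p q w. p w \<oplus>\<^bsub>F\<^esub> q w),
     smult = (\<lambda>c p w. c \<otimes>\<^bsub>F\<^esub> p w)\<rparr>"

definition gen :: "('f, 'm) ring_scheme \<Rightarrow> 'x \<Rightarrow> 'x list \<Rightarrow> 'f" where
  "gen F x = (\<lambda>w. if w = [x] then \<one>\<^bsub>F\<^esub> else \<zero>\<^bsub>F\<^esub>)"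

definition free_ext ::
  "('f, 'm) ring_scheme \<Rightarrow> 'x set \<Rightarrow> ('f, 'a) module \<Rightarrow> ('x \<Rightarrow> 'a) \<Rightarrow> ('x list \<Rightarrow> 'f) \<Rightarrow> 'a" where
  "free_ext F X A v = (THE h. h \<in> alg_hom F (free_algebra F X) A \<and> (\<forall>x\<in>X. h (gen F x) = v x))"

subsection \<open>Free products\<close>

text \<open>The elements that have to vanish in a quotient of \<open>P\<close> in order that \<open>j\<close>, composed
  with the projection, becomes a homomorphism of unital algebras on \<open>A\<close>.\<close>

definition hom_relations ::
  "('f, 'm) ring_scheme \<Rightarrow> ('f, 'a) module \<Rightarrow> ('f, 'p) module \<Rightarrow> ('a \<Rightarrow> 'p) \<Rightarrow> 'p set" where
  "hom_relations F A P j =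
     {j (a \<oplus>\<^bsub>A\<^esub> b) \<ominus>\<^bsub>P\<^esub> (j a \<oplus>\<^bsub>P\<^esub> j b) | a b. a \<in> carrier A \<and> b \<in> carrier A} \<union>
     {j (a \<otimes>\<^bsub>A\<^esub> b) \<ominus>\<^bsub>P\<^esub> (j a \<otimes>\<^bsub>P\<^esub> j b) | a b. a \<in> carrier A \<and> b \<in> carrier A} \<union>
     {j (c \<odot>\<^bsub>A\<^esub> a) \<ominus>\<^bsub>P\<^esub> (c \<odot>\<^bsub>P\<^esub> j a) | c a. c \<in> carrier F \<and> a \<in> carrier A} \<union>
     {j \<one>\<^bsub>A\<^esub> \<ominus>\<^bsub>P\<^esub> \<one>\<^bsub>P\<^esub>}"

text \<open>The free product is the quotient of the free algebra on the disjoint union of the carriers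
  by the two-sided ideal generated by these relations for both summands.\<close>

definition fp_free ::
  "('f, 'm) ring_scheme \<Rightarrow> ('f, 'a) module \<Rightarrow> ('f, 'b) module \<Rightarrow> ('f, ('a + 'b) list \<Rightarrow> 'f) module" where
  "fp_free F A B = free_algebra F (carrier A <+> carrier B)"

definition fp_ideal ::
  "('f, 'm) ring_scheme \<Rightarrow> ('f, 'a) module \<Rightarrow> ('f, 'b) module \<Rightarrow> (('a + 'b) list \<Rightarrow> 'f) set" where
  "fp_ideal F A B = Idl\<^bsub>fp_free F A B\<^esub>
     (hom_relations F A (fp_free F A B) (\<lambda>a. gen F (Inl a)) \<union>
      hom_relations F B (fp_free F A B) (\<lambda>b. gen F (Inr b)))"

definition free_product ::
  "('f, 'm) ring_scheme \<Rightarrow> ('f, 'a) module \<Rightarrow> ('f, 'b) module \<Rightarrow>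
   ('f, (('a + 'b) list \<Rightarrow> 'f) set) module" where
  "free_product F A B = (let P = fp_free F A B; J = fp_ideal F A B; R = P Quot J in
    \<lparr>carrier = carrier R, mult = mult R, one = \<one>\<^bsub>R\<^esub>, zero = \<zero>\<^bsub>R\<^esub>, add = add R,
     smult = (\<lambda>c X. \<Union>p\<in>X. J +>\<^bsub>P\<^esub> (c \<odot>\<^bsub>P\<^esub> p))\<rparr>)"

definition incl1 ::
  "('f, 'm) ring_scheme \<Rightarrow> ('f, 'a) module \<Rightarrow> ('f, 'b) module \<Rightarrow> 'a \<Rightarrow> (('a + 'b) list \<Rightarrow> 'f) set" where
  "incl1 F A B = (\<lambda>a\<in>carrier A. fp_ideal F A B +>\<^bsub>fp_free F A B\<^esub> gen F (Inl a))"

definition incl2 ::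
  "('f, 'm) ring_scheme \<Rightarrow> ('f, 'a) module \<Rightarrow> ('f, 'b) module \<Rightarrow> 'b \<Rightarrow> (('a + 'b) list \<Rightarrow> 'f) set" where
  "incl2 F A B = (\<lambda>b\<in>carrier B. fp_ideal F A B +>\<^bsub>fp_free F A B\<^esub> gen F (Inr b))"

text \<open>The map \<open>\<langle>f, g\<rangle>\<close> from the free product of \<open>A\<close> and \<open>B\<close> to \<open>C\<close>.\<close>

definition copair ::
  "('f, 'm) ring_scheme \<Rightarrow> ('f, 'a) module \<Rightarrow> ('f, 'b) module \<Rightarrow> ('f, 'c) module \<Rightarrow>
   ('a \<Rightarrow> 'c) \<Rightarrow> ('b \<Rightarrow> 'c) \<Rightarrow> (('a + 'b) list \<Rightarrow> 'f) set \<Rightarrow> 'c" where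
  "copair F A B C f g = (THE h. h \<in> alg_hom F (free_product F A B) C \<and>
     compose (carrier A) h (incl1 F A B) = f \<and> compose (carrier B) h (incl2 F A B) = g)"

text \<open>The map \<open>f \<amalg> g\<close> from the free product of \<open>A\<close> and \<open>B\<close> to that of \<open>C\<close> and \<open>D\<close>.\<close>

definition coprod_map ::
  "('f, 'm) ring_scheme \<Rightarrow> ('f, 'a) module \<Rightarrow> ('f, 'b) module \<Rightarrow> ('f, 'c) module \<Rightarrow> ('f, 'd) module \<Rightarrow>
   ('a \<Rightarrow> 'c) \<Rightarrow> ('b \<Rightarrow> 'd) \<Rightarrow> (('a + 'b) list \<Rightarrow> 'f) set \<Rightarrow> (('c + 'd) list \<Rightarrow> 'f) set" where
  "coprod_map F A B C D f g = copair F A B (free_product F C D)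
     (compose (carrier A) (incl1 F C D) f) (compose (carrier B) (incl2 F C D) g)"

definition folding ::
  "('f, 'm) ring_scheme \<Rightarrow> ('f, 'a) module \<Rightarrow> (('a + 'a) list \<Rightarrow> 'f) set \<Rightarrow> 'a" where
  "folding F A = copair F A A A (alg_id A) (alg_id A)"

text \<open>The canonical isomorphisms between \<open>(A \<amalg> B) \<amalg> C\<close> and \<open>A \<amalg> (B \<amalg> C)\<close>, which are left
  implicit on paper.\<close>

definition assoc_right ::
  "('f, 'm) ring_scheme \<Rightarrow> ('f, 'a) module \<Rightarrow> ('f, 'b) module \<Rightarrow> ('f, 'c) module \<Rightarrow>
   (((('a + 'b) list \<Rightarrow> 'f) set + 'c) list \<Rightarrow> 'f) set \<Rightarrow>
   (('a + (('b + 'c) list \<Rightarrow> 'f) set) list \<Rightarrow> 'f) set" where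
  "assoc_right F A B C = (let BC = free_product F B C; T = free_product F A BC in
     copair F (free_product F A B) C T
       (copair F A B T (incl1 F A BC) (compose (carrier B) (incl2 F A BC) (incl1 F B C)))
       (compose (carrier C) (incl2 F A BC) (incl2 F B C)))"

definition assoc_left ::
  "('f, 'm) ring_scheme \<Rightarrow> ('f, 'a) module \<Rightarrow> ('f, 'b) module \<Rightarrow> ('f, 'c) module \<Rightarrow>
   (('a + (('b + 'c) list \<Rightarrow> 'f) set) list \<Rightarrow> 'f) set \<Rightarrow>
   (((('a + 'b) list \<Rightarrow> 'f) set + 'c) list \<Rightarrow> 'f) set" where
  "assoc_left F A B C = (let AB = free_product F A B; T = free_product F AB C in
     copair F A (free_product F B C) T
       (compose (carrier A) (incl1 F AB C) (incl1 F A B))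
       (copair F B C T (compose (carrier B) (incl1 F AB C) (incl2 F A B)) (incl2 F AB C)))"

section \<open>Coloops\<close>

locale coloop =
  fixes F :: "('f, 'm) ring_scheme" and H :: "('f, 'h) module"
    and \<Delta> \<delta>r \<delta>l :: "'h \<Rightarrow> (('h + 'h) list \<Rightarrow> 'f) set"
    and \<epsilon> :: "'h \<Rightarrow> 'f"
  assumes algebra: "unital_algebra F H"
    and comult_hom: "\<Delta> \<in> alg_hom F H (free_product F H H)"
    and rcodiv_hom: "\<delta>r \<in> alg_hom F H (free_product F H H)"
    and lcodiv_hom: "\<delta>l \<in> alg_hom F H (free_product F H H)"
    and counit_hom: "\<epsilon> \<in> alg_hom F H (base_algebra F)"
    and counit_left:
      "compose (carrier H) (coprod_map F H H (base_algebra F) H \<epsilon> (alg_id H)) \<Delta>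
        = incl2 F (base_algebra F) H"
    and counit_right:
      "compose (carrier H) (coprod_map F H H H (base_algebra F) (alg_id H) \<epsilon>) \<Delta>
        = incl1 F H (base_algebra F)"
    and rcodiv_comult:
      "compose (carrier H) (coprod_map F H (free_product F H H) H H (alg_id H) (folding F H))
         (compose (carrier H) (assoc_right F H H H)
           (compose (carrier H) (coprod_map F H H (free_product F H H) H \<delta>r (alg_id H)) \<Delta>))
        = incl1 F H H"
    and comult_rcodiv:
      "compose (carrier H) (coprod_map F H (free_product F H H) H H (alg_id H) (folding F H))
         (compose (carrier H) (assoc_right F H H H)
           (compose (carrier H) (coprod_map F H H (free_product F H H) H \<Delta> (alg_id H)) \<delta>r))
        = incl1 F H H"
    and lcodiv_comult:
      "compose (carrier H) (coprod_map F (free_product F H H) H H H (folding F H) (alg_id H))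
         (compose (carrier H) (assoc_left F H H H)
           (compose (carrier H) (coprod_map F H H H (free_product F H H) (alg_id H) \<delta>l) \<Delta>))
        = incl2 F H H"
    and comult_lcodiv:
      "compose (carrier H) (coprod_map F (free_product F H H) H H H (folding F H) (alg_id H))
         (compose (carrier H) (assoc_left F H H H)
           (compose (carrier H) (coprod_map F H H H (free_product F H H) (alg_id H) \<Delta>) \<delta>l))
        = incl2 F H H"

text \<open>The composite \<open>\<mu>\<^sub>A (\<alpha> \<amalg> \<beta>) D\<close> for a co-operation \<open>D\<close> of \<open>H\<close>.\<close>

definition convolution ::
  "('f, 'm) ring_scheme \<Rightarrow> ('f, 'h) module \<Rightarrow> ('f, 'a) module \<Rightarrow>
   ('h \<Rightarrow> (('h + 'h) list \<Rightarrow> 'f) set) \<Rightarrow> ('h \<Rightarrow> 'a) \<Rightarrow> ('h \<Rightarrow> 'a) \<Rightarrow> 'h \<Rightarrow> 'a" where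
  "convolution F H A D \<alpha> \<beta> =
     compose (carrier H) (folding F A) (compose (carrier H) (coprod_map F H H A A \<alpha> \<beta>) D)"

definition hom_loop ::
  "('f, 'm) ring_scheme \<Rightarrow> ('f, 'h) module \<Rightarrow>
   ('h \<Rightarrow> (('h + 'h) list \<Rightarrow> 'f) set) \<Rightarrow> ('h \<Rightarrow> (('h + 'h) list \<Rightarrow> 'f) set) \<Rightarrow>
   ('h \<Rightarrow> (('h + 'h) list \<Rightarrow> 'f) set) \<Rightarrow> ('h \<Rightarrow> 'f) \<Rightarrow> ('f, 'a) module \<Rightarrow> ('h \<Rightarrow> 'a) loop" where
  "hom_loop F H \<Delta> \<delta>r \<delta>l \<epsilon> A =
    \<lparr>carrier = alg_hom F H A,
     mult = convolution F H A \<Delta>,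
     one = compose (carrier H) (alg_unit F A) \<epsilon>,
     ldiv = convolution F H A \<delta>l,
     rdiv = convolution F H A \<delta>r\<rparr>"

section \<open>Formal diffeomorphisms\<close>

definition lprod :: "('a, 'm) monoid_scheme \<Rightarrow> 'a list \<Rightarrow> 'a" where
  "lprod A xs = foldr (mult A) xs \<one>\<^bsub>A\<^esub>"

definition diff_carrier :: "('a, 'm) ring_scheme \<Rightarrow> (nat \<Rightarrow> 'a) set" where
  "diff_carrier A = {a. a 0 = \<one>\<^bsub>A\<^esub> \<and> (\<forall>n. a n \<in> carrier A)}"

definition diff_mult :: "('a, 'm) ring_scheme \<Rightarrow> (nat \<Rightarrow> 'a) \<Rightarrow> (nat \<Rightarrow> 'a) \<Rightarrow> nat \<Rightarrow> 'a" where
  "diff_mult A a b = (\<lambda>n. \<Oplus>\<^bsub>A\<^esub>m\<in>{..n}.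
     \<Oplus>\<^bsub>A\<^esub>k\<in>{k. length k = m + 1 \<and> sum_list k = n - m}. a m \<otimes>\<^bsub>A\<^esub> lprod A (map b k))"

text \<open>The divisions are the unique solutions of the corresponding equations; that these exist
  is part of \<open>Diff A\<close> being a loop.\<close>

definition Diff :: "('a, 'm) ring_scheme \<Rightarrow> (nat \<Rightarrow> 'a) loop" where
  "Diff A =
    \<lparr>carrier = diff_carrier A,
     mult = diff_mult A,
     one = (\<lambda>n. if n = 0 then \<one>\<^bsub>A\<^esub> else \<zero>\<^bsub>A\<^esub>),
     ldiv = (\<lambda>a b. THE c. c \<in> diff_carrier A \<and> diff_mult A a c = b),
     rdiv = (\<lambda>a b. THE c. c \<in> diff_carrier A \<and> diff_mult A c b = a)\<rparr>"

definition Diff_map :: "('a, 'm) ring_scheme \<Rightarrow> ('a \<Rightarrow> 'b) \<Rightarrow> (nat \<Rightarrow> 'a) \<Rightarrow> nat \<Rightarrow> 'b" where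
  "Diff_map A f = (\<lambda>a\<in>diff_carrier A. \<lambda>n. f (a n))"

section \<open>Combinatorial coefficients\<close>

text \<open>Sequences $(n_1, \dots, n_\ell)$ are lists with 0-based access: $n_i$ is \<open>ns ! (i - 1)\<close>.\<close>

definition compositions :: "nat \<Rightarrow> nat \<Rightarrow> nat list set" where
  "compositions n l = {ns. length ns = l \<and> sum_list ns = n \<and> (\<forall>k\<in>set ns. k \<ge> 1)}"

definition Mseq :: "nat \<Rightarrow> nat list set" where
  "Mseq l = {ms. length ms = l \<and> sum_list ms = l \<and> (\<forall>j. 1 \<le> j \<and> j \<le> l - 1 \<longrightarrow> sum_list (take j ms) \<ge> j)}"

text \<open>For the empty list, this is 1, as required.\<close>

definition dcoeff :: "nat list \<Rightarrow> nat" where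
  "dcoeff ns = (\<Sum>ms\<in>Mseq (length ns). \<Prod>i<length ns. (ns ! i + 1) choose (ms ! i))"

definition Eseq :: "nat \<Rightarrow> nat list set" where
  "Eseq l = {es. length es = l \<and> set es \<subseteq> {1, 2}}"

definition Mseq_e :: "nat list \<Rightarrow> nat list set" where
  "Mseq_e es = {ms \<in> Mseq (length es). \<forall>i<length es. es ! i = 2 \<longrightarrow> ms ! i = 0}"

definition dcoeff_e :: "nat list \<Rightarrow> nat list \<Rightarrow> nat" where
  "dcoeff_e es ns = (\<Sum>ms\<in>Mseq_e es. \<Prod>i<length ns. (ns ! i + 1) choose (ms ! i))"

definition esign :: "nat list \<Rightarrow> int" where
  "esign es = (-1) ^ (sum_list es - length es)"

definition pick :: "'b \<Rightarrow> 'b \<Rightarrow> nat \<Rightarrow> 'b" where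
  "pick x y e = (if e = 1 then x else y)"

section \<open>The Faa di Bruno coloop bialgebra\<close>

text \<open>The generator $x_n$ is \<^term>\<open>gen F n\<close>, for $n \ge 1$.\<close>

definition FdB :: "('f, 'm) ring_scheme \<Rightarrow> ('f, nat list \<Rightarrow> 'f) module" where
  "FdB F = free_algebra F {1..}"

type_synonym 'f FdB2 = "(((nat list \<Rightarrow> 'f) + (nat list \<Rightarrow> 'f)) list \<Rightarrow> 'f) set"

text \<open>The images $x_n$ and $y_n$ of the generator under the two inclusions of \<open>FdB F\<close> into its
  free product with itself.\<close>

definition gen1 :: "('f, 'm) ring_scheme \<Rightarrow> nat \<Rightarrow> 'f FdB2" where
  "gen1 F n = incl1 F (FdB F) (FdB F) (gen F n)"

definition gen2 :: "('f, 'm) ring_scheme \<Rightarrow> nat \<Rightarrow> 'f FdB2" where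
  "gen2 F n = incl2 F (FdB F) (FdB F) (gen F n)"

definition FdB_comult :: "('f, 'm) ring_scheme \<Rightarrow> (nat list \<Rightarrow> 'f) \<Rightarrow> 'f FdB2" where
  "FdB_comult F = (let T = free_product F (FdB F) (FdB F); x = gen1 F; y = gen2 F in
    free_ext F {1..} T (\<lambda>n.
      x n \<oplus>\<^bsub>T\<^esub> y n \<oplus>\<^bsub>T\<^esub>
      (\<Oplus>\<^bsub>T\<^esub>l\<in>{1..n - 1}. \<Oplus>\<^bsub>T\<^esub>ns\<in>compositions n (l + 1).
         [((ns ! 0 + 1) choose l)] \<cdot>\<^bsub>T\<^esub> (x (ns ! 0) \<otimes>\<^bsub>T\<^esub> lprod T (map y (tl ns))))))"

definition FdB_counit :: "('f, 'm) ring_scheme \<Rightarrow> (nat list \<Rightarrow> 'f) \<Rightarrow> 'f" where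
  "FdB_counit F = free_ext F {1..} (base_algebra F) (\<lambda>n. \<zero>\<^bsub>F\<^esub>)"

definition FdB_rcodiv :: "('f, 'm) ring_scheme \<Rightarrow> (nat list \<Rightarrow> 'f) \<Rightarrow> 'f FdB2" where
  "FdB_rcodiv F = (let T = free_product F (FdB F) (FdB F); x = gen1 F; y = gen2 F in
    free_ext F {1..} T (\<lambda>n.
      \<Oplus>\<^bsub>T\<^esub>l\<in>{0..n - 1}. \<Oplus>\<^bsub>T\<^esub>ns\<in>compositions n (l + 1).
         [((-1) ^ l * int (dcoeff (take l ns)))] \<cdot>\<^bsub>T\<^esub>
           ((x (ns ! 0) \<ominus>\<^bsub>T\<^esub> y (ns ! 0)) \<otimes>\<^bsub>T\<^esub> lprod T (map y (tl ns)))))"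

definition FdB_lcodiv :: "('f, 'm) ring_scheme \<Rightarrow> (nat list \<Rightarrow> 'f) \<Rightarrow> 'f FdB2" where
  "FdB_lcodiv F = (let T = free_product F (FdB F) (FdB F); x = gen1 F; y = gen2 F in
    free_ext F {1..} T (\<lambda>n.
      (y n \<ominus>\<^bsub>T\<^esub> x n) \<oplus>\<^bsub>T\<^esub>
      (\<Oplus>\<^bsub>T\<^esub>l\<in>{1..n - 1}. \<Oplus>\<^bsub>T\<^esub>ns\<in>compositions n (l + 1). \<Oplus>\<^bsub>T\<^esub>es\<in>Eseq l.
         [((-1) ^ l * esign es * int (dcoeff_e es (take l ns)))] \<cdot>\<^bsub>T\<^esub>
           (lprod T (map (\<lambda>i. pick x y (es ! i) (ns ! i)) [0..<l]) \<otimes>\<^bsub>T\<^esub>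
            (y (ns ! l) \<ominus>\<^bsub>T\<^esub> x (ns ! l))))))"

definition FdB_hom_loop ::
  "('f, 'm) ring_scheme \<Rightarrow> ('f, 'a) module \<Rightarrow> ((nat list \<Rightarrow> 'f) \<Rightarrow> 'a) loop" where
  "FdB_hom_loop F A =
     hom_loop F (FdB F) (FdB_comult F) (FdB_rcodiv F) (FdB_lcodiv F) (FdB_counit F) A"

text \<open>The bijection between algebra homomorphisms on \<open>FdB F\<close> and series in \<open>Diff A\<close>, in both
  directions.\<close>

definition hom_to_series ::
  "('f, 'm) ring_scheme \<Rightarrow> ('f, 'a) module \<Rightarrow> ((nat list \<Rightarrow> 'f) \<Rightarrow> 'a) \<Rightarrow> nat \<Rightarrow> 'a" where
  "hom_to_series F A \<alpha> = (\<lambda>n. if n = 0 then \<one>\<^bsub>A\<^esub> else \<alpha> (gen F n))"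

definition series_to_hom ::
  "('f, 'm) ring_scheme \<Rightarrow> ('f, 'a) module \<Rightarrow> (nat \<Rightarrow> 'a) \<Rightarrow> (nat list \<Rightarrow> 'f) \<Rightarrow> 'a" where
  "series_to_hom F A a = free_ext F {1..} A a"

end

theory Submission
  imports Defs "HOL-Computational_Algebra.Polynomial"
begin

text \<open>Words in the letters \<open>a\<^sub>n\<close> and \<open>b\<^sub>n\<close> reduce both division formulas to integer identities.
  The recursion \<open>c\<^sub>n = b\<^sub>n - (\<Sum>\<^sub>m a\<^sub>m (\<Sum>\<^sub>j (m + 1 choose j) c\<cdots>c))\<close> for \<open>c = a \ b\<close> unfolds into plane trees
  whose nodes are labelled by \<open>a\<close>-letters or by \<open>b\<close>-letters, the latter being leaves; reading a tree in preorder
  gives a word, its child counts form a sequence in \<open>\<M>\<^sub>\<ell>\<close>, and each \<open>a\<close>-letter contributes a sign. The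
  last node is always a leaf with either label, whence the factor \<open>b - a\<close>. For \<open>a / b\<close> the required
  identity between the numbers \<open>d\<^sub>\<ell>\<close> says that a random walk which loses 1 per step and wins a
  binomial number is absorbed with total probability 1. Since composition is determined degree by degree,
  solutions are unique, so the divisions are preserved by algebra homomorphisms; the coloop axioms
  are then the loop axioms of \<open>Diff\<close> for the two universal series in the free product.\<close>

section \<open>Counting forests\<close>

text \<open>The binomials (n + 1 choose j) come from the n + 1 factors b in a_n b^(n+1): each
  contributes either its leading coefficient 1 or a term of positive degree, and j of them do the
  latter. Coefficients do not commute and may have any characteristic, so a series is expanded as an
  integral combination of words, and composition acts on the integer coefficient functions alone
  (\<open>word_subst\<close>). Only one law per division is computed on words, the one saying that
  the quotient solves its equation; the other follows from cancellation. The walk is treated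
  formally: its absorption probability is an integer polynomial in s, and surviving N steps from
  position 1 forces at least N wins, so the probability differs from 1 by a multiple of s^N. The
  coefficient of s^(N-1) is the alternating identity behind a / b. For the coloop axioms, the long
  composites with re-association and folding collapse to a co-operation followed by a map <D, i_2>
  or <i_1, D> out of the coproduct, and there the co-operation acts as the corresponding operation
  of \<open>Diff\<close>.\<close>

fun forest_count :: "nat \<Rightarrow> (nat \<times> nat) list \<Rightarrow> nat" where
  "forest_count 0 w = (if w = [] then 1 else 0)"
| "forest_count (Suc j) [] = 0"
| "forest_count (Suc j) ((e, n) # w) =
     (if e = 2 then forest_count j w
      else (\<Sum>i\<le>n + 1. ((n + 1) choose i) * forest_count (j + i) w))"

lemma forest_count_Nil: "forest_count j [] = (if j = 0 then 1 else 0)"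
  by (cases j) auto

text \<open>Every tree uses up at least the letter of its root.\<close>

lemma forest_count_eq_0: "length w < j \<Longrightarrow> forest_count j w = 0"
proof (induction w arbitrary: j)
  case Nil
  then show ?case by (simp add: forest_count_Nil)
next
  case (Cons x w)
  then show ?case by (cases j; cases x) auto
qed

text \<open>\<open>forest_count j w\<close> is the weighted number of forests of \<open>j\<close>
  plane trees with preorder word \<open>w\<close>: a node (e, n) is a leaf if e = 2 and otherwise
  has i children with weight (n + 1 choose i). Such a forest has exactly one cut between its first
  \<open>j\<close> and its last \<open>k\<close> trees. The induction reads the root of the first
  tree and puts its children in its place, so \<open>j\<close> has to vary.\<close>

lemma forest_count_add:
  "forest_count (j + k) w = (\<Sum>i\<le>length w. forest_count j (take i w) * forest_count k (drop i w))"
proof (induction w arbitrary: j)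
  case Nil
  then show ?case by (auto simp: forest_count_Nil)
next
  case (Cons x w)
  obtain e n where x: "x = (e, n)" by (cases x)
  show ?case
  proof (cases j)
    case 0
    have "(\<Sum>i\<le>length (x # w). forest_count j (take i (x # w)) * forest_count k (drop i (x # w)))
        = (\<Sum>i\<in>{0}. forest_count j (take i (x # w)) * forest_count k (drop i (x # w)))"
      by (rule sum.mono_neutral_right) (auto simp: 0 take_Cons')
    then show ?thesis by (simp add: 0)
  next
    case (Suc j')
    have "(\<Sum>i\<le>length (x # w). forest_count j (take i (x # w)) * forest_count k (drop i (x # w)))
        = (\<Sum>i\<le>length w. forest_count j (x # take i w) * forest_count k (drop i w))"
      unfolding length_Cons by (subst sum.atMost_Suc_shift) (simp add: Suc)
    also have "\<dots> = forest_count (j + k) (x # w)"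
    proof (cases "e = 2")
      case True
      then show ?thesis using Cons.IH[of j'] by (simp add: Suc x)
    next
      case False
      have "(\<Sum>i\<le>length w. forest_count j (x # take i w) * forest_count k (drop i w))
         = (\<Sum>i\<le>length w. \<Sum>r\<le>n + 1. ((n + 1) choose r) *
             (forest_count (j' + r) (take i w) * forest_count k (drop i w)))"
        using False
        by (simp add: Suc x sum_distrib_right mult.assoc del: sum.atMost_Suc binomial_Suc_Suc)
      also have "\<dots> = (\<Sum>r\<le>n + 1. ((n + 1) choose r) * forest_count (j' + r + k) w)"
        by (subst sum.swap) (simp only: sum_distrib_left Cons.IH)
      finally show ?thesis using False by (simp add: Suc x add.commute add.left_commute)
    qed
    finally show ?thesis by simp
  qed
qed

text \<open>Child counts of all nodes except the last, which is always a leaf. Before node i is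
  read, j + m_0 + ... + m_(i-1) - i trees are pending, and this must be positive; after all of
  \<open>es\<close> exactly one is pending. The conditions are stated additively to avoid truncated
  subtraction.\<close>

definition Mseq_forest :: "nat \<Rightarrow> nat list \<Rightarrow> nat list set" where
  "Mseq_forest j es = {ms. length ms = length es \<and> j + sum_list ms = length es + 1 \<and>
     (\<forall>i<length es. i + 1 \<le> j + sum_list (take i ms)) \<and>
     (\<forall>i<length es. es ! i = 2 \<longrightarrow> ms ! i = 0)}"

lemma finite_Mseq_forest: "finite (Mseq_forest j es)"
proof (rule finite_subset)
  show "Mseq_forest j es \<subseteq> {ms. set ms \<subseteq> {..length es + 1} \<and> length ms = length es}"
    unfolding Mseq_forest_def using member_le_sum_list by fastforce
qed (simp add: finite_lists_length_eq)

lemma Mseq_forest_Nil: "Mseq_forest j [] = (if j = 1 then {[]} else {})"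
  by (auto simp: Mseq_forest_def)

lemma Mseq_forest_0: "Mseq_forest 0 (e # es) = {}"
  by (auto simp: Mseq_forest_def intro: exI[of _ 0])

lemma Cons_in_Mseq_forest:
  "m # ms \<in> Mseq_forest (Suc j) (e # es) \<longleftrightarrow> ms \<in> Mseq_forest (j + m) es \<and> (e = 2 \<longrightarrow> m = 0)"
  unfolding Mseq_forest_def by (auto simp: All_less_Suc2 add.assoc)

lemma Mseq_forest_Suc:
  "Mseq_forest (Suc j) (e # es) =
     (\<lambda>(m, ms). m # ms) ` (SIGMA m:(if e = 2 then {0} else UNIV). Mseq_forest (j + m) es)"
proof (intro equalityI subsetI)
  fix x assume x: "x \<in> Mseq_forest (Suc j) (e # es)"
  then obtain m ms where "x = m # ms"
    by (cases x) (auto simp: Mseq_forest_def)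
  with x show "x \<in> (\<lambda>(m, ms). m # ms) ` (SIGMA m:(if e = 2 then {0} else UNIV). Mseq_forest (j + m) es)"
    by (auto simp: Cons_in_Mseq_forest)
qed (auto simp: Cons_in_Mseq_forest split: if_splits)

text \<open>The last letter \<open>z\<close> is always a leaf, so it does not contribute to the weight.\<close>

lemma forest_count_Mseq:
  assumes "length es = length ns"
  shows "forest_count j (zip es ns @ [z])
    = (\<Sum>ms\<in>Mseq_forest j es. \<Prod>i<length ns. (ns ! i + 1) choose (ms ! i))"
  using assms
proof (induction es ns arbitrary: j rule: list_induct2)
  case Nil
  obtain e n where "z = (e, n)" by (cases z)
  then show ?case
    by (cases j) (auto simp: Mseq_forest_Nil forest_count_Nil if_distrib cong: if_cong)
next
  case (Cons e es n ns)
  let ?g = "\<lambda>ns ms. \<Prod>i<length ns. (ns ! i + 1) choose (ms ! i)"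
  have g: "?g (n # ns) (m # ms) = ((n + 1) choose m) * ?g ns ms" for m ms
    by (simp add: prod.lessThan_Suc_shift del: prod.lessThan_Suc)
  show ?case
  proof (cases j)
    case 0
    then show ?thesis by (simp add: Mseq_forest_0)
  next
    case (Suc j')
    \<comment> \<open>\<open>Mseq_forest_Suc\<close> lets the first child count range over all
      numbers; above n + 1 its binomial weight is 0, so a finite range suffices.\<close>
    define I where "I = (if e = 2 then {0} else {..n + 1})"
    have "(\<Sum>ms\<in>Mseq_forest j (e # es). ?g (n # ns) ms)
        = (\<Sum>ms\<in>(\<lambda>(m, ms). m # ms) ` (SIGMA m:I. Mseq_forest (j' + m) es). ?g (n # ns) ms)"
    proof (rule sum.mono_neutral_right)
      show "finite (Mseq_forest j (e # es))" by (rule finite_Mseq_forest)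
      show "(\<lambda>(m, ms). m # ms) ` (SIGMA m:I. Mseq_forest (j' + m) es) \<subseteq> Mseq_forest j (e # es)"
        by (auto simp: Suc Mseq_forest_Suc I_def split: if_splits)
      show "\<forall>ms\<in>Mseq_forest j (e # es) - (\<lambda>(m, ms). m # ms) ` (SIGMA m:I. Mseq_forest (j' + m) es).
          ?g (n # ns) ms = 0"
      proof
        fix x assume "x \<in> Mseq_forest j (e # es) - (\<lambda>(m, ms). m # ms) ` (SIGMA m:I. Mseq_forest (j' + m) es)"
        then obtain m ms where x: "x = m # ms" "m \<notin> I" "e \<noteq> 2"
          by (auto simp: Suc Mseq_forest_Suc I_def split: if_splits)
        then have "(n + 1) choose m = 0"
          by (simp add: I_def)
        then show "?g (n # ns) x = 0" by (simp only: x(1) g mult_zero_left)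
      qed
    qed
    also have "\<dots> = (\<Sum>(m, ms)\<in>(SIGMA m:I. Mseq_forest (j' + m) es). ?g (n # ns) (m # ms))"
      by (subst sum.reindex) (auto simp: inj_on_def intro!: sum.cong)
    also have "\<dots> = (\<Sum>m\<in>I. \<Sum>ms\<in>Mseq_forest (j' + m) es. ?g (n # ns) (m # ms))"
      by (rule sum.Sigma[symmetric]) (auto simp: I_def finite_Mseq_forest)
    also have "\<dots> = (\<Sum>m\<in>I. ((n + 1) choose m) * forest_count (j' + m) (zip es ns @ [z]))"
      by (simp only: g Cons.IH sum_distrib_left)
    also have "\<dots> = forest_count j (zip (e # es) (n # ns) @ [z])"
      by (simp add: Suc I_def)
    finally show ?thesis by simp
  qed
qed

text \<open>For a single tree the positivity of the pending count, i + 1 \<le> 1 + (m_1 + ... +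
  m_i), is the defining inequality of \<open>Mseq\<close>; the additional case i = 0 is
  trivial.\<close>

lemma Mseq_e_eq_Mseq_forest: "Mseq_e es = Mseq_forest 1 es"
proof -
  have "(\<forall>j. 1 \<le> j \<and> j \<le> length es - 1 \<longrightarrow> j \<le> sum_list (take j ms)) \<longleftrightarrow>
      (\<forall>i<length es. i \<le> sum_list (take i ms))" for ms
  proof (intro iffI allI impI)
    fix i assume "\<forall>j. 1 \<le> j \<and> j \<le> length es - 1 \<longrightarrow> j \<le> sum_list (take j ms)" "i < length es"
    then show "i \<le> sum_list (take i ms)" by (cases "i = 0") auto
  qed auto
  then show ?thesis
    by (auto simp: Mseq_e_def Mseq_def Mseq_forest_def)
qed

lemma dcoeff_e_eq_forest_count:
  "length es = length ns \<Longrightarrow> dcoeff_e es ns = forest_count 1 (zip es ns @ [z])"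
  by (simp add: dcoeff_e_def Mseq_e_eq_Mseq_forest forest_count_Mseq)

lemma dcoeff_eq_dcoeff_e: "dcoeff ns = dcoeff_e (replicate (length ns) 1) ns"
  by (auto simp: dcoeff_def dcoeff_e_def Mseq_e_def intro!: sum.cong)

text \<open>No label 2 occurs, so no node is forced to be a leaf: these words give the unrestricted
  counts \<open>dcoeff\<close>.\<close>

definition first_word :: "nat list \<Rightarrow> (nat \<times> nat) list" where
  "first_word = map (Pair 1)"

text \<open>The appended \<open>n\<close> belongs to the final leaf, which has weight (n + 1 choose
  0) = 1.\<close>

lemma dcoeff_eq_forest_count: "dcoeff ns = forest_count 1 (first_word (ns @ [n]))"
proof -
  have "zip (replicate (length ns) 1) ns = first_word ns"
    by (simp add: first_word_def zip_replicate1)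
  then show ?thesis
    using dcoeff_e_eq_forest_count[of "replicate (length ns) 1" ns "(1, n)"]
    by (simp add: dcoeff_eq_dcoeff_e first_word_def)
qed

text \<open>The probability, as a polynomial in the success probability \<open>s\<close>, that a walk started
  at \<open>j\<close> reaches 0 within \<open>length ns\<close> steps, where the step at the letter \<open>n\<close> consists
  in losing 1 and winning the number of successes in \<open>n + 1\<close> trials.\<close>

fun walk :: "nat \<Rightarrow> nat list \<Rightarrow> int poly" where
  "walk 0 ns = 1"
| "walk (Suc j) [] = 0"
| "walk (Suc j) (n # ns) =
     (\<Sum>i\<le>n + 1. of_nat ((n + 1) choose i) * [:0, 1:] ^ i * [:1, -1:] ^ (n + 1 - i) * walk (j + i) ns)"

text \<open>A walk from \<open>j\<close> that survives all steps has won at least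
  \<open>length ns + 1 - j\<close> times, and every win carries a factor s =
  \<open>[:0, 1:]\<close>. Hence this power of s divides the survival probability.\<close>

lemma walk_dvd: "[:0, 1:] ^ (length ns + 1 - j) dvd walk j ns - 1"
proof (induction ns arbitrary: j)
  case Nil
  then show ?case by (cases j) auto
next
  case (Cons n ns)
  show ?case
  proof (cases j)
    case 0
    then show ?thesis by simp
  next
    case (Suc j')
    define c :: "nat \<Rightarrow> int poly" where
      "c i = of_nat ((n + 1) choose i) * [:0, 1:] ^ i * [:1, -1:] ^ (n + 1 - i)" for i
    \<comment> \<open>The weights of one step add up to (s + (1 - s))^(n + 1) = 1, so the constant 1
      can be distributed over the summands and the induction hypothesis applies to each of
      them.\<close>
    have "(\<Sum>i\<le>n + 1. c i) = ([:0, 1:] + [:1, -1:]) ^ (n + 1)"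
      unfolding c_def by (rule binomial_ring[symmetric])
    moreover have "[:0, 1:] + [:1, -1:] = (1 :: int poly)" by (simp add: one_pCons)
    ultimately have c1: "(\<Sum>i\<le>n + 1. c i) = 1" by (simp only: power_one)
    have "walk j (n # ns) - 1 = (\<Sum>i\<le>n + 1. c i * walk (j' + i) ns) - (\<Sum>i\<le>n + 1. c i)"
      unfolding c1 by (simp only: Suc walk.simps c_def)
    also have "\<dots> = (\<Sum>i\<le>n + 1. c i * (walk (j' + i) ns - 1))"
      by (simp add: sum_subtractf algebra_simps)
    finally have eq: "walk j (n # ns) - 1 = (\<Sum>i\<le>n + 1. c i * (walk (j' + i) ns - 1))" .
    show ?thesis unfolding eq
    proof (rule dvd_sum)
      fix i
      have "[:0, 1:] ^ i dvd c i" by (simp add: c_def)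
      then have "[:0, 1:] ^ i * [:0, 1:] ^ (length ns + 1 - (j' + i)) dvd c i * (walk (j' + i) ns - 1)"
        using Cons.IH by (rule mult_dvd_mono)
      then show "[:0, 1:] ^ (length (n # ns) + 1 - j) dvd c i * (walk (j' + i) ns - 1)"
        by (rule dvd_trans[rotated]) (auto simp: Suc power_add[symmetric] intro!: le_imp_power_dvd)
    qed
  qed
qed

text \<open>The sum runs over the time k of absorption. Up to then there are k - j wins among as
  many trials as the sum of all n_i + 1, which leaves \<open>sum_list (take k ns) + j\<close>
  failures; first passage through 0 at step k is the preorder condition for a forest of
  \<open>j\<close> trees with k nodes. For k < j the exponent is truncated, but the forest count is
  0.\<close>

lemma walk_eq_sum:
  "walk j ns = (\<Sum>k\<le>length ns. of_nat (forest_count j (first_word (take k ns))) *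
     [:0, 1:] ^ (k - j) * [:1, -1:] ^ (sum_list (take k ns) + j))"
proof (induction ns arbitrary: j)
  case Nil
  then show ?case by (cases j) (auto simp: first_word_def)
next
  case (Cons n ns)
  let ?t = "\<lambda>j ns k. of_nat (forest_count j (first_word (take k ns))) *
     [:0, 1:] ^ (k - j) * [:1, -1:] ^ (sum_list (take k ns) + j) :: int poly"
  show ?case
  proof (cases j)
    case 0
    have "(\<Sum>k\<le>length (n # ns). ?t j (n # ns) k) = (\<Sum>k\<in>{0}. ?t j (n # ns) k)"
      by (rule sum.mono_neutral_right) (auto simp: 0 first_word_def take_Cons')
    then show ?thesis by (simp add: 0 first_word_def)
  next
    case (Suc j')
    have step: "of_nat ((n + 1) choose i) * [:0, 1:] ^ i * [:1, -1:] ^ (n + 1 - i) * ?t (j' + i) ns k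
      = of_nat (((n + 1) choose i) * forest_count (j' + i) (first_word (take k ns))) *
     [:0, 1:] ^ (k - j') * [:1, -1:] ^ (sum_list (take k ns) + n + j)" if "i \<le> n + 1" for i k
    proof (cases "j' + i \<le> k")
      case True
      then have "k - j' = i + (k - (j' + i))"
        "sum_list (take k ns) + n + j = (n + 1 - i) + (sum_list (take k ns) + (j' + i))"
        using that Suc by auto
      then show ?thesis by (simp only: power_add of_nat_mult ac_simps)
    next
      case False
      then have "forest_count (j' + i) (first_word (take k ns)) = 0"
        by (intro forest_count_eq_0) (simp add: first_word_def)
      then show ?thesis by simp
    qed
    have "walk j (n # ns) = (\<Sum>i\<le>n + 1. \<Sum>k\<le>length ns.
        of_nat (((n + 1) choose i) * forest_count (j' + i) (first_word (take k ns))) *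
        [:0, 1:] ^ (k - j') * [:1, -1:] ^ (sum_list (take k ns) + n + j))"
      unfolding Suc walk.simps Cons.IH sum_distrib_left
      by (intro sum.cong refl, subst step) (auto simp: Suc)
    also have "\<dots> = (\<Sum>k\<le>length ns. \<Sum>i\<le>n + 1. 
        of_nat (((n + 1) choose i) * forest_count (j' + i) (first_word (take k ns))) *
        [:0, 1:] ^ (k - j') * [:1, -1:] ^ (sum_list (take k ns) + n + j))"
      by (rule sum.swap)
    also have "\<dots> = (\<Sum>k\<le>length ns. ?t j (n # ns) (Suc k))"
    proof (rule sum.cong[OF refl])
      fix k
      have "forest_count j (first_word (take (Suc k) (n # ns))) =
          (\<Sum>i\<le>n + 1. ((n + 1) choose i) * forest_count (j' + i) (first_word (take k ns)))"
        by (simp add: Suc first_word_def)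
      moreover have "sum_list (take (Suc k) (n # ns)) = sum_list (take k ns) + n" "Suc k - j = k - j'"
        by (simp_all add: Suc)
      ultimately show "(\<Sum>i\<le>n + 1.
        of_nat (((n + 1) choose i) * forest_count (j' + i) (first_word (take k ns))) *
        [:0, 1:] ^ (k - j') * [:1, -1:] ^ (sum_list (take k ns) + n + j)) = ?t j (n # ns) (Suc k)"
        by (simp only: of_nat_sum sum_distrib_right)
    qed
    also have "\<dots> = (\<Sum>k\<le>length (n # ns). ?t j (n # ns) k)"
      unfolding length_Cons by (subst sum.atMost_Suc_shift) (simp add: Suc first_word_def)
    finally show ?thesis .
  qed
qed

lemma coeff_X_power_one_minus_X_power:
  "coeff ([:0, 1:] ^ i * [:1, -1:] ^ m :: int poly) k
     = (if k < i then 0 else (-1) ^ (k - i) * int (m choose (k - i)))"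
proof -
  have "[:0, 1:] ^ i = (monom 1 i :: int poly)"
    by (metis monom_altdef smult_1_left)
  moreover have "coeff ([:1, -1:] ^ m) r = (-1) ^ r * int (m choose r)" for r
  proof (cases "r \<le> m")
    case False
    have "degree ([:1, -1 :: int:] ^ m) \<le> m"
      using degree_power_le[of "[:1, -1 :: int:]" m] by simp
    with False show ?thesis by (simp add: coeff_eq_0 binomial_eq_0)
  qed (simp add: coeff_linear_poly_power)
  ultimately show ?thesis
    by (simp add: coeff_monom_mult)
qed

text \<open>Both sides are the coefficient of s^(N - 1) in the absorption probability from position
  1, where N = \<open>length ns\<close>. By \<open>walk_dvd\<close> it agrees with that of the
  constant 1; by \<open>walk_eq_sum\<close> the summand k is a multiple of s^(k - 1) (1 - s)^(S_k +
  1) with the partial sum S_k.\<close>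

lemma alternating_sum_forest_count:
  assumes "ns \<noteq> []"
  shows "(\<Sum>k\<le>length ns. (-1) ^ (length ns - k) * int ((sum_list (take k ns) + 1) choose (length ns - k)) *
     int (forest_count 1 (first_word (take k ns)))) = (if length ns = 1 then 1 else 0)"
proof -
  obtain l where l: "length ns = Suc l" using assms by (cases ns) auto
  have "coeff (walk 1 ns - 1) l = 0"
  proof -
    obtain q where "walk 1 ns - 1 = [:0, 1:] ^ Suc l * q"
      using walk_dvd[of ns 1] l by (auto elim: dvdE)
    moreover have "[:0, 1:] ^ Suc l = (monom 1 (Suc l) :: int poly)"
      by (metis monom_altdef smult_1_left)
    ultimately show ?thesis by (simp only: coeff_monom_mult) simp
  qed
  then have "coeff (walk 1 ns) l = (if l = 0 then 1 else 0)"
    by (simp add: coeff_1 split: if_splits)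
  moreover have "coeff (walk 1 ns) l = (\<Sum>k\<le>Suc l.
      (-1) ^ (Suc l - k) * int ((sum_list (take k ns) + 1) choose (Suc l - k)) *
     int (forest_count 1 (first_word (take k ns))))"
    unfolding walk_eq_sum l coeff_sum
  proof (rule sum.cong[OF refl])
    fix k assume k: "k \<in> {..Suc l}"
    show "coeff (of_nat (forest_count 1 (first_word (take k ns))) * [:0, 1:] ^ (k - 1) *
          [:1, -1:] ^ (sum_list (take k ns) + 1)) l
      = (-1) ^ (Suc l - k) * int ((sum_list (take k ns) + 1) choose (Suc l - k)) *
     int (forest_count 1 (first_word (take k ns)))"
    \<comment> \<open>For k = 0 the exponent k - 1 is truncated, but the factor
      \<open>forest_count 1 []\<close> is 0.\<close>
    proof (cases k)
      case 0
      then show ?thesis by (simp add: first_word_def)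
    next
      case (Suc k')
      have "coeff (of_nat c * p) i = int c * coeff p i" for c i and p :: "int poly"
        by (simp add: of_nat_poly)
      then show ?thesis using k
        by (simp only: mult.assoc coeff_X_power_one_minus_X_power) (simp add: Suc)
    qed
  qed
  ultimately show ?thesis by (simp add: l)
qed

section \<open>Coefficient functions on words\<close>

definition word_weight :: "(nat \<times> nat) list \<Rightarrow> nat" where
  "word_weight w = sum_list (map snd w)"

definition conv :: "('x list \<Rightarrow> int) \<Rightarrow> ('x list \<Rightarrow> int) \<Rightarrow> 'x list \<Rightarrow> int" where
  "conv p q w = (\<Sum>i\<le>length w. p (take i w) * q (drop i w))"

fun conv_pow :: "('x list \<Rightarrow> int) \<Rightarrow> nat \<Rightarrow> 'x list \<Rightarrow> int" where
  "conv_pow p 0 = (\<lambda>w. if w = [] then 1 else 0)"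
| "conv_pow p (Suc m) = conv p (conv_pow p m)"

text \<open>Composition on coefficient functions: the prefix comes from a_m, where m is its weight,
  and the suffix from the m + 1 factors b behind it.\<close>

definition word_subst ::
  "((nat \<times> nat) list \<Rightarrow> int) \<Rightarrow> ((nat \<times> nat) list \<Rightarrow> int) \<Rightarrow> (nat \<times> nat) list \<Rightarrow> int" where
  "word_subst p q w =
     (\<Sum>i\<le>length w. p (take i w) * conv_pow q (word_weight (take i w) + 1) (drop i w))"

text \<open>The series whose n-th coefficient is the letter (e, n); the empty word stands for the
  leading coefficient 1. Label 1 is the left operand, label 2 the right one.\<close>

definition letter_coeff :: "nat \<Rightarrow> (nat \<times> nat) list \<Rightarrow> int" where
  "letter_coeff e w = (if w = [] \<or> (\<exists>n. w = [(e, n)]) then 1 else 0)"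

text \<open>Expansion of (a - b) b ... b into words: the first label is free and decides the sign,
  all others are 2. The labels are then erased, because the numbers d depend on the indices only;
  the last letter is the final leaf, so the count is d of all indices but the last.\<close>

definition rdiv_coeff :: "(nat \<times> nat) list \<Rightarrow> int" where
  "rdiv_coeff w = (if w = [] then 1 else if \<forall>x\<in>set (tl w). fst x = 2 then
     (if fst (hd w) = 1 then 1 else -1) * (-1) ^ (length w - 1) *
       int (forest_count 1 (first_word (map snd w)))
     else 0)"

definition word_sign :: "(nat \<times> nat) list \<Rightarrow> int" where
  "word_sign w = prod_list (map (\<lambda>x. if fst x = 2 then 1 else -1) w)"

text \<open>Signed trees, together with the empty word for the leading coefficient 1;
  \<open>forest_count 1 []\<close> is 0, so the two summands do not overlap.\<close>

definition ldiv_coeff :: "(nat \<times> nat) list \<Rightarrow> int" where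
  "ldiv_coeff w = (if w = [] then 1 else 0) + word_sign w * int (forest_count 1 w)"

lemma word_sign_Cons: "word_sign (x # w) = (if fst x = 2 then 1 else -1) * word_sign w"
  by (simp add: word_sign_def)

lemma word_sign_Nil [simp]: "word_sign [] = 1"
  by (simp add: word_sign_def)

lemma word_sign_append: "word_sign (u @ v) = word_sign u * word_sign v"
  by (simp add: word_sign_def)

lemma conv_Nil: "conv p q [] = p [] * q []"
  by (simp add: conv_def)

lemma conv_Cons: "conv p q (x # w) = p [] * q (x # w) + conv (\<lambda>u. p (x # u)) q w"
  unfolding conv_def length_Cons by (subst sum.atMost_Suc_shift) simp

lemma conv_pow_1: "conv_pow p (Suc 0) w = p w"
proof -
  have "conv_pow p (Suc 0) w = (\<Sum>i\<in>{length w}. p (take i w) * (if drop i w = [] then 1 else 0))"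
    unfolding conv_pow.simps conv_def by (rule sum.mono_neutral_right) auto
  then show ?thesis by simp
qed

lemma letter_coeff_Cons: "letter_coeff e (x # w) = (if fst x = e \<and> w = [] then 1 else 0)"
  by (cases x) (auto simp: letter_coeff_def)

text \<open>Each of the \<open>m\<close> factors supplies the empty word or one letter; the binomial
  chooses the factors that supply a letter.\<close>

lemma conv_pow_letter_coeff:
  "conv_pow (letter_coeff e) m w = (if \<forall>x\<in>set w. fst x = e then int (m choose length w) else 0)"
proof (induction m arbitrary: w)
  case 0
  then show ?case by auto
next
  case (Suc m)
  show ?case
  proof (cases w)
    case Nil
    then show ?thesis using Suc[of "[]"] by (simp add: conv_Nil letter_coeff_def)
  next
    case (Cons x w')
    have "conv (\<lambda>u. letter_coeff e (x # u)) (conv_pow (letter_coeff e) m) w'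
       = (\<Sum>i\<in>{0}. letter_coeff e (x # take i w') * conv_pow (letter_coeff e) m (drop i w'))"
      unfolding conv_def by (rule sum.mono_neutral_right) (auto simp: letter_coeff_Cons)
    also have "\<dots> = (if fst x = e then conv_pow (letter_coeff e) m w' else 0)"
      by (simp add: letter_coeff_Cons)
    finally show ?thesis
      by (simp add: Cons conv_Cons Suc) (simp add: letter_coeff_def)
  qed
qed

text \<open>Power of "1 + trees": j of the \<open>m\<close> factors supply a tree, these trees form
  a forest, and signs multiply under concatenation. The induction splits off one factor, uses
  \<open>forest_count_add\<close> for the part with a tree, and ends with the Pascal rule.\<close>

lemma conv_pow_ldiv_coeff:
  "conv_pow ldiv_coeff m w =
     word_sign w * (\<Sum>j\<le>m. int (m choose j) * int (forest_count j w))"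
proof (induction m arbitrary: w)
  case 0
  then show ?case by simp
next
  case (Suc m)
  let ?P = "conv_pow ldiv_coeff m"
  have sgn: "word_sign w = word_sign (take i w) * word_sign (drop i w)" for i
    by (metis append_take_drop_id word_sign_append)
  have "conv ldiv_coeff ?P w =
      (\<Sum>i\<le>length w. (if take i w = [] then 1 else 0) * ?P (drop i w)) +
      (\<Sum>i\<le>length w. word_sign (take i w) * int (forest_count 1 (take i w)) * ?P (drop i w))"
    by (simp only: conv_def ldiv_coeff_def distrib_right sum.distrib)
  also have "(\<Sum>i\<le>length w. (if take i w = [] then 1 else 0) * ?P (drop i w))
      = (\<Sum>i\<in>{0}. (if take i w = [] then 1 else 0) * ?P (drop i w))"
    by (rule sum.mono_neutral_right) auto
  also have "\<dots> = word_sign w * (\<Sum>j\<le>m. int (m choose j) * int (forest_count j w))"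
    by (simp add: Suc)
  also have "(\<Sum>i\<le>length w. word_sign (take i w) * int (forest_count 1 (take i w)) * ?P (drop i w))
      = (\<Sum>i\<le>length w. \<Sum>j\<le>m. word_sign w * (int (m choose j) *
           int (forest_count 1 (take i w) * forest_count j (drop i w))))"
    by (intro sum.cong refl, subst sgn) (simp add: Suc sum_distrib_left mult_ac)
  also have "\<dots> = word_sign w * (\<Sum>j\<le>m. int (m choose j) * int (forest_count (1 + j) w))"
    unfolding forest_count_add by (subst sum.swap) (simp add: sum_distrib_left)
  also have "word_sign w * (\<Sum>j\<le>m. int (m choose j) * int (forest_count j w)) + \<dots>
      = word_sign w * (\<Sum>j\<le>Suc m. int (Suc m choose j) * int (forest_count j w))"
  proof -
    have "(\<Sum>j\<le>Suc m. int (Suc m choose j) * int (forest_count j w))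
      = int (forest_count 0 w) + (\<Sum>j\<le>m. (int (m choose j) + int (m choose Suc j)) * int (forest_count (Suc j) w))"
      by (subst sum.atMost_Suc_shift) simp
    also have "\<dots> = (\<Sum>j\<le>m. int (m choose j) * int (forest_count (1 + j) w)) +
        (\<Sum>j\<le>Suc m. int (m choose j) * int (forest_count j w))"
      by (subst sum.atMost_Suc_shift) (simp add: distrib_right sum.distrib)
    also have "(\<Sum>j\<le>Suc m. int (m choose j) * int (forest_count j w))
        = (\<Sum>j\<le>m. int (m choose j) * int (forest_count j w))"
      by simp
    finally show ?thesis by (simp only: distrib_left add.commute)
  qed
  finally show ?case by simp
qed

text \<open>Only prefixes of length 0 and 1 matter. The empty prefix gives the trees on the whole
  word, a prefix consisting of one a-letter gives the forests below that root. If the word starts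
  with an a-letter the two cancel, since the root has sign -1; if it starts with a b-letter, the
  tree is a single leaf.\<close>

lemma word_subst_ldiv_coeff:
  assumes "fst ` set w \<subseteq> {1, 2}"
  shows "word_subst (letter_coeff 1) ldiv_coeff w = letter_coeff 2 w"
proof (cases w)
  case Nil
  then show ?thesis
    by (simp add: word_subst_def letter_coeff_def conv_Nil ldiv_coeff_def word_weight_def)
next
  case (Cons x w')
  obtain e n where x: "x = (e, n)" by (cases x)
  have "word_subst (letter_coeff 1) ldiv_coeff w
      = ldiv_coeff w + (\<Sum>i\<le>length w'. letter_coeff 1 (x # take i w') *
          conv_pow ldiv_coeff (n + word_weight (take i w') + 1) (drop i w'))"
    unfolding word_subst_def Cons length_Cons
    by (subst sum.atMost_Suc_shift)
      (simp add: x letter_coeff_def word_weight_def conv_pow_1 del: conv_pow.simps(2))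
  also have "(\<Sum>i\<le>length w'. letter_coeff 1 (x # take i w') *
          conv_pow ldiv_coeff (n + word_weight (take i w') + 1) (drop i w'))
      = (\<Sum>i\<in>{0}. letter_coeff 1 (x # take i w') *
          conv_pow ldiv_coeff (n + word_weight (take i w') + 1) (drop i w'))"
    by (rule sum.mono_neutral_right) (auto simp: letter_coeff_Cons)
  also have "\<dots> = (if e = 1 then conv_pow ldiv_coeff (n + 1) w' else 0)"
    by (simp add: letter_coeff_Cons x word_weight_def)
  also have "ldiv_coeff w + \<dots> = letter_coeff 2 w"
  proof (cases "e = 2")
    case True
    then show ?thesis
      by (auto simp: Cons x ldiv_coeff_def letter_coeff_Cons word_sign_Cons)
  next
    case False
    then have "e = 1" using assms by (auto simp: Cons x)
    then have "ldiv_coeff w = - conv_pow ldiv_coeff (n + 1) w'"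
      unfolding conv_pow_ldiv_coeff
      by (simp add: Cons x ldiv_coeff_def word_sign_Cons)
    then show ?thesis using \<open>e = 1\<close> by (simp add: Cons x letter_coeff_Cons)
  qed
  finally show ?thesis .
qed

text \<open>A suffix of label 2 behind a prefix of weight S is counted by (S + 1 choose its length).
  Up to a global sign, the sum over the nonempty prefixes is therefore the sum in
  \<open>alternating_sum_forest_count\<close>.\<close>

lemma word_subst_rdiv_coeff:
  assumes "fst ` set w \<subseteq> {1, 2}"
  shows "word_subst rdiv_coeff (letter_coeff 2) w = letter_coeff 1 w"
proof (cases w)
  case Nil
  then show ?thesis
    by (simp add: word_subst_def letter_coeff_def conv_Nil rdiv_coeff_def word_weight_def)
next
  case (Cons x w')
  obtain e n where x: "x = (e, n)" by (cases x)
  let ?B = "\<lambda>i. conv_pow (letter_coeff 2) (word_weight (take i w) + 1) (drop i w)"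
  show ?thesis
  proof (cases "\<forall>y\<in>set w'. fst y = 2")
    case False
    \<comment> \<open>A letter behind the first position with label other than 2 lies either in the
      tail of the prefix or in the suffix, and makes the corresponding factor vanish.\<close>
    have "rdiv_coeff (take i w) * ?B i = 0" for i
    proof (cases i)
      case 0
      then show ?thesis using False
        by (auto simp: Cons conv_pow_letter_coeff simp del: conv_pow.simps)
    next
      case (Suc i')
      have "set w' = set (take i' w') \<union> set (drop i' w')"
        by (metis append_take_drop_id set_append)
      then have "(\<exists>y\<in>set (take i' w'). fst y \<noteq> 2) \<or> (\<exists>y\<in>set (drop i' w'). fst y \<noteq> 2)"
        using False by auto
      then show ?thesis
        by (auto simp: Cons Suc conv_pow_letter_coeff rdiv_coeff_def simp del: conv_pow.simps)
    qed
    moreover have "letter_coeff 1 w = 0" using False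
      by (auto simp: Cons letter_coeff_Cons)
    ultimately show ?thesis
      unfolding word_subst_def by (simp only: sum.neutral_const)
  next
    case True
    define ns where "ns = map snd w"
    have ns: "length ns = length w" "ns \<noteq> []" by (simp_all add: ns_def Cons)
    define s :: int where "s = (if e = 1 then 1 else -1)"
    have weight: "word_weight (take i w) = sum_list (take i ns)" for i
      by (simp add: word_weight_def ns_def take_map)
    define t where "t i = (-1) ^ (length ns - i) * int ((sum_list (take i ns) + 1) choose (length ns - i)) *
       int (forest_count 1 (first_word (take i ns)))" for i
    have t0: "t 0 = 0" by (simp add: t_def first_word_def)
    \<comment> \<open>The prefix has sign (-1)^i up to \<open>s\<close>, while \<open>t\<close>
      carries (-1)^(length w' - i); they differ by the constant (-1)^(length w').\<close>
    have *: "rdiv_coeff (take (Suc i) w) * ?B (Suc i) = s * (-1) ^ length w' * t (Suc i)"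
      if "i \<le> length w'" for i
    proof -
      have "\<forall>y\<in>set (take i w'). fst y = 2" "\<forall>y\<in>set (drop i w'). fst y = 2"
        using True by (meson in_set_takeD in_set_dropD)+
      moreover have "(-1) ^ length w' * (-1) ^ (length w' - i) = (-1 :: int) ^ i"
        using that by (metis le_add_diff_inverse left_minus_one_mult_self mult.commute power_add)
      moreover have "take (Suc i) ns = n # map snd (take i w')"
        by (simp add: ns_def Cons x take_map)
      ultimately show ?thesis using that
        by (simp add: weight conv_pow_letter_coeff t_def del: conv_pow.simps)
          (simp add: rdiv_coeff_def Cons x s_def ns_def)
    qed
    have "word_subst rdiv_coeff (letter_coeff 2) w
        = ?B 0 + (\<Sum>i\<le>length w'. rdiv_coeff (take (Suc i) w) * ?B (Suc i))"
    proof -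
      have "rdiv_coeff [] = 1" "length w = Suc (length w')"
        by (simp_all add: rdiv_coeff_def Cons)
      then show ?thesis
        unfolding word_subst_def by (simp only: sum.atMost_Suc_shift take_0 mult_1)
    qed
    also have "(\<Sum>i\<le>length w'. rdiv_coeff (take (Suc i) w) * ?B (Suc i))
        = s * (-1) ^ length w' * (\<Sum>i\<le>length w'. t (Suc i))"
      unfolding sum_distrib_left by (rule sum.cong[OF refl], rule *) simp
    also have "(\<Sum>i\<le>length w'. t (Suc i)) = (\<Sum>i\<le>length ns. t i)"
      by (simp add: ns Cons sum.atMost_Suc_shift t0 del: sum.atMost_Suc)
    also have "\<dots> = (if w' = [] then 1 else 0)"
      unfolding t_def using alternating_sum_forest_count[OF ns(2)] by (simp add: ns Cons)
    \<comment> \<open>The empty prefix contributes 1 only for a one-letter word of label 2, where it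
      cancels the -1 of the alternating sum.\<close>
    finally show ?thesis using True assms
      by (auto simp: Cons x s_def letter_coeff_Cons conv_pow_letter_coeff word_weight_def
          simp del: conv_pow.simps)
  qed
qed

section \<open>Finite sums and list products in rings\<close>

lemma (in abelian_monoid) finsum_Sigma:
  assumes "finite I" "\<And>i. i \<in> I \<Longrightarrow> finite (X i)"
    and "\<And>i x. i \<in> I \<Longrightarrow> x \<in> X i \<Longrightarrow> f i x \<in> carrier G"
  shows "(\<Oplus>i\<in>I. \<Oplus>x\<in>X i. f i x) = (\<Oplus>z\<in>Sigma I X. f (fst z) (snd z))"
proof -
  have "(\<Oplus>z\<in>Sigma I X. f (fst z) (snd z)) = (\<Oplus>z\<in>(\<Union>i\<in>I. Pair i ` X i). f (fst z) (snd z))"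
    by (rule arg_cong[where f = "finsum G _"]) auto
  also have "\<dots> = (\<Oplus>i\<in>I. \<Oplus>z\<in>Pair i ` X i. f (fst z) (snd z))"
    by (rule add.finprod_UN_disjoint) (use assms in \<open>auto simp: pairwise_def disjnt_def\<close>)
  also have "\<dots> = (\<Oplus>i\<in>I. \<Oplus>x\<in>X i. f i x)"
  proof (rule add.finprod_cong'[OF refl])
    fix i assume "i \<in> I"
    then show "(\<Oplus>z\<in>Pair i ` X i. f (fst z) (snd z)) = (\<Oplus>x\<in>X i. f i x)"
      by (subst add.finprod_reindex) (use assms in \<open>auto simp: inj_on_def\<close>)
  qed (use assms in auto)
  finally show ?thesis ..
qed

lemma (in abelian_monoid) finsum_bij_betw:
  assumes "bij_betw h I J" "\<And>j. j \<in> J \<Longrightarrow> f j \<in> carrier G"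
  shows "(\<Oplus>j\<in>J. f j) = (\<Oplus>i\<in>I. f (h i))"
  using assms unfolding bij_betw_def by (auto intro!: add.finprod_reindex)

lemma (in abelian_monoid) finsum_eq_single:
  assumes "finite I" "i \<in> I" "f i \<in> carrier G" "\<And>j. j \<in> I \<Longrightarrow> j \<noteq> i \<Longrightarrow> f j = \<zero>"
  shows "finsum G f I = f i"
proof -
  have "finsum G f I = finsum G f {i}"
    by (rule add.finprod_mono_neutral_cong_right) (use assms in fastforce)+
  with assms show ?thesis by simp
qed

lemma (in ring) int_zero_smult [simp]: "[(0 :: int)] \<cdot> x = \<zero>"
  by (simp add: add_pow_def)

lemma (in ring) int_pow_sum:
  assumes "finite I" "x \<in> carrier R"
  shows "[(\<Sum>i\<in>I. f i :: int)] \<cdot> x = (\<Oplus>i\<in>I. [f i] \<cdot> x)"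
  using assms by (induction I rule: finite_induct) (simp_all add: add.int_pow_mult)

lemma (in ring) finsum_mult_finsum:
  assumes "finite I" "finite J" "\<And>i. i \<in> I \<Longrightarrow> f i \<in> carrier R" "\<And>j. j \<in> J \<Longrightarrow> g j \<in> carrier R"
  shows "finsum R f I \<otimes> finsum R g J = (\<Oplus>i\<in>I. \<Oplus>j\<in>J. f i \<otimes> g j)"
  using assms by (subst finsum_ldistr) (auto intro!: add.finprod_cong' finsum_closed finsum_rdistr)

lemma lprod_Nil [simp]: "lprod R [] = \<one>\<^bsub>R\<^esub>"
  by (simp add: lprod_def)

lemma lprod_Cons: "lprod R (x # xs) = x \<otimes>\<^bsub>R\<^esub> lprod R xs"
  by (simp add: lprod_def)

context monoid
begin

lemma lprod_closed [simp]: "set xs \<subseteq> carrier G \<Longrightarrow> lprod G xs \<in> carrier G"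
  by (induction xs) (auto simp: lprod_Cons)

lemma lprod_append:
  "set xs \<subseteq> carrier G \<Longrightarrow> set ys \<subseteq> carrier G \<Longrightarrow> lprod G (xs @ ys) = lprod G xs \<otimes> lprod G ys"
  by (induction xs) (auto simp: lprod_Cons m_assoc)

end

section \<open>Composition of series\<close>

fun series_power :: "('a, 'm) ring_scheme \<Rightarrow> (nat \<Rightarrow> 'a) \<Rightarrow> nat \<Rightarrow> nat \<Rightarrow> 'a" where
  "series_power R b 0 = (\<lambda>n. if n = 0 then \<one>\<^bsub>R\<^esub> else \<zero>\<^bsub>R\<^esub>)"
| "series_power R b (Suc m) = (\<lambda>n. \<Oplus>\<^bsub>R\<^esub>i\<in>{..n}. b i \<otimes>\<^bsub>R\<^esub> series_power R b m (n - i))"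

definition weak_compositions :: "nat \<Rightarrow> nat \<Rightarrow> nat list set" where
  "weak_compositions m n = {k. length k = m \<and> sum_list k = n}"

lemma finite_weak_compositions [simp]: "finite (weak_compositions m n)"
proof (rule finite_subset)
  show "weak_compositions m n \<subseteq> {k. set k \<subseteq> {..n} \<and> length k = m}"
    unfolding weak_compositions_def using member_le_sum_list by fastforce
qed (simp add: finite_lists_length_eq)

lemma weak_compositions_Suc:
  "weak_compositions (Suc m) n = (\<lambda>(i, k). i # k) ` (SIGMA i:{..n}. weak_compositions m (n - i))"
proof (intro equalityI subsetI)
  fix x assume "x \<in> weak_compositions (Suc m) n"
  then show "x \<in> (\<lambda>(i, k). i # k) ` (SIGMA i:{..n}. weak_compositions m (n - i))"
    by (cases x) (force simp: weak_compositions_def)+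
qed (auto simp: weak_compositions_def)

context ring
begin

lemma series_power_closed [simp]:
  "(\<And>i. b i \<in> carrier R) \<Longrightarrow> series_power R b m n \<in> carrier R"
  by (induction m arbitrary: n) auto

lemma series_power_eq_finsum:
  assumes b: "\<And>i. b i \<in> carrier R"
  shows "series_power R b m n = (\<Oplus>k\<in>weak_compositions m n. lprod R (map b k))"
proof (induction m arbitrary: n)
  case 0
  have "weak_compositions 0 n = (if n = 0 then {[]} else {})"
    by (auto simp: weak_compositions_def)
  then show ?case by simp
next
  case (Suc m)
  have *: "lprod R (map b k) \<in> carrier R" for k using b by (auto intro!: lprod_closed)
  have "series_power R b (Suc m) n =
      (\<Oplus>i\<in>{..n}. \<Oplus>k\<in>weak_compositions m (n - i). lprod R (map b (i # k)))"
    unfolding series_power.simps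
    by (intro add.finprod_cong' refl) (auto simp: Suc finsum_rdistr lprod_Cons b *)
  also have "\<dots> = (\<Oplus>z\<in>(SIGMA i:{..n}. weak_compositions m (n - i)). lprod R (map b (fst z # snd z)))"
    by (rule finsum_Sigma) (use * in \<open>auto simp: lprod_Cons b\<close>)
  also have "\<dots> = (\<Oplus>k\<in>weak_compositions (Suc m) n. lprod R (map b k))"
    unfolding weak_compositions_Suc
    by (subst add.finprod_reindex) (auto simp: inj_on_def * case_prod_unfold intro!: add.finprod_cong' simp del: list.map)
  finally show ?case .
qed

lemma series_power_cong:
  assumes "\<And>i. i \<le> n \<Longrightarrow> b i = b' i" "\<And>i. b' i \<in> carrier R"
  shows "series_power R b m n = series_power R b' m n"
  using assms(1)
proof (induction m arbitrary: n)
  case (Suc m)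
  have "series_power R b m (n - i) = series_power R b' m (n - i)" if "i \<le> n" for i
    using that Suc by auto
  then show ?case
    by (auto intro!: add.finprod_cong' simp: Suc.prems assms(2))
qed auto

lemma series_power_1: "(\<And>i. b i \<in> carrier R) \<Longrightarrow> series_power R b (Suc 0) n = b n"
proof -
  assume "\<And>i. b i \<in> carrier R"
  then have "(\<Oplus>i\<in>{..n}. b i \<otimes> series_power R b 0 (n - i)) = b n \<otimes> series_power R b 0 (n - n)"
    by (intro finsum_eq_single) auto
  then show ?thesis using \<open>\<And>i. b i \<in> carrier R\<close> by simp
qed

lemma series_power_at_0: "b 0 = \<one> \<Longrightarrow> series_power R b m 0 = \<one>"
  by (induction m) auto

lemma diff_mult_eq:
  assumes "\<And>i. a i \<in> carrier R" "\<And>i. b i \<in> carrier R"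
  shows "diff_mult R a b n = (\<Oplus>m\<in>{..n}. a m \<otimes> series_power R b (Suc m) (n - m))"
proof -
  have *: "lprod R (map b k) \<in> carrier R" for k using assms by (auto intro!: lprod_closed)
  show ?thesis
    unfolding diff_mult_def
  proof (intro add.finprod_cong' refl)
    fix m
    show "(\<Oplus>k\<in>{k. length k = m + 1 \<and> sum_list k = n - m}. a m \<otimes> lprod R (map b k))
        = a m \<otimes> series_power R b (Suc m) (n - m)"
      using finite_weak_compositions[of "m + 1" "n - m"] assms *
      by (simp add: series_power_eq_finsum finsum_rdistr weak_compositions_def del: series_power.simps)
  qed (use assms in \<open>auto simp del: series_power.simps\<close>)
qed

lemma diff_carrierD: "a \<in> diff_carrier R \<Longrightarrow> a n \<in> carrier R" "a \<in> diff_carrier R \<Longrightarrow> a 0 = \<one>"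
  by (auto simp: diff_carrier_def)

lemma diff_mult_closed:
  assumes "a \<in> diff_carrier R" "b \<in> diff_carrier R"
  shows "diff_mult R a b \<in> diff_carrier R"
  using assms by (auto simp: diff_carrier_def diff_mult_eq series_power_at_0)

text \<open>The summand m = n is a_n b_0^(n+1) = a_n, and the others involve only a_m with m < n.
  This triangular shape determines the left operand.\<close>

lemma diff_mult_last:
  assumes "\<And>i. a i \<in> carrier R" "b \<in> diff_carrier R"
  shows "diff_mult R a b n = (\<Oplus>m\<in>{..<n}. a m \<otimes> series_power R b (Suc m) (n - m)) \<oplus> a n"
proof -
  have "{..n} = insert n {..<n}" by auto
  moreover have b: "\<And>i. b i \<in> carrier R" "b 0 = \<one>" using assms diff_carrierD by auto
  ultimately show ?thesis
    using assms(1)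
    by (simp add: diff_mult_eq a_comm series_power_at_0 del: series_power.simps)
qed

text \<open>The summand m = 0 is b_n; for m \<ge> 1 only b_i with i \<le> n - m < n occur, which
  determines the right operand.\<close>

lemma diff_mult_first:
  assumes "a \<in> diff_carrier R" "\<And>i. b i \<in> carrier R"
  shows "diff_mult R a b n = b n \<oplus> (\<Oplus>m\<in>{1..n}. a m \<otimes> series_power R b (Suc m) (n - m))"
proof -
  have "{..n} = insert 0 {1..n}" by auto
  moreover have a: "\<And>i. a i \<in> carrier R" "a 0 = \<one>" using assms diff_carrierD by auto
  ultimately show ?thesis
    using assms(2)
    by (simp add: diff_mult_eq series_power_1 del: series_power.simps)
qed

lemma diff_mult_right_cancel:
  assumes "a \<in> diff_carrier R" "a' \<in> diff_carrier R" "b \<in> diff_carrier R"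
    and eq: "diff_mult R a b = diff_mult R a' b"
  shows "a = a'"
proof
  note [simp] = assms(1-3)[THEN diff_carrierD(1)]
  fix n show "a n = a' n"
  proof (induction n rule: less_induct)
    case (less n)
    then have "(\<Oplus>m\<in>{..<n}. a m \<otimes> series_power R b (Suc m) (n - m))
        = (\<Oplus>m\<in>{..<n}. a' m \<otimes> series_power R b (Suc m) (n - m))"
      by (intro add.finprod_cong' refl) (auto simp del: series_power.simps)
    with fun_cong[OF eq, of n] show ?case
      using assms(3) by (simp add: diff_mult_last del: series_power.simps)
  qed
qed

lemma diff_mult_left_cancel:
  assumes "a \<in> diff_carrier R" "b \<in> diff_carrier R" "b' \<in> diff_carrier R"
    and eq: "diff_mult R a b = diff_mult R a b'"
  shows "b = b'"
proof
  note [simp] = assms(1-3)[THEN diff_carrierD(1)]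
  fix n show "b n = b' n"
  proof (induction n rule: less_induct)
    case (less n)
    have "(\<Oplus>m\<in>{1..n}. a m \<otimes> series_power R b (Suc m) (n - m))
        = (\<Oplus>m\<in>{1..n}. a m \<otimes> series_power R b' (Suc m) (n - m))"
    proof (intro add.finprod_cong' refl)
      fix m assume "m \<in> {1..n}"
      then have "series_power R b (Suc m) (n - m) = series_power R b' (Suc m) (n - m)"
        by (intro series_power_cong) (auto intro: less)
      then show "a m \<otimes> series_power R b (Suc m) (n - m) = a m \<otimes> series_power R b' (Suc m) (n - m)"
        by (simp only:)
    qed (auto simp del: series_power.simps)
    with fun_cong[OF eq, of n] show ?case
      using assms(1) by (simp add: diff_mult_first del: series_power.simps)
  qed
qed

end

section \<open>Series with values in words\<close>

text \<open>Indices start at 1 because the leading coefficient is represented by the empty word. A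
  word of weight n then has at most n letters, so there are finitely many.\<close>

definition letter_words :: "nat \<Rightarrow> (nat \<times> nat) list set" where
  "letter_words n = {w. set w \<subseteq> {1, 2} \<times> {1..} \<and> word_weight w = n}"

lemma word_weight_Nil [simp]: "word_weight [] = 0"
  by (simp add: word_weight_def)

lemma word_weight_append: "word_weight (u @ v) = word_weight u + word_weight v"
  by (simp add: word_weight_def)

lemma length_le_word_weight: "set w \<subseteq> X \<times> {1..} \<Longrightarrow> length w \<le> word_weight w"
  by (induction w) (auto simp: word_weight_def)

lemma finite_letter_words [simp]: "finite (letter_words n)"
proof (rule finite_subset)
  show "letter_words n \<subseteq> {w. set w \<subseteq> {1, 2} \<times> {..n} \<and> length w \<le> n}"
  proof
    fix w assume w: "w \<in> letter_words n"
    then have "snd x \<le> n" if "x \<in> set w" for x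
      using that member_le_sum_list[of "snd x" "map snd w"]
      by (auto simp: letter_words_def word_weight_def)
    with w show "w \<in> {w. set w \<subseteq> {1, 2} \<times> {..n} \<and> length w \<le> n}"
      using length_le_word_weight[of w] by (fastforce simp: letter_words_def)
  qed
qed (intro finite_lists_length_le, simp)

definition pair_value :: "(nat \<Rightarrow> 'a) \<Rightarrow> (nat \<Rightarrow> 'a) \<Rightarrow> nat \<times> nat \<Rightarrow> 'a" where
  "pair_value a b x = pick a b (fst x) (snd x)"

definition word_series ::
  "('a, 'm) ring_scheme \<Rightarrow> (nat \<times> nat \<Rightarrow> 'a) \<Rightarrow> ((nat \<times> nat) list \<Rightarrow> int) \<Rightarrow> nat \<Rightarrow> 'a" where
  "word_series R v p n = (\<Oplus>\<^bsub>R\<^esub>w\<in>letter_words n. [p w] \<cdot>\<^bsub>R\<^esub> lprod R (map v w))"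

text \<open>The weight of the prefix is kept as a component of its own, since it is the summation
  index of the Cauchy product.\<close>

lemma bij_betw_cut_word:
  "bij_betw (\<lambda>(w, k). ((word_weight (take k w), take k w), drop k w))
     (SIGMA w:letter_words n. {..length w})
     (SIGMA x:(SIGMA i:{..n}. letter_words i). letter_words (n - fst x))"
proof (rule bij_betw_byWitness[where f' = "\<lambda>((i, u), v). (u @ v, length u)"])
  have "word_weight (take k w) + word_weight (drop k w) = word_weight w" for k w
    by (metis append_take_drop_id word_weight_append)
  then have "word_weight (take k w) \<le> word_weight w"
    "word_weight (drop k w) = word_weight w - word_weight (take k w)" for k w
    by (metis le_add1, metis diff_add_inverse)
  then show "(\<lambda>(w, k). ((word_weight (take k w), take k w), drop k w)) ` (SIGMA w:letter_words n. {..length w})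
    \<subseteq> (SIGMA x:(SIGMA i:{..n}. letter_words i). letter_words (n - fst x))"
    by (auto simp: letter_words_def dest!: in_set_takeD in_set_dropD)
qed (auto simp: letter_words_def word_weight_append)

context ring
begin

context
  fixes v :: "nat \<times> nat \<Rightarrow> 'a"
  assumes v [simp]: "\<And>x. v x \<in> carrier R"
begin

lemma word_closed [simp]: "lprod R (map v w) \<in> carrier R"
  by (auto intro!: lprod_closed)

lemma word_series_closed [simp]: "word_series R v p n \<in> carrier R"
  unfolding word_series_def by auto

text \<open>A Cauchy product whose second factor may depend on the degree i of the first. A constant
  \<open>q\<close> yields powers of series; taking for \<open>q i\<close> the power with exponent i
  + 1 yields composition.\<close>

lemma word_series_mult:
  "(\<Oplus>i\<in>{..n}. word_series R v p i \<otimes> word_series R v (q i) (n - i))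
    = word_series R v (\<lambda>w. \<Sum>k\<le>length w. p (take k w) * q (word_weight (take k w)) (drop k w)) n"
proof -
  let ?L = "\<lambda>w. lprod R (map v w)"
  have L: "([i] \<cdot> ?L u) \<otimes> ([j] \<cdot> ?L w) = [(i * j)] \<cdot> ?L (u @ w)" for i j :: int and u w
    using add.int_pow_pow[of "?L u \<otimes> ?L w" j i]
    by (simp add: lprod_append image_subset_iff add_pow_ldistr_int add_pow_rdistr_int mult.commute)
  have "(\<Oplus>i\<in>{..n}. word_series R v p i \<otimes> word_series R v (q i) (n - i))
    = (\<Oplus>i\<in>{..n}. \<Oplus>u\<in>letter_words i. \<Oplus>w\<in>letter_words (n - i). [(p u * q i w)] \<cdot> ?L (u @ w))"
  proof (intro add.finprod_cong' refl)
    fix i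
    show "word_series R v p i \<otimes> word_series R v (q i) (n - i)
      = (\<Oplus>u\<in>letter_words i. \<Oplus>w\<in>letter_words (n - i). [(p u * q i w)] \<cdot> ?L (u @ w))"
      unfolding word_series_def by (subst finsum_mult_finsum) (simp_all add: L del: map_append)
  qed (auto simp del: map_append)
  also have "\<dots> = (\<Oplus>x\<in>(SIGMA i:{..n}. letter_words i).
      \<Oplus>w\<in>letter_words (n - fst x). [(p (snd x) * q (fst x) w)] \<cdot> ?L (snd x @ w))"
    by (rule finsum_Sigma) (auto simp del: map_append)
  also have "\<dots> = (\<Oplus>z\<in>(SIGMA x:(SIGMA i:{..n}. letter_words i). letter_words (n - fst x)).
      [(p (snd (fst z)) * q (fst (fst z)) (snd z))] \<cdot> ?L (snd (fst z) @ snd z))"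
    by (rule finsum_Sigma) (auto simp del: map_append)
  also have "\<dots> = (\<Oplus>z\<in>(SIGMA w:letter_words n. {..length w}).
      [(p (take (snd z) (fst z)) * q (word_weight (take (snd z) (fst z))) (drop (snd z) (fst z)))] \<cdot> ?L (fst z))"
    by (subst finsum_bij_betw[OF bij_betw_cut_word])
      (auto simp del: map_append intro!: add.finprod_cong')
  also have "\<dots> = (\<Oplus>w\<in>letter_words n. \<Oplus>k\<in>{..length w}.
      [(p (take k w) * q (word_weight (take k w)) (drop k w))] \<cdot> ?L w)"
    by (rule finsum_Sigma[symmetric]) auto
  also have "\<dots> = word_series R v (\<lambda>w. \<Sum>k\<le>length w. p (take k w) * q (word_weight (take k w)) (drop k w)) n"
    unfolding word_series_def by (intro add.finprod_cong' refl) (auto simp: int_pow_sum)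
  finally show ?thesis .
qed

lemma letter_words_0: "letter_words 0 = {[]}"
proof
  show "letter_words 0 \<subseteq> {[]}"
    using length_le_word_weight[of _ "{1, 2}"] by (fastforce simp: letter_words_def)
qed (simp add: letter_words_def)

lemma word_series_0: "word_series R v p 0 = [p []] \<cdot> \<one>"
  by (simp add: word_series_def letter_words_0)

lemma Nil_in_letter_words: "[] \<in> letter_words n \<longleftrightarrow> n = 0"
  by (auto simp: letter_words_def word_weight_def)

lemma series_power_word_series:
  "series_power R (word_series R v p) m n = word_series R v (conv_pow p m) n"
proof (induction m arbitrary: n)
  case 0
  show ?case
  proof (cases "n = 0")
    case False
    then have "word_series R v (conv_pow p 0) n = (\<Oplus>w\<in>letter_words n. \<zero>)"
      unfolding word_series_def
      by (intro add.finprod_cong' refl) (auto simp: Nil_in_letter_words)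
    with False show ?thesis by simp
  qed (simp add: word_series_0)
next
  case (Suc m)
  have "series_power R (word_series R v p) (Suc m) n
      = (\<Oplus>i\<in>{..n}. word_series R v p i \<otimes> word_series R v (conv_pow p m) (n - i))"
    by (simp add: Suc)
  then show ?case
    by (simp add: word_series_mult conv_def[abs_def])
qed

lemma diff_mult_word_series:
  "diff_mult R (word_series R v p) (word_series R v q) = word_series R v (word_subst p q)"
  by (rule ext, subst diff_mult_eq)
    (simp_all add: series_power_word_series word_series_mult word_subst_def[abs_def] del: series_power.simps conv_pow.simps)

lemma word_series_cong:
  assumes "\<And>w. fst ` set w \<subseteq> {1, 2} \<Longrightarrow> p w = q w"
  shows "word_series R v p = word_series R v q"
proof
  fix n
  have "p w = q w" if "w \<in> letter_words n" for w
    using that by (intro assms) (auto simp: letter_words_def)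
  then show "word_series R v p n = word_series R v q n"
    unfolding word_series_def by (intro add.finprod_cong' refl) auto
qed

lemma word_series_letter_coeff:
  assumes "e \<in> {1, 2}" "n \<ge> 1"
  shows "word_series R v (letter_coeff e) n = v (e, n)"
proof -
  have "word_series R v (letter_coeff e) n = [letter_coeff e [(e, n)]] \<cdot> lprod R (map v [(e, n)])"
    unfolding word_series_def
  proof (rule finsum_eq_single)
    show "[(e, n)] \<in> letter_words n"
      using assms by (auto simp: letter_words_def word_weight_def)
    fix w assume "w \<in> letter_words n" "w \<noteq> [(e, n)]"
    then have "letter_coeff e w = 0" using assms
      by (auto simp: letter_coeff_def letter_words_def word_weight_def)
    then show "[letter_coeff e w] \<cdot> lprod R (map v w) = \<zero>" by simp
  qed auto
  then show ?thesis
    by (simp add: letter_coeff_def lprod_Cons)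
qed

lemma word_series_in_diff_carrier: "p [] = 1 \<Longrightarrow> word_series R v p \<in> diff_carrier R"
  by (simp add: diff_carrier_def word_series_0)

end

section \<open>Quotients as word series and the loop laws of \<open>Diff\<close>\<close>

definition rdiv_series :: "(nat \<Rightarrow> 'a) \<Rightarrow> (nat \<Rightarrow> 'a) \<Rightarrow> nat \<Rightarrow> 'a" where
  "rdiv_series a b = word_series R (pair_value a b) rdiv_coeff"

definition ldiv_series :: "(nat \<Rightarrow> 'a) \<Rightarrow> (nat \<Rightarrow> 'a) \<Rightarrow> nat \<Rightarrow> 'a" where
  "ldiv_series a b = word_series R (pair_value a b) ldiv_coeff"

context
  fixes a b
  assumes ab: "a \<in> diff_carrier R" "b \<in> diff_carrier R"
begin

lemma pair_value_closed: "pair_value a b x \<in> carrier R"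
  using ab by (auto simp: pair_value_def pick_def diff_carrierD)

lemma word_series_letter_coeff_1: "word_series R (pair_value a b) (letter_coeff 1) = a"
proof
  fix n show "word_series R (pair_value a b) (letter_coeff 1) n = a n"
  proof (cases "n = 0")
    case True
    then show ?thesis
      using ab by (simp add: word_series_0[OF pair_value_closed] letter_coeff_def diff_carrierD)
  next
    case False
    then show ?thesis
      by (subst word_series_letter_coeff[OF pair_value_closed]) (auto simp: pair_value_def pick_def)
  qed
qed

lemma word_series_letter_coeff_2: "word_series R (pair_value a b) (letter_coeff 2) = b"
proof
  fix n show "word_series R (pair_value a b) (letter_coeff 2) n = b n"
  proof (cases "n = 0")
    case True
    then show ?thesis
      using ab by (simp add: word_series_0[OF pair_value_closed] letter_coeff_def diff_carrierD)
  next
    case False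
    then show ?thesis
      by (subst word_series_letter_coeff[OF pair_value_closed]) (auto simp: pair_value_def pick_def)
  qed
qed

lemma rdiv_series_closed: "rdiv_series a b \<in> diff_carrier R"
  unfolding rdiv_series_def
  by (intro word_series_in_diff_carrier pair_value_closed) (simp add: rdiv_coeff_def)

lemma ldiv_series_closed: "ldiv_series a b \<in> diff_carrier R"
  unfolding ldiv_series_def
  by (intro word_series_in_diff_carrier pair_value_closed) (simp add: ldiv_coeff_def)

lemma rdiv_series_mult: "diff_mult R (rdiv_series a b) b = a"
proof -
  have "diff_mult R (rdiv_series a b) b
      = word_series R (pair_value a b) (word_subst rdiv_coeff (letter_coeff 2))"
    using diff_mult_word_series[of "pair_value a b" rdiv_coeff "letter_coeff 2", OF pair_value_closed]
    by (simp only: word_series_letter_coeff_2 rdiv_series_def)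
  also have "\<dots> = word_series R (pair_value a b) (letter_coeff 1)"
    by (intro word_series_cong pair_value_closed word_subst_rdiv_coeff)
  finally show ?thesis by (simp only: word_series_letter_coeff_1)
qed

lemma mult_ldiv_series: "diff_mult R a (ldiv_series a b) = b"
proof -
  have "diff_mult R a (ldiv_series a b)
      = word_series R (pair_value a b) (word_subst (letter_coeff 1) ldiv_coeff)"
    using diff_mult_word_series[of "pair_value a b" "letter_coeff 1" ldiv_coeff, OF pair_value_closed]
    by (simp only: word_series_letter_coeff_1 ldiv_series_def)
  also have "\<dots> = word_series R (pair_value a b) (letter_coeff 2)"
    by (intro word_series_cong pair_value_closed word_subst_ldiv_coeff)
  finally show ?thesis by (simp only: word_series_letter_coeff_2)
qed

text \<open>Turns the definite description in \<open>Diff\<close> into an equation to be checked;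
  uniqueness is right cancellation.\<close>

lemma rdiv_Diff_unique: "c \<in> diff_carrier R \<Longrightarrow> diff_mult R c b = a \<Longrightarrow> rdiv (Diff R) a b = c"
  using ab by (auto simp: Diff_def intro!: the_equality intro: diff_mult_right_cancel)

lemma ldiv_Diff_unique: "c \<in> diff_carrier R \<Longrightarrow> diff_mult R a c = b \<Longrightarrow> ldiv (Diff R) a b = c"
  using ab by (auto simp: Diff_def intro!: the_equality intro: diff_mult_left_cancel)

lemma rdiv_Diff_eq: "rdiv (Diff R) a b = rdiv_series a b"
  by (intro rdiv_Diff_unique rdiv_series_closed rdiv_series_mult)

lemma ldiv_Diff_eq: "ldiv (Diff R) a b = ldiv_series a b"
  by (intro ldiv_Diff_unique ldiv_series_closed mult_ldiv_series)

end

lemma one_Diff_closed: "\<one>\<^bsub>Diff R\<^esub> \<in> diff_carrier R"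
  by (simp add: Diff_def diff_carrier_def)

lemma series_power_one_Diff: "series_power R \<one>\<^bsub>Diff R\<^esub> m n = (if n = 0 then \<one> else \<zero>)"
proof (induction m arbitrary: n)
  case (Suc m)
  have "series_power R \<one>\<^bsub>Diff R\<^esub> (Suc m) n = \<one>\<^bsub>Diff R\<^esub> 0 \<otimes> series_power R \<one>\<^bsub>Diff R\<^esub> m (n - 0)"
    unfolding series_power.simps by (intro finsum_eq_single) (auto simp: Suc, auto simp: Diff_def)
  then show ?case by (simp add: Suc) (simp add: Diff_def)
qed auto

lemma diff_mult_one: "a \<in> diff_carrier R \<Longrightarrow> diff_mult R a \<one>\<^bsub>Diff R\<^esub> = a"
proof
  fix n assume a: "a \<in> diff_carrier R"
  have "diff_mult R a \<one>\<^bsub>Diff R\<^esub> n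
      = (\<Oplus>m\<in>{..n}. a m \<otimes> series_power R \<one>\<^bsub>Diff R\<^esub> (Suc m) (n - m))"
    using a one_Diff_closed by (intro diff_mult_eq) (simp_all add: diff_carrierD)
  also have "\<dots> = a n \<otimes> series_power R \<one>\<^bsub>Diff R\<^esub> (Suc n) (n - n)"
    using a by (intro finsum_eq_single)
      (auto simp: diff_carrierD series_power_one_Diff simp del: series_power.simps)
  finally show "diff_mult R a \<one>\<^bsub>Diff R\<^esub> n = a n"
    using a by (simp add: series_power_one_Diff diff_carrierD del: series_power.simps)
qed

lemma diff_one_mult: "a \<in> diff_carrier R \<Longrightarrow> diff_mult R \<one>\<^bsub>Diff R\<^esub> a = a"
proof
  fix n assume a: "a \<in> diff_carrier R"
  have "(\<Oplus>m\<in>{1..n}. \<one>\<^bsub>Diff R\<^esub> m \<otimes> series_power R a (Suc m) (n - m)) = (\<Oplus>m\<in>{1..n}. \<zero>)"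
    using a by (intro add.finprod_cong' refl) (auto simp: Diff_def diff_carrierD simp del: series_power.simps)
  with a show "diff_mult R \<one>\<^bsub>Diff R\<^esub> a n = a n"
    using one_Diff_closed by (simp add: diff_mult_first diff_carrierD del: series_power.simps)
qed

lemma carrier_Diff: "carrier (Diff R) = diff_carrier R"
  and mult_Diff: "monoid.mult (Diff R) = diff_mult R"
  by (simp_all add: Diff_def)

text \<open>Existence of quotients is the word computation. When a product is divided by one of its
  factors, the other factor already solves the equation, so uniqueness applies.\<close>

theorem loop_Diff: "loop (Diff R)"
proof
  fix a b assume "a \<in> carrier (Diff R)" "b \<in> carrier (Diff R)"
  then have ab: "a \<in> diff_carrier R" "b \<in> diff_carrier R"
    by (simp_all add: carrier_Diff)
  show "ldiv (Diff R) a (a \<otimes>\<^bsub>Diff R\<^esub> b) = b" "rdiv (Diff R) (a \<otimes>\<^bsub>Diff R\<^esub> b) b = a"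
    using ab by (auto simp: mult_Diff diff_mult_closed intro!: ldiv_Diff_unique rdiv_Diff_unique)
qed (auto simp: carrier_Diff mult_Diff diff_mult_closed one_Diff_closed diff_mult_one diff_one_mult
  ldiv_Diff_eq rdiv_Diff_eq ldiv_series_closed rdiv_series_closed rdiv_series_mult mult_ldiv_series)

end

section \<open>Explicit formulas for the divisions\<close>

lemma finite_compositions [simp]: "finite (compositions n l)"
proof (rule finite_subset)
  show "compositions n l \<subseteq> weak_compositions l n"
    by (auto simp: compositions_def weak_compositions_def)
qed simp

lemma finite_Eseq [simp]: "finite (Eseq l)"
proof -
  have "Eseq l = {es. set es \<subseteq> {1, 2} \<and> length es = l}" by (auto simp: Eseq_def)
  then show ?thesis by (simp add: finite_lists_length_eq)
qed

lemma compositions_nth: "ns \<in> compositions n l \<Longrightarrow> i < l \<Longrightarrow> 1 \<le> ns ! i"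
  by (auto simp: compositions_def)

lemma zip_in_letter_words:
  assumes "ns \<in> compositions n l" "es \<in> Eseq l"
  shows "zip es ns \<in> letter_words n"
  using assms
  by (auto simp: compositions_def Eseq_def letter_words_def word_weight_def dest: set_zip_leftD set_zip_rightD)

text \<open>Positive weight excludes the empty word, so the summation index l of the division
  formulas can be the length of the word minus 1.\<close>

lemma bij_betw_zip_letter_words:
  assumes "n \<ge> 1"
  shows "bij_betw (\<lambda>((l, ns), es). zip es ns)
    (SIGMA x:(SIGMA l:{0..n - 1}. compositions n (l + 1)). Eseq (fst x + 1)) (letter_words n)"
proof (rule bij_betw_byWitness[where f' = "\<lambda>w. ((length w - 1, map snd w), map fst w)"])
  show "\<forall>x\<in>(SIGMA x:(SIGMA l:{0..n - 1}. compositions n (l + 1)). Eseq (fst x + 1)).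
      (\<lambda>w. ((length w - 1, map snd w), map fst w)) ((\<lambda>((l, ns), es). zip es ns) x) = x"
    by (auto simp: compositions_def Eseq_def)
  show "\<forall>w\<in>letter_words n.
      (\<lambda>((l, ns), es). zip es ns) ((\<lambda>w. ((length w - 1, map snd w), map fst w)) w) = w"
    by (simp add: zip_map_fst_snd)
  show "(\<lambda>((l, ns), es). zip es ns) `
      (SIGMA x:(SIGMA l:{0..n - 1}. compositions n (l + 1)). Eseq (fst x + 1)) \<subseteq> letter_words n"
    by (auto simp: zip_in_letter_words simp del: One_nat_def)
  show "(\<lambda>w. ((length w - 1, map snd w), map fst w)) ` letter_words n
      \<subseteq> (SIGMA x:(SIGMA l:{0..n - 1}. compositions n (l + 1)). Eseq (fst x + 1))"
  proof (rule image_subsetI)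
    fix w assume w: "w \<in> letter_words n"
    then have "w \<noteq> []" "length w \<le> n"
      using assms length_le_word_weight[of w] by (auto simp: letter_words_def)
    with w show "((length w - 1, map snd w), map fst w)
        \<in> (SIGMA x:(SIGMA l:{0..n - 1}. compositions n (l + 1)). Eseq (fst x + 1))"
      by (auto simp: letter_words_def compositions_def Eseq_def word_weight_def Suc_le_eq)
  qed
qed

lemma esign_Cons: "e \<in> {1, 2} \<Longrightarrow> es \<in> Eseq l \<Longrightarrow> esign (e # es) = (if e = 2 then -1 else 1) * esign es"
proof -
  assume *: "e \<in> {1, 2}" "es \<in> Eseq l"
  \<comment> \<open>Keeps the subtraction in \<open>esign\<close> from being truncated.\<close>
  then have "length es \<le> sum_list es"
    unfolding Eseq_def by (induction es arbitrary: l) auto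
  then show ?thesis using * by (auto simp: esign_def Suc_diff_le)
qed

text \<open>The left side is -1 to the number of labels 1, and \<open>esign es\<close> is -1 to the
  number of labels 2; the two numbers add up to the length.\<close>

lemma word_sign_zip:
  assumes "length es = length ns" "set es \<subseteq> {1, 2}"
  shows "word_sign (zip es ns) = (-1) ^ length es * esign es"
  using assms
proof (induction es ns rule: list_induct2)
  case Nil
  then show ?case by (simp add: esign_def)
next
  case (Cons e es n ns)
  then show ?case
    using esign_Cons[of e es "length es"] by (auto simp: word_sign_Cons Eseq_def)
qed

lemma Eseq_Suc: "Eseq (l + 1) = (\<lambda>(es, e). es @ [e]) ` (Eseq l \<times> {1, 2})"
proof (intro equalityI subsetI)
  fix es assume "es \<in> Eseq (l + 1)"
  then show "es \<in> (\<lambda>(es, e). es @ [e]) ` (Eseq l \<times> {1, 2})"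
    by (cases es rule: rev_cases) (auto simp: Eseq_def)
qed (auto simp: Eseq_def)

text \<open>A first letter of label 2 is a leaf that completes the only tree, so no further node can
  follow. This is why the formula for the left division may start with a fixed factor a.\<close>

lemma dcoeff_e_eq_0: "es \<in> Eseq l \<Longrightarrow> l \<ge> 1 \<Longrightarrow> es ! 0 \<noteq> 1 \<Longrightarrow> dcoeff_e es ns = 0"
proof -
  assume *: "es \<in> Eseq l" "l \<ge> 1" "es ! 0 \<noteq> 1"
  then have "es ! 0 = 2" by (cases es) (auto simp: Eseq_def)
  then obtain es' where "es = 2 # es'" using * by (cases es) (auto simp: Eseq_def)
  moreover have "Mseq_forest 0 es' = {}"
    by (cases es') (simp_all add: Mseq_forest_Nil Mseq_forest_0)
  ultimately have "Mseq_e es = {}"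
    by (auto simp: Mseq_e_eq_Mseq_forest Mseq_forest_Suc)
  then show ?thesis by (simp add: dcoeff_e_def)
qed

context ring
begin

lemma word_series_eq_finsum_zip:
  assumes v: "\<And>x. v x \<in> carrier R" and n: "n \<ge> 1"
  shows "word_series R v p n = (\<Oplus>l\<in>{0..n - 1}. \<Oplus>ns\<in>compositions n (l + 1). \<Oplus>es\<in>Eseq (l + 1).
    [p (zip es ns)] \<cdot> lprod R (map v (zip es ns)))"
proof -
  note [simp] = word_closed[OF v]
  have "(\<Oplus>l\<in>{0..n - 1}. \<Oplus>ns\<in>compositions n (l + 1). \<Oplus>es\<in>Eseq (l + 1).
      [p (zip es ns)] \<cdot> lprod R (map v (zip es ns)))
    = (\<Oplus>x\<in>(SIGMA l:{0..n - 1}. compositions n (l + 1)). \<Oplus>es\<in>Eseq (fst x + 1).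
      [p (zip es (snd x))] \<cdot> lprod R (map v (zip es (snd x))))"
    by (rule finsum_Sigma) auto
  also have "\<dots> = (\<Oplus>z\<in>(SIGMA x:(SIGMA l:{0..n - 1}. compositions n (l + 1)). Eseq (fst x + 1)).
      [p (zip (snd z) (snd (fst z)))] \<cdot> lprod R (map v (zip (snd z) (snd (fst z)))))"
    by (rule finsum_Sigma) auto
  also have "\<dots> = word_series R v p n"
    unfolding word_series_def
    by (subst finsum_bij_betw[OF bij_betw_zip_letter_words[OF n]])
      (auto simp: case_prod_unfold)
  finally show ?thesis ..
qed

lemma int_smult_minus: "x \<in> carrier R \<Longrightarrow> [(- k :: int)] \<cdot> x = \<ominus> ([k] \<cdot> x)"
  by (simp add: add.int_pow_neg)

lemma int_smult_diff:
  assumes "x \<in> carrier R" "y \<in> carrier R"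
  shows "[k] \<cdot> x \<oplus> [(- k :: int)] \<cdot> y = [k] \<cdot> (x \<ominus> y)"
  using assms by (simp add: a_minus_def int_smult_minus add.int_pow_mult_distrib a_comm add.int_pow_inv)

definition rdiv_formula :: "(nat \<Rightarrow> 'a) \<Rightarrow> (nat \<Rightarrow> 'a) \<Rightarrow> nat \<Rightarrow> nat \<Rightarrow> 'a" where
  "rdiv_formula a b n l = (\<Oplus>ns\<in>compositions n (l + 1).
         [((-1) ^ l * int (dcoeff (take l ns)))] \<cdot>
           ((a (ns ! 0) \<ominus> b (ns ! 0)) \<otimes> lprod R (map b (tl ns))))"

definition ldiv_formula :: "(nat \<Rightarrow> 'a) \<Rightarrow> (nat \<Rightarrow> 'a) \<Rightarrow> nat \<Rightarrow> nat \<Rightarrow> 'a" where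
  "ldiv_formula a b n l = (\<Oplus>ns\<in>compositions n (l + 1). \<Oplus>es\<in>Eseq l.
         [((-1) ^ l * esign es * int (dcoeff_e es (take l ns)))] \<cdot>
           (lprod R (map (\<lambda>i. pick a b (es ! i) (ns ! i)) [0..<l]) \<otimes>
            (b (ns ! l) \<ominus> a (ns ! l))))"

lemma compositions_1: "n \<ge> 1 \<Longrightarrow> compositions n (Suc 0) = {[n]}"
  by (auto simp: compositions_def length_Suc_conv)

lemma dcoeff_e_Nil: "dcoeff_e [] [] = 1"
  using dcoeff_e_eq_forest_count[of "[]" "[]" "(1, 0)"] by simp

lemma dcoeff_Nil: "dcoeff [] = 1"
  using dcoeff_eq_dcoeff_e[of "[]"] by (simp add: dcoeff_e_Nil)

lemma Eseq_0: "Eseq 0 = {[]}"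
  by (auto simp: Eseq_def)

lemma rdiv_formula_0:
  "n \<ge> 1 \<Longrightarrow> a n \<in> carrier R \<Longrightarrow> b n \<in> carrier R \<Longrightarrow> rdiv_formula a b n 0 = a n \<ominus> b n"
  by (simp add: rdiv_formula_def compositions_1 dcoeff_Nil)

lemma ldiv_formula_0:
  "n \<ge> 1 \<Longrightarrow> a n \<in> carrier R \<Longrightarrow> b n \<in> carrier R \<Longrightarrow> ldiv_formula a b n 0 = b n \<ominus> a n"
  by (simp add: ldiv_formula_def compositions_1 dcoeff_e_Nil Eseq_0 esign_def)

context
  fixes a b :: "nat \<Rightarrow> 'a"
  assumes a [simp]: "\<And>n. a n \<in> carrier R" and b [simp]: "\<And>n. b n \<in> carrier R"
begin

lemma pair_value_closed' [simp]: "pair_value a b x \<in> carrier R"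
  by (auto simp: pair_value_def pick_def)

lemma rdiv_formula_closed [simp]: "rdiv_formula a b n l \<in> carrier R"
  unfolding rdiv_formula_def by (auto intro!: finsum_closed add.int_pow_closed m_closed lprod_closed)

lemma ldiv_formula_closed [simp]: "ldiv_formula a b n l \<in> carrier R"
  unfolding ldiv_formula_def
  by (auto intro!: finsum_closed add.int_pow_closed m_closed lprod_closed simp: pick_def)

text \<open>Only the label sequences 1 2 ... 2 and 2 2 ... 2 have a nonzero coefficient, and their
  coefficients are opposite; together they produce the difference in the first factor.\<close>

lemma sum_Eseq_rdiv_coeff:
  assumes ns: "ns \<in> compositions n (l + 1)"
  shows "(\<Oplus>es\<in>Eseq (l + 1). [rdiv_coeff (zip es ns)] \<cdot> lprod R (map (pair_value a b) (zip es ns)))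
    = [((-1) ^ l * int (dcoeff (take l ns)))] \<cdot> ((a (ns ! 0) \<ominus> b (ns ! 0)) \<otimes> lprod R (map b (tl ns)))"
    (is "finsum R ?f _ = [?c] \<cdot> _")
proof -
  note [simp] = word_closed[OF pair_value_closed']
  obtain m ms where ms: "ns = m # ms" "length ms = l"
    using ns by (cases ns) (auto simp: compositions_def)
  have L: "lprod R (map b ms) \<in> carrier R" by (auto intro!: lprod_closed)
  have d: "dcoeff (take l ns) = forest_count 1 (first_word ns)"
  proof -
    have "length ns = Suc l" by (simp add: ms)
    then have "ns = take l ns @ [ns ! l]" by (metis lessI take_Suc_conv_app_nth order_refl take_all)
    then show ?thesis using dcoeff_eq_forest_count[of "take l ns" "ns ! l"] by simp
  qed
  have P: "map (pair_value a b) (zip (replicate l 2) ms) = map b ms"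
    by (rule nth_equalityI) (auto simp: ms pair_value_def pick_def)
  have f: "?f (e # replicate l 2) = [(if e = 1 then ?c else - ?c)] \<cdot>
      (pick a b e m \<otimes> lprod R (map b ms))" for e
  proof -
    have "map snd (zip (e # replicate l 2) ns) = ns" by (simp add: ms)
    moreover have "\<forall>x\<in>set (zip (replicate l 2) ms). fst x = (2 :: nat)"
      by (auto dest: set_zip_leftD)
    ultimately have "rdiv_coeff (zip (e # replicate l 2) ns) = (if e = 1 then ?c else - ?c)"
      unfolding d rdiv_coeff_def by (simp add: ms)
    then show ?thesis
      by (simp add: ms lprod_Cons P) (simp add: pair_value_def)
  qed
  have "finsum R ?f (Eseq (l + 1)) = finsum R ?f {1 # replicate l 2, 2 # replicate l 2}"
  proof (rule add.finprod_mono_neutral_cong_right)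
    show "{1 # replicate l 2, 2 # replicate l 2} \<subseteq> Eseq (l + 1)"
      by (auto simp: Eseq_def)
    fix es assume es: "es \<in> Eseq (l + 1) - {1 # replicate l 2, 2 # replicate l 2}"
    then obtain e es' where es': "es = e # es'" "length es' = l" "e \<in> {1, 2}"
      by (cases es) (auto simp: Eseq_def)
    with es have "es' \<noteq> replicate l 2" by auto
    then obtain i where i: "i < l" "es' ! i \<noteq> 2"
      using es'(2) by (metis nth_equalityI length_replicate nth_replicate)
    then have "(es' ! i, ms ! i) \<in> set (zip es' ms)"
      using es' ms by (auto simp: set_zip)
    then have "rdiv_coeff (zip es ns) = 0"
      using i by (auto simp: rdiv_coeff_def es' ms)
    then show "?f es = \<zero>" by simp
  qed auto
  also have "\<dots> = ?f (1 # replicate l 2) \<oplus> ?f (2 # replicate l 2)"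
    by simp
  also have "\<dots> = [?c] \<cdot> (a m \<otimes> lprod R (map b ms)) \<oplus> [(- ?c)] \<cdot> (b m \<otimes> lprod R (map b ms))"
    unfolding f by (simp add: pick_def)
  also have "\<dots> = [?c] \<cdot> ((a m \<ominus> b m) \<otimes> lprod R (map b ms))"
    using L by (subst int_smult_diff) (auto simp: a_minus_def l_distr l_minus)
  finally show ?thesis by (simp add: ms)
qed

text \<open>The last node is a leaf whatever its label, so the label leaves the count unchanged and
  only flips the sign; summation over it gives b - a.\<close>

lemma sum_Eseq_ldiv_coeff:
  assumes ns: "ns \<in> compositions n (l + 1)"
  shows "(\<Oplus>es\<in>Eseq (l + 1). [ldiv_coeff (zip es ns)] \<cdot> lprod R (map (pair_value a b) (zip es ns)))
    = (\<Oplus>es\<in>Eseq l. [((-1) ^ l * esign es * int (dcoeff_e es (take l ns)))] \<cdot>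
           (lprod R (map (\<lambda>i. pick a b (es ! i) (ns ! i)) [0..<l]) \<otimes> (b (ns ! l) \<ominus> a (ns ! l))))"
    (is "finsum R ?f _ = (\<Oplus>es\<in>_. [?c es] \<cdot> (?P es \<otimes> _))")
proof -
  note [simp] = word_closed[OF pair_value_closed']
  have P [simp]: "?P es \<in> carrier R" for es by (auto intro!: lprod_closed simp: pick_def)
  have "finsum R ?f (Eseq (l + 1)) = (\<Oplus>x\<in>Eseq l \<times> {1, 2}. ?f (fst x @ [snd x]))"
    unfolding Eseq_Suc by (subst add.finprod_reindex) (auto simp: inj_on_def case_prod_unfold)
  also have "\<dots> = (\<Oplus>es\<in>Eseq l. \<Oplus>e\<in>{1, 2}. ?f (es @ [e]))"
    by (rule finsum_Sigma[symmetric]) auto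
  also have "\<dots> = (\<Oplus>es\<in>Eseq l. [?c es] \<cdot> (?P es \<otimes> (b (ns ! l) \<ominus> a (ns ! l))))"
  proof (intro add.finprod_cong' refl)
    fix es assume es: "es \<in> Eseq l"
    define ms k where "ms = take l ns" and "k = ns ! l"
    have ms: "length ms = l" "length es = length ms"
      using ns es by (auto simp: ms_def compositions_def Eseq_def)
    have "ns = ms @ [k]"
      using ns unfolding ms_def k_def compositions_def
      by (auto simp: take_Suc_conv_app_nth[symmetric])
    then have z: "zip (es @ [e]) ns = zip es ms @ [(e, k)]" for e
      using ms by simp
    have "map (pair_value a b) (zip es ms) = map (\<lambda>i. pick a b (es ! i) (ns ! i)) [0..<l]"
      by (rule nth_equalityI) (use ms in \<open>auto simp: pair_value_def ms_def\<close>)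
    then have "lprod R (map (pair_value a b) (zip (es @ [e]) ns)) = ?P es \<otimes> pick a b e k" for e
    proof -
      assume "map (pair_value a b) (zip es ms) = map (\<lambda>i. pick a b (es ! i) (ns ! i)) [0..<l]"
      moreover have "lprod R (map (pair_value a b) (zip es ms @ [(e, k)]))
          = lprod R (map (pair_value a b) (zip es ms)) \<otimes> pair_value a b (e, k)"
        by (simp add: lprod_append image_subset_iff lprod_Cons)
      ultimately show ?thesis
        unfolding z by (simp add: pair_value_def)
    qed
    moreover have "ldiv_coeff (zip (es @ [e]) ns) = (if e = 2 then ?c es else - ?c es)" for e
      using es ms unfolding z
      by (simp add: ldiv_coeff_def word_sign_append word_sign_Cons word_sign_zip Eseq_def
          dcoeff_e_eq_forest_count[of es ms "(e, k)"] flip: ms_def)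
    moreover have "(\<Oplus>e\<in>{1, 2}. ?f (es @ [e])) = ?f (es @ [2]) \<oplus> ?f (es @ [1])"
      by (simp add: a_comm)
    ultimately have "(\<Oplus>e\<in>{1, 2}. ?f (es @ [e])) =
        [?c es] \<cdot> (?P es \<otimes> b k) \<oplus> [(- ?c es)] \<cdot> (?P es \<otimes> a k)"
      by (simp add: pick_def)
    then show "(\<Oplus>e\<in>{1, 2}. ?f (es @ [e])) = [?c es] \<cdot> (?P es \<otimes> (b (ns ! l) \<ominus> a (ns ! l)))"
      unfolding k_def
      by (simp only: int_smult_diff P a b m_closed) (simp add: a_minus_def r_distr r_minus)
  qed auto
  finally show ?thesis .
qed

lemma rdiv_series_eq_formula: "n \<ge> 1 \<Longrightarrow> rdiv_series a b n = (\<Oplus>l\<in>{0..n - 1}. rdiv_formula a b n l)"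
  unfolding rdiv_series_def
  by (subst word_series_eq_finsum_zip, simp, simp, unfold rdiv_formula_def)
    (intro add.finprod_cong' refl sum_Eseq_rdiv_coeff,
      auto intro!: finsum_closed add.int_pow_closed m_closed lprod_closed)

lemma ldiv_series_eq_formula: "n \<ge> 1 \<Longrightarrow> ldiv_series a b n = (\<Oplus>l\<in>{0..n - 1}. ldiv_formula a b n l)"
  unfolding ldiv_series_def
  by (subst word_series_eq_finsum_zip, simp, simp, unfold ldiv_formula_def)
    (intro add.finprod_cong' refl sum_Eseq_ldiv_coeff,
      auto intro!: finsum_closed add.int_pow_closed m_closed lprod_closed simp: pick_def)

lemma finsum_atLeastAtMost_0:
  assumes "\<And>l. f l \<in> carrier R"
  shows "(\<Oplus>l\<in>{0..m :: nat}. f l) = f 0 \<oplus> (\<Oplus>l\<in>{1..m}. f l)"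
proof -
  have "{0..m} = insert 0 {1..m}" by auto
  then show ?thesis using assms by simp
qed

lemma rdiv_series_eq:
  "n \<ge> 1 \<Longrightarrow> rdiv_series a b n = (a n \<ominus> b n) \<oplus> (\<Oplus>l\<in>{1..n - 1}. rdiv_formula a b n l)"
  by (simp add: rdiv_series_eq_formula finsum_atLeastAtMost_0 rdiv_formula_0 del: One_nat_def)

lemma ldiv_series_eq:
  "n \<ge> 1 \<Longrightarrow> ldiv_series a b n = (b n \<ominus> a n) \<oplus> (\<Oplus>l\<in>{1..n - 1}. ldiv_formula a b n l)"
  by (simp add: ldiv_series_eq_formula finsum_atLeastAtMost_0 ldiv_formula_0 del: One_nat_def)

lemma ldiv_formula_eq:
  assumes "l \<ge> 1"
  shows "ldiv_formula a b n l = (\<Oplus>ns\<in>compositions n (l + 1). \<Oplus>es\<in>Eseq l.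
         [((-1) ^ l * esign es * int (dcoeff_e es (take l ns)))] \<cdot>
           (a (ns ! 0) \<otimes> lprod R (map (\<lambda>i. pick a b (es ! i) (ns ! i)) [1..<l]) \<otimes>
            (b (ns ! l) \<ominus> a (ns ! l))))"
  unfolding ldiv_formula_def
proof (intro add.finprod_cong' refl)
  fix ns es assume es: "es \<in> Eseq l"
  let ?c = "(-1) ^ l * esign es * int (dcoeff_e es (take l ns))"
  show "[?c] \<cdot> (lprod R (map (\<lambda>i. pick a b (es ! i) (ns ! i)) [0..<l]) \<otimes> (b (ns ! l) \<ominus> a (ns ! l)))
      = [?c] \<cdot> (a (ns ! 0) \<otimes> lprod R (map (\<lambda>i. pick a b (es ! i) (ns ! i)) [1..<l]) \<otimes>
            (b (ns ! l) \<ominus> a (ns ! l)))"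
  \<comment> \<open>If the first label is 2, the first factors on the two sides differ, but the
    coefficient is 0.\<close>
  proof (cases "es ! 0 = 1")
    case True
    have "[0..<l] = 0 # [1..<l]" using assms by (simp add: upt_conv_Cons)
    then show ?thesis using True by (simp add: lprod_Cons pick_def)
  next
    case False
    then show ?thesis using dcoeff_e_eq_0[OF es assms] by simp
  qed
qed (auto intro!: finsum_closed add.int_pow_closed m_closed lprod_closed simp: pick_def)

end

end

section \<open>Homomorphisms of unital algebras\<close>

lemma unital_algebraD:
  assumes "unital_algebra F A"
  shows "field F" "ring A" "Module.module F A"
  using assms by (simp_all add: unital_algebra_def)

lemma unital_algebraI:
  fixes A (structure)
  assumes "field F" "ring A"
    and "\<And>c x. c \<in> carrier F \<Longrightarrow> x \<in> carrier A \<Longrightarrow> c \<odot> x \<in> carrier A"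
    and "\<And>c d x. c \<in> carrier F \<Longrightarrow> d \<in> carrier F \<Longrightarrow> x \<in> carrier A \<Longrightarrow>
      (c \<oplus>\<^bsub>F\<^esub> d) \<odot> x = c \<odot> x \<oplus> d \<odot> x"
    and "\<And>c x y. c \<in> carrier F \<Longrightarrow> x \<in> carrier A \<Longrightarrow> y \<in> carrier A \<Longrightarrow>
      c \<odot> (x \<oplus> y) = c \<odot> x \<oplus> c \<odot> y"
    and "\<And>c d x. c \<in> carrier F \<Longrightarrow> d \<in> carrier F \<Longrightarrow> x \<in> carrier A \<Longrightarrow>
      (c \<otimes>\<^bsub>F\<^esub> d) \<odot> x = c \<odot> (d \<odot> x)"
    and "\<And>x. x \<in> carrier A \<Longrightarrow> \<one>\<^bsub>F\<^esub> \<odot> x = x"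
    and "\<And>c x y. c \<in> carrier F \<Longrightarrow> x \<in> carrier A \<Longrightarrow> y \<in> carrier A \<Longrightarrow>
      (c \<odot> x) \<otimes> y = c \<odot> (x \<otimes> y)"
    and "\<And>c x y. c \<in> carrier F \<Longrightarrow> x \<in> carrier A \<Longrightarrow> y \<in> carrier A \<Longrightarrow>
      x \<otimes> (c \<odot> y) = c \<odot> (x \<otimes> y)"
  shows "unital_algebra F A"
proof (intro unital_algebra.intro unital_algebra_axioms.intro assms)
  show "Module.module F A"
    using assms by (intro moduleI fieldE ring.is_abelian_group)
qed

lemma alg_homD:
  assumes "h \<in> alg_hom F A B"
  shows "h \<in> ring_hom A B"
    "\<And>x. x \<in> carrier A \<Longrightarrow> h x \<in> carrier B"
    "\<And>x y. x \<in> carrier A \<Longrightarrow> y \<in> carrier A \<Longrightarrow> h (x \<otimes>\<^bsub>A\<^esub> y) = h x \<otimes>\<^bsub>B\<^esub> h y"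
    "\<And>x y. x \<in> carrier A \<Longrightarrow> y \<in> carrier A \<Longrightarrow> h (x \<oplus>\<^bsub>A\<^esub> y) = h x \<oplus>\<^bsub>B\<^esub> h y"
    "h \<one>\<^bsub>A\<^esub> = \<one>\<^bsub>B\<^esub>"
    "\<And>c x. c \<in> carrier F \<Longrightarrow> x \<in> carrier A \<Longrightarrow> h (c \<odot>\<^bsub>A\<^esub> x) = c \<odot>\<^bsub>B\<^esub> h x"
    "h \<in> extensional (carrier A)"
  using assms by (auto simp: alg_hom_def ring_hom_def)

lemma alg_homI:
  assumes "\<And>x. x \<in> carrier A \<Longrightarrow> h x \<in> carrier B"
    and "\<And>x y. x \<in> carrier A \<Longrightarrow> y \<in> carrier A \<Longrightarrow> h (x \<otimes>\<^bsub>A\<^esub> y) = h x \<otimes>\<^bsub>B\<^esub> h y"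
    and "\<And>x y. x \<in> carrier A \<Longrightarrow> y \<in> carrier A \<Longrightarrow> h (x \<oplus>\<^bsub>A\<^esub> y) = h x \<oplus>\<^bsub>B\<^esub> h y"
    and "h \<one>\<^bsub>A\<^esub> = \<one>\<^bsub>B\<^esub>"
    and "\<And>c x. c \<in> carrier F \<Longrightarrow> x \<in> carrier A \<Longrightarrow> h (c \<odot>\<^bsub>A\<^esub> x) = c \<odot>\<^bsub>B\<^esub> h x"
    and "h \<in> extensional (carrier A)"
  shows "h \<in> alg_hom F A B"
  using assms by (auto simp: alg_hom_def ring_hom_def)

lemma alg_hom_eqI:
  assumes "f \<in> alg_hom F A B" "g \<in> alg_hom F A B" "\<And>x. x \<in> carrier A \<Longrightarrow> f x = g x"
  shows "f = g"
  using assms(3) alg_homD(7)[OF assms(1)] alg_homD(7)[OF assms(2)] by (rule extensionalityI[rotated 2])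

lemma compose_alg_hom:
  assumes "unital_algebra F A" "f \<in> alg_hom F A B" "g \<in> alg_hom F B C"
  shows "compose (carrier A) g f \<in> alg_hom F A C"
proof -
  interpret A: ring A using assms unital_algebraD by blast
  interpret AM: Module.module F A using assms unital_algebraD by blast
  show ?thesis
    by (rule alg_homI) (simp_all add: compose_eq alg_homD[OF assms(2)] alg_homD[OF assms(3)])
qed

lemma alg_id_hom: "unital_algebra F A \<Longrightarrow> alg_id A \<in> alg_hom F A A"
proof -
  assume A: "unital_algebra F A"
  interpret A: ring A using A unital_algebraD by blast
  interpret AM: Module.module F A using A unital_algebraD by blast
  show ?thesis by (rule alg_homI) (simp_all add: alg_id_def)
qed

lemma alg_hom_zero:
  "unital_algebra F A \<Longrightarrow> unital_algebra F B \<Longrightarrow> h \<in> alg_hom F A B \<Longrightarrow> h \<zero>\<^bsub>A\<^esub> = \<zero>\<^bsub>B\<^esub>"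
  by (meson alg_homD(1) ring_hom_zero unital_algebraD(2))

lemma base_algebra: "field F \<Longrightarrow> unital_algebra F (base_algebra F)"
proof -
  assume "field F"
  then interpret field F .
  have "ring (base_algebra F)"
    by (intro ringI abelian_groupI monoidI)
      (auto simp: base_algebra_def a_ac m_assoc l_distr r_distr intro: r_neg bexI[of _ "\<ominus>\<^bsub>F\<^esub> _"])
  then show ?thesis
    using \<open>field F\<close>
    by (intro unital_algebraI) (auto simp: base_algebra_def l_distr r_distr m_assoc m_lcomm)
qed

lemma alg_unit_hom: "unital_algebra F A \<Longrightarrow> alg_unit F A \<in> alg_hom F (base_algebra F) A"
proof -
  assume A: "unital_algebra F A"
  interpret F: field F using A unital_algebraD by blast
  interpret A: ring A using A unital_algebraD by blast
  interpret AM: Module.module F A using A unital_algebraD by blast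
  show ?thesis
    using unital_algebra.smult_mult_left[OF A]
    by (intro alg_homI) (auto simp: base_algebra_def alg_unit_def AM.smult_l_distr AM.smult_assoc1)
qed

section \<open>Free algebras\<close>

definition word_monom :: "('f, 'm) ring_scheme \<Rightarrow> 'x list \<Rightarrow> 'x list \<Rightarrow> 'f" where
  "word_monom F w = (\<lambda>u. if u = w then \<one>\<^bsub>F\<^esub> else \<zero>\<^bsub>F\<^esub>)"

lemma gen_eq_word_monom: "gen F x = word_monom F [x]"
  by (simp add: gen_def word_monom_def)

locale free_algebra_on = field F for F :: "('f, 'm) ring_scheme" (structure) +
  fixes X :: "'x set"
begin

abbreviation P where "P \<equiv> free_algebra F X"

definition support :: "('x list \<Rightarrow> 'f) \<Rightarrow> 'x list set" where
  "support p = {w. p w \<noteq> \<zero>}"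

lemma in_carrier_iff:
  "p \<in> carrier P \<longleftrightarrow> (\<forall>w. p w \<in> carrier F) \<and> finite (support p) \<and> support p \<subseteq> lists X"
  by (simp add: free_algebra_def support_def)

lemma in_carrierD: "p \<in> carrier P \<Longrightarrow> p w \<in> carrier F" "p \<in> carrier P \<Longrightarrow> finite (support p)"
  "p \<in> carrier P \<Longrightarrow> support p \<subseteq> lists X"
  by (auto simp: in_carrier_iff)

lemma ops:
  "p \<otimes>\<^bsub>P\<^esub> q = (\<lambda>w. \<Oplus>i\<in>{..length w}. p (take i w) \<otimes> q (drop i w))"
  "\<one>\<^bsub>P\<^esub> = word_monom F []"
  "\<zero>\<^bsub>P\<^esub> = (\<lambda>w. \<zero>)"
  "p \<oplus>\<^bsub>P\<^esub> q = (\<lambda>w. p w \<oplus> q w)"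
  "c \<odot>\<^bsub>P\<^esub> p = (\<lambda>w. c \<otimes> p w)"
  by (simp_all add: free_algebra_def word_monom_def)

lemma add_closed: "p \<in> carrier P \<Longrightarrow> q \<in> carrier P \<Longrightarrow> p \<oplus>\<^bsub>P\<^esub> q \<in> carrier P"
proof -
  assume *: "p \<in> carrier P" "q \<in> carrier P"
  have sub: "support (p \<oplus>\<^bsub>P\<^esub> q) \<subseteq> support p \<union> support q"
    by (auto simp: support_def ops)
  have "finite (support (p \<oplus>\<^bsub>P\<^esub> q))"
    by (rule finite_subset[OF sub]) (simp add: * in_carrierD)
  moreover have "support (p \<oplus>\<^bsub>P\<^esub> q) \<subseteq> lists X"
    using sub * in_carrierD(3) by blast
  moreover have "(p \<oplus>\<^bsub>P\<^esub> q) w \<in> carrier F" for w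
    using * by (simp add: ops in_carrierD)
  ultimately show ?thesis by (simp only: in_carrier_iff) blast
qed

lemma smult_closed: "c \<in> carrier F \<Longrightarrow> p \<in> carrier P \<Longrightarrow> c \<odot>\<^bsub>P\<^esub> p \<in> carrier P"
proof -
  assume *: "c \<in> carrier F" "p \<in> carrier P"
  have sub: "support (c \<odot>\<^bsub>P\<^esub> p) \<subseteq> support p"
    using * by (auto simp: support_def ops)
  have "finite (support (c \<odot>\<^bsub>P\<^esub> p))"
    by (rule finite_subset[OF sub]) (simp add: * in_carrierD)
  moreover have "support (c \<odot>\<^bsub>P\<^esub> p) \<subseteq> lists X"
    using sub * in_carrierD(3) by blast
  moreover have "(c \<odot>\<^bsub>P\<^esub> p) w \<in> carrier F" for w
    using * by (simp add: ops in_carrierD)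
  ultimately show ?thesis by (simp only: in_carrier_iff) blast
qed

lemma mult_closed: "p \<in> carrier P \<Longrightarrow> q \<in> carrier P \<Longrightarrow> p \<otimes>\<^bsub>P\<^esub> q \<in> carrier P"
proof -
  assume *: "p \<in> carrier P" "q \<in> carrier P"
  have "support (p \<otimes>\<^bsub>P\<^esub> q) \<subseteq> (\<lambda>(u, v). u @ v) ` (support p \<times> support q)"
  proof
    fix w assume "w \<in> support (p \<otimes>\<^bsub>P\<^esub> q)"
    then have "(\<Oplus>i\<in>{..length w}. p (take i w) \<otimes> q (drop i w)) \<noteq> \<zero>"
      by (simp add: support_def ops)
    then obtain i where "p (take i w) \<otimes> q (drop i w) \<noteq> \<zero>"
      by (metis (lifting) add.finprod_one_eqI)
    then have "take i w \<in> support p" "drop i w \<in> support q"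
      using * by (auto simp: support_def in_carrierD)
    then show "w \<in> (\<lambda>(u, v). u @ v) ` (support p \<times> support q)"
      by (intro image_eqI[of _ _ "(take i w, drop i w)"]) auto
  qed
  moreover have "finite ((\<lambda>(u, v). u @ v) ` (support p \<times> support q))"
    using * by (simp add: in_carrierD)
  moreover have "(\<lambda>(u, v). u @ v) ` (support p \<times> support q) \<subseteq> lists X"
  proof (rule image_subsetI)
    fix z assume "z \<in> support p \<times> support q"
    then have "fst z \<in> lists X" "snd z \<in> lists X"
      using *[THEN in_carrierD(3)] by (metis mem_Times_iff subsetD)+
    then show "(\<lambda>(u, v). u @ v) z \<in> lists X" by (simp add: case_prod_unfold)
  qed
  ultimately have "finite (support (p \<otimes>\<^bsub>P\<^esub> q))" "support (p \<otimes>\<^bsub>P\<^esub> q) \<subseteq> lists X"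
    by (metis finite_subset, metis subset_trans)
  moreover have "(p \<otimes>\<^bsub>P\<^esub> q) w \<in> carrier F" for w
    using * by (auto simp: ops in_carrierD)
  ultimately show ?thesis by (simp add: in_carrier_iff)
qed

lemma word_monom_closed: "w \<in> lists X \<Longrightarrow> word_monom F w \<in> carrier P"
  using zero_not_one by (auto simp: in_carrier_iff word_monom_def support_def)

lemma zero_closed': "\<zero>\<^bsub>P\<^esub> \<in> carrier P"
  by (auto simp: in_carrier_iff ops support_def)

text \<open>Two cut positions j \<le> i are recorded either as the outer pair (i, j) or as j
  together with the length i - j of the middle piece; associativity is this reindexing.\<close>

lemma bij_betw_cut_twice:
  "bij_betw (\<lambda>(i, j). (j, i - j)) (SIGMA i:{..n :: nat}. {..i}) (SIGMA j:{..n}. {..n - j})"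
  by (rule bij_betw_byWitness[where f' = "\<lambda>(j, k). (j + k, j)"]) auto

lemma mult_assoc':
  assumes "p \<in> carrier P" "q \<in> carrier P" "r \<in> carrier P"
  shows "(p \<otimes>\<^bsub>P\<^esub> q) \<otimes>\<^bsub>P\<^esub> r = p \<otimes>\<^bsub>P\<^esub> (q \<otimes>\<^bsub>P\<^esub> r)"
proof
  fix w
  note [simp] = assms[THEN in_carrierD(1)]
  have "((p \<otimes>\<^bsub>P\<^esub> q) \<otimes>\<^bsub>P\<^esub> r) w
    = (\<Oplus>i\<in>{..length w}. \<Oplus>j\<in>{..i}. p (take j w) \<otimes> q (take (i - j) (drop j w)) \<otimes> r (drop i w))"
    unfolding ops
    by (intro add.finprod_cong' refl)
      (auto simp: finsum_ldistr drop_take min_def intro!: add.finprod_cong')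
  also have "\<dots> = (\<Oplus>z\<in>(SIGMA i:{..length w}. {..i}).
      p (take (snd z) w) \<otimes> q (take (fst z - snd z) (drop (snd z) w)) \<otimes> r (drop (fst z) w))"
    by (rule finsum_Sigma) auto
  also have "\<dots> = (\<Oplus>z\<in>(SIGMA j:{..length w}. {..length w - j}).
      p (take (fst z) w) \<otimes> q (take (snd z) (drop (fst z) w)) \<otimes> r (drop (snd z + fst z) w))"
    by (subst finsum_bij_betw[OF bij_betw_cut_twice]) (auto intro!: add.finprod_cong')
  also have "\<dots> = (\<Oplus>j\<in>{..length w}. \<Oplus>k\<in>{..length w - j}.
      p (take j w) \<otimes> q (take k (drop j w)) \<otimes> r (drop (k + j) w))"
    by (rule finsum_Sigma[symmetric]) auto
  also have "\<dots> = (p \<otimes>\<^bsub>P\<^esub> (q \<otimes>\<^bsub>P\<^esub> r)) w"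
    unfolding ops
    by (intro add.finprod_cong' refl)
      (auto simp: finsum_rdistr m_assoc intro!: add.finprod_cong')
  finally show "((p \<otimes>\<^bsub>P\<^esub> q) \<otimes>\<^bsub>P\<^esub> r) w = (p \<otimes>\<^bsub>P\<^esub> (q \<otimes>\<^bsub>P\<^esub> r)) w" .
qed

lemma mult_one_left: "p \<in> carrier P \<Longrightarrow> \<one>\<^bsub>P\<^esub> \<otimes>\<^bsub>P\<^esub> p = p"
proof
  fix w assume p: "p \<in> carrier P"
  have "(\<Oplus>i\<in>{..length w}. word_monom F [] (take i w) \<otimes> p (drop i w))
      = word_monom F [] (take 0 w) \<otimes> p (drop 0 w)"
    using p by (intro finsum_eq_single) (auto simp: word_monom_def in_carrierD)
  then show "(\<one>\<^bsub>P\<^esub> \<otimes>\<^bsub>P\<^esub> p) w = p w"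
    using p by (simp add: ops in_carrierD) (simp add: word_monom_def in_carrierD)
qed

lemma mult_one_right: "p \<in> carrier P \<Longrightarrow> p \<otimes>\<^bsub>P\<^esub> \<one>\<^bsub>P\<^esub> = p"
proof
  fix w assume p: "p \<in> carrier P"
  have "(\<Oplus>i\<in>{..length w}. p (take i w) \<otimes> word_monom F [] (drop i w))
      = p (take (length w) w) \<otimes> word_monom F [] (drop (length w) w)"
    using p by (intro finsum_eq_single) (auto simp: word_monom_def in_carrierD)
  then show "(p \<otimes>\<^bsub>P\<^esub> \<one>\<^bsub>P\<^esub>) w = p w"
    using p by (simp add: ops in_carrierD) (simp add: word_monom_def in_carrierD)
qed

lemma minus_exists: "p \<in> carrier P \<Longrightarrow> \<exists>q\<in>carrier P. q \<oplus>\<^bsub>P\<^esub> p = \<zero>\<^bsub>P\<^esub>"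
proof
  assume p: "p \<in> carrier P"
  show "(\<ominus> \<one>) \<odot>\<^bsub>P\<^esub> p \<in> carrier P" using p by (simp add: smult_closed)
  show "(\<ominus> \<one>) \<odot>\<^bsub>P\<^esub> p \<oplus>\<^bsub>P\<^esub> p = \<zero>\<^bsub>P\<^esub>"
    using p by (auto simp: ops in_carrierD l_minus l_neg)
qed

lemma ring_free_algebra: "ring P"
proof (intro ringI abelian_groupI monoidI)
  fix x y z assume *: "x \<in> carrier P" "y \<in> carrier P" "z \<in> carrier P"
  note [simp] = *[THEN in_carrierD(1)]
  show "(x \<oplus>\<^bsub>P\<^esub> y) \<otimes>\<^bsub>P\<^esub> z = x \<otimes>\<^bsub>P\<^esub> z \<oplus>\<^bsub>P\<^esub> y \<otimes>\<^bsub>P\<^esub> z"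
    by (rule ext) (simp add: ops l_distr finsum_addf Pi_def)
  show "z \<otimes>\<^bsub>P\<^esub> (x \<oplus>\<^bsub>P\<^esub> y) = z \<otimes>\<^bsub>P\<^esub> x \<oplus>\<^bsub>P\<^esub> z \<otimes>\<^bsub>P\<^esub> y"
    by (rule ext) (simp add: ops r_distr finsum_addf Pi_def)
  show "x \<oplus>\<^bsub>P\<^esub> y \<oplus>\<^bsub>P\<^esub> z = x \<oplus>\<^bsub>P\<^esub> (y \<oplus>\<^bsub>P\<^esub> z)" "x \<oplus>\<^bsub>P\<^esub> y = y \<oplus>\<^bsub>P\<^esub> x" "\<zero>\<^bsub>P\<^esub> \<oplus>\<^bsub>P\<^esub> x = x"
    by (rule ext, simp add: ops a_ac)+
qed (simp_all add: add_closed zero_closed' mult_closed mult_assoc' mult_one_left mult_one_right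
    minus_exists, simp add: ops word_monom_closed)

lemma unital_algebra_free_algebra: "unital_algebra F P"
proof (rule unital_algebraI[OF field_axioms ring_free_algebra])
  fix c d x y assume *: "c \<in> carrier F" "d \<in> carrier F" "x \<in> carrier P" "y \<in> carrier P"
  note [simp] = *(1,2) *(3,4)[THEN in_carrierD(1)]
  show "(c \<oplus> d) \<odot>\<^bsub>P\<^esub> x = c \<odot>\<^bsub>P\<^esub> x \<oplus>\<^bsub>P\<^esub> d \<odot>\<^bsub>P\<^esub> x"
    "c \<odot>\<^bsub>P\<^esub> (x \<oplus>\<^bsub>P\<^esub> y) = c \<odot>\<^bsub>P\<^esub> x \<oplus>\<^bsub>P\<^esub> c \<odot>\<^bsub>P\<^esub> y"
    "(c \<otimes> d) \<odot>\<^bsub>P\<^esub> x = c \<odot>\<^bsub>P\<^esub> (d \<odot>\<^bsub>P\<^esub> x)"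
    by (rule ext, simp add: ops l_distr r_distr m_assoc)+
  show "(c \<odot>\<^bsub>P\<^esub> x) \<otimes>\<^bsub>P\<^esub> y = c \<odot>\<^bsub>P\<^esub> (x \<otimes>\<^bsub>P\<^esub> y)" "x \<otimes>\<^bsub>P\<^esub> (c \<odot>\<^bsub>P\<^esub> y) = c \<odot>\<^bsub>P\<^esub> (x \<otimes>\<^bsub>P\<^esub> y)"
    by (rule ext, simp add: ops finsum_rdistr Pi_def m_assoc m_lcomm)+
next
  fix x assume "x \<in> carrier P"
  then show "\<one> \<odot>\<^bsub>P\<^esub> x = x" by (intro ext) (simp add: ops in_carrierD)
qed (rule smult_closed)

lemma word_monom_mult:
  "word_monom F u \<otimes>\<^bsub>P\<^esub> word_monom F v = word_monom F (u @ v)"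
proof
  fix w
  let ?f = "\<lambda>i. word_monom F u (take i w) \<otimes> word_monom F v (drop i w)"
  have closed: "word_monom F u w \<in> carrier F" for u w :: "'x list"
    by (simp add: word_monom_def)
  show "(word_monom F u \<otimes>\<^bsub>P\<^esub> word_monom F v) w = word_monom F (u @ v) w"
  proof (cases "w = u @ v")
    case True
    have "finsum F ?f {..length w} = ?f (length u)"
    proof (rule finsum_eq_single)
      fix j assume "j \<in> {..length w}" "j \<noteq> length u"
      then have "take j w \<noteq> u" by auto
      then show "?f j = \<zero>" by (simp add: word_monom_def)
    qed (auto simp: closed True)
    then show ?thesis by (simp add: ops) (simp add: True word_monom_def)
  next
    case False
    then have "?f i = \<zero>" for i
      by (auto simp: word_monom_def)
    then show ?thesis using False by (simp add: ops) (simp add: word_monom_def)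
  qed
qed

lemma gen_closed: "x \<in> X \<Longrightarrow> gen F x \<in> carrier P"
  by (simp add: gen_eq_word_monom word_monom_closed)

lemma word_monom_Cons: "word_monom F (x # w) = gen F x \<otimes>\<^bsub>P\<^esub> word_monom F w"
  by (simp add: gen_eq_word_monom word_monom_mult)

text \<open>The induction runs over a finite set \<open>S\<close> containing the support, and
  deletes one word of \<open>S\<close> from the polynomial at a time; words outside the support
  change nothing.\<close>

lemma free_algebra_induct [consumes 1, case_names zero add]:
  assumes p: "p \<in> carrier P"
    and zero: "Q \<zero>\<^bsub>P\<^esub>"
    and add: "\<And>c w p. c \<in> carrier F \<Longrightarrow> w \<in> lists X \<Longrightarrow> p \<in> carrier P \<Longrightarrow> Q p \<Longrightarrow>
      Q (c \<odot>\<^bsub>P\<^esub> word_monom F w \<oplus>\<^bsub>P\<^esub> p)"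
  shows "Q p"
proof -
  have "support q \<subseteq> S \<longrightarrow> Q q" if "finite S" "q \<in> carrier P" for S q
    using that
  proof (induction S arbitrary: q rule: finite_induct)
    case empty
    then have "q = \<zero>\<^bsub>P\<^esub>" if "support q \<subseteq> {}" using that by (auto simp: support_def ops)
    with zero show ?case by blast
  next
    case (insert w S)
    define q' where "q' = q(w := \<zero>)"
    have supp: "support q' = support q - {w}" by (auto simp: support_def q'_def)
    have q': "q' \<in> carrier P"
      using insert.prems unfolding in_carrier_iff supp by (auto simp: q'_def)
    have qw: "q w \<in> carrier F" using insert.prems in_carrierD by blast
    have eq: "q w \<odot>\<^bsub>P\<^esub> word_monom F w \<oplus>\<^bsub>P\<^esub> q' = q"
      using insert.prems by (auto simp: ops q'_def word_monom_def in_carrierD)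
    show ?case
    proof
      assume S: "support q \<subseteq> insert w S"
      then have "Q q'" using insert.IH[OF q'] supp by auto
      show "Q q"
      proof (cases "w \<in> lists X")
        case True
        then show ?thesis using add[OF qw True q' \<open>Q q'\<close>] eq by simp
      next
        case False
        then have "w \<notin> support q" using insert.prems in_carrierD(3) by blast
        then have "q = q'" by (auto simp: q'_def support_def)
        with \<open>Q q'\<close> show ?thesis by simp
      qed
    qed
  qed
  then show ?thesis using p in_carrierD(2) by blast
qed

lemma free_algebra_hom_eqI:
  assumes A: "unital_algebra F A" and h: "h \<in> alg_hom F P A" "h' \<in> alg_hom F P A"
    and gen: "\<And>x. x \<in> X \<Longrightarrow> h (gen F x) = h' (gen F x)"
  shows "h = h'"
proof (rule alg_hom_eqI[OF h])
  have monom: "h (word_monom F w) = h' (word_monom F w)" if "w \<in> lists X" for w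
    using that
  proof (induction w)
    case Nil
    then show ?case using alg_homD(5)[OF h(1)] alg_homD(5)[OF h(2)] by (simp add: ops)
  next
    case (Cons x w)
    then show ?case
      by (simp add: word_monom_Cons alg_homD[OF h(1)] alg_homD[OF h(2)] gen_closed word_monom_closed gen)
  qed
  fix p assume "p \<in> carrier P"
  then show "h p = h' p"
  proof (induction p rule: free_algebra_induct)
    case zero
    then show ?case
      using alg_hom_zero[OF unital_algebra_free_algebra A] h by metis
  next
    case (add c w p)
    then show ?case
      by (simp add: alg_homD[OF h(1)] alg_homD[OF h(2)] monom word_monom_closed smult_closed)
  qed
qed

subsection \<open>Evaluation\<close>

context
  fixes A :: "('f, 'a) module" and v
  assumes A: "unital_algebra F A" and v: "\<And>x. x \<in> X \<Longrightarrow> v x \<in> carrier A"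
begin

interpretation A: ring A using A unital_algebraD by blast
interpretation AM: Module.module F A using A unital_algebraD by blast

definition evaluate :: "('x list \<Rightarrow> 'f) \<Rightarrow> 'a" where
  "evaluate p = (\<Oplus>\<^bsub>A\<^esub>w\<in>support p. p w \<odot>\<^bsub>A\<^esub> lprod A (map v w))"

lemma word_value_closed: "w \<in> lists X \<Longrightarrow> lprod A (map v w) \<in> carrier A"
  using v by (auto intro!: A.lprod_closed)

lemma term_closed: "p \<in> carrier P \<Longrightarrow> w \<in> lists X \<Longrightarrow> p w \<odot>\<^bsub>A\<^esub> lprod A (map v w) \<in> carrier A"
  by (simp add: word_value_closed in_carrierD)

lemma evaluate_closed: "p \<in> carrier P \<Longrightarrow> evaluate p \<in> carrier A"
  unfolding evaluate_def 
  by (intro A.finsum_closed Pi_I) (meson in_carrierD(3) subsetD term_closed)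

text \<open>Allows sums over different supports to be taken over one common finite set.\<close>

lemma evaluate_superset:
  assumes "p \<in> carrier P" "finite S" "support p \<subseteq> S" "S \<subseteq> lists X"
  shows "evaluate p = (\<Oplus>\<^bsub>A\<^esub>w\<in>S. p w \<odot>\<^bsub>A\<^esub> lprod A (map v w))"
  unfolding evaluate_def
proof (rule A.add.finprod_mono_neutral_cong_left)
  fix w assume "w \<in> S - support p"
  then have "p w = \<zero>" "w \<in> lists X"
    using assms(4) by (simp add: support_def, blast)
  then show "p w \<odot>\<^bsub>A\<^esub> lprod A (map v w) = \<zero>\<^bsub>A\<^esub>"
    by (simp add: word_value_closed)
qed (use assms term_closed in blast)+

lemma evaluate_add:
  assumes "p \<in> carrier P" "q \<in> carrier P"
  shows "evaluate (p \<oplus>\<^bsub>P\<^esub> q) = evaluate p \<oplus>\<^bsub>A\<^esub> evaluate q"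
proof -
  let ?S = "support p \<union> support q"
  have S: "finite ?S" "?S \<subseteq> lists X" "support (p \<oplus>\<^bsub>P\<^esub> q) \<subseteq> ?S"
    using assms in_carrierD(2,3) by (blast, blast) (auto simp: support_def ops)
  have "evaluate (p \<oplus>\<^bsub>P\<^esub> q) = (\<Oplus>\<^bsub>A\<^esub>w\<in>?S. p w \<odot>\<^bsub>A\<^esub> lprod A (map v w) \<oplus>\<^bsub>A\<^esub> q w \<odot>\<^bsub>A\<^esub> lprod A (map v w))"
    unfolding evaluate_superset[OF add_closed[OF assms] S(1,3,2)]
  proof (intro A.add.finprod_cong' refl Pi_I)
    fix w assume "w \<in> ?S"
    then have w: "w \<in> lists X" using S by blast
    then show "p w \<odot>\<^bsub>A\<^esub> lprod A (map v w) \<oplus>\<^bsub>A\<^esub> q w \<odot>\<^bsub>A\<^esub> lprod A (map v w) \<in> carrier A"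
      using assms by (intro A.a_closed term_closed)
    show "(p \<oplus>\<^bsub>P\<^esub> q) w \<odot>\<^bsub>A\<^esub> lprod A (map v w)
        = p w \<odot>\<^bsub>A\<^esub> lprod A (map v w) \<oplus>\<^bsub>A\<^esub> q w \<odot>\<^bsub>A\<^esub> lprod A (map v w)"
      using assms word_value_closed[OF w] by (simp add: ops AM.smult_l_distr in_carrierD)
  qed
  also have "\<dots> = (\<Oplus>\<^bsub>A\<^esub>w\<in>?S. p w \<odot>\<^bsub>A\<^esub> lprod A (map v w)) \<oplus>\<^bsub>A\<^esub> (\<Oplus>\<^bsub>A\<^esub>w\<in>?S. q w \<odot>\<^bsub>A\<^esub> lprod A (map v w))"
    using S assms term_closed by (intro A.finsum_addf Pi_I) blast+
  also have "\<dots> = evaluate p \<oplus>\<^bsub>A\<^esub> evaluate q"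
    using S assms by (simp add: evaluate_superset[of _ ?S])
  finally show ?thesis .
qed

lemma evaluate_smult:
  assumes "c \<in> carrier F" "p \<in> carrier P"
  shows "evaluate (c \<odot>\<^bsub>P\<^esub> p) = c \<odot>\<^bsub>A\<^esub> evaluate p"
proof -
  have S: "finite (support p)" "support p \<subseteq> lists X" "support (c \<odot>\<^bsub>P\<^esub> p) \<subseteq> support p"
    using assms in_carrierD(2,3) by (blast, blast, auto simp: support_def ops)
  have "evaluate (c \<odot>\<^bsub>P\<^esub> p) = (\<Oplus>\<^bsub>A\<^esub>w\<in>support p. c \<odot>\<^bsub>A\<^esub> (p w \<odot>\<^bsub>A\<^esub> lprod A (map v w)))"
    unfolding evaluate_superset[OF smult_closed[OF assms] S(1,3,2)]
  proof (intro A.add.finprod_cong' refl Pi_I)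
    fix w assume "w \<in> support p"
    then have w: "w \<in> lists X" using S by blast
    then show "c \<odot>\<^bsub>A\<^esub> (p w \<odot>\<^bsub>A\<^esub> lprod A (map v w)) \<in> carrier A"
      using assms by (intro AM.smult_closed term_closed)
    show "(c \<odot>\<^bsub>P\<^esub> p) w \<odot>\<^bsub>A\<^esub> lprod A (map v w) = c \<odot>\<^bsub>A\<^esub> (p w \<odot>\<^bsub>A\<^esub> lprod A (map v w))"
      using assms word_value_closed[OF w] by (simp add: ops AM.smult_assoc1 in_carrierD)
  qed
  also have "\<dots> = c \<odot>\<^bsub>A\<^esub> evaluate p"
    unfolding evaluate_def
    using S assms term_closed by (intro AM.finsum_smult_ldistr[symmetric] Pi_I) blast+
  finally show ?thesis .
qed

lemma evaluate_word_monom: "w \<in> lists X \<Longrightarrow> evaluate (word_monom F w) = lprod A (map v w)"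
proof -
  assume w: "w \<in> lists X"
  have "support (word_monom F w) = {w}" using zero_not_one by (auto simp: support_def word_monom_def)
  then show ?thesis using w by (simp add: evaluate_def word_value_closed) (simp add: word_monom_def word_value_closed)
qed

lemma evaluate_zero: "evaluate \<zero>\<^bsub>P\<^esub> = \<zero>\<^bsub>A\<^esub>"
  by (simp add: evaluate_def support_def ops)

text \<open>Both sides are bilinear, and on words the claim is that values of concatenated words
  multiply. Linearity is used first in the right factor, against a fixed word, and then in the left
  factor.\<close>

lemma evaluate_mult:
  assumes "p \<in> carrier P" "q \<in> carrier P"
  shows "evaluate (p \<otimes>\<^bsub>P\<^esub> q) = evaluate p \<otimes>\<^bsub>A\<^esub> evaluate q"
proof -
  interpret P: ring P by (rule ring_free_algebra)
  note closed = word_monom_closed smult_closed evaluate_closed word_value_closed mult_closed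
  note left = unital_algebra.smult_mult_left[OF unital_algebra_free_algebra]
    unital_algebra.smult_mult_left[OF A]
  note right = unital_algebra.smult_mult_right[OF unital_algebra_free_algebra]
    unital_algebra.smult_mult_right[OF A]
  have monom: "evaluate (word_monom F w \<otimes>\<^bsub>P\<^esub> q) = lprod A (map v w) \<otimes>\<^bsub>A\<^esub> evaluate q"
    if w: "w \<in> lists X" for w
    using assms(2)
  proof (induction q rule: free_algebra_induct)
    case zero
    then show ?case using w by (simp add: evaluate_zero closed)
  next
    case (add c u q)
    have "lprod A (map v (w @ u)) = lprod A (map v w) \<otimes>\<^bsub>A\<^esub> lprod A (map v u)"
      using w add.hyps v unfolding map_append by (intro A.lprod_append) auto
    then show ?case
      using w add
      by (simp add: P.r_distr A.r_distr closed evaluate_add evaluate_smult evaluate_word_monom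
          right word_monom_mult)
  qed
  show ?thesis
    using assms(1)
  proof (induction p rule: free_algebra_induct)
    case zero
    then show ?case using assms(2) by (simp add: evaluate_zero closed)
  next
    case (add c u p)
    then show ?case
      using assms(2)
      by (simp add: P.l_distr A.l_distr closed evaluate_add evaluate_smult evaluate_word_monom
          left monom)
  qed
qed

lemma evaluate_hom: "restrict evaluate (carrier P) \<in> alg_hom F P A"
proof (rule alg_homI)
  show "restrict evaluate (carrier P) \<one>\<^bsub>P\<^esub> = \<one>\<^bsub>A\<^esub>"
    using evaluate_word_monom[of "[]"] word_monom_closed[of "[]"] by (simp add: ops)
qed (simp_all add: evaluate_closed evaluate_mult mult_closed evaluate_add add_closed
    evaluate_smult smult_closed)

lemma free_ext_unique_existence:
  "\<exists>!h. h \<in> alg_hom F P A \<and> (\<forall>x\<in>X. h (gen F x) = v x)"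
proof (rule ex_ex1I)
  have "\<forall>x\<in>X. restrict evaluate (carrier P) (gen F x) = v x"
    using v by (auto simp: gen_closed) (simp add: gen_eq_word_monom evaluate_word_monom lprod_Cons)
  with evaluate_hom show "\<exists>h. h \<in> alg_hom F P A \<and> (\<forall>x\<in>X. h (gen F x) = v x)"
    by blast
qed (auto intro: free_algebra_hom_eqI[OF A])

lemma free_ext_hom: "free_ext F X A v \<in> alg_hom F P A"
  and free_ext_gen: "x \<in> X \<Longrightarrow> free_ext F X A v (gen F x) = v x"
  using theI'[OF free_ext_unique_existence] by (auto simp: free_ext_def)

end

end

section \<open>Free products\<close>

lemma minus_eq_zero_iff:
  fixes G (structure)
  assumes "abelian_group G" "x \<in> carrier G" "y \<in> carrier G"
  shows "x \<ominus> y = \<zero> \<longleftrightarrow> x = y"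
proof -
  interpret abelian_group G by fact
  show ?thesis using assms(2,3)
    by (metis a_minus_def minus_equality minus_minus r_neg a_inv_closed)
qed

lemma alg_hom_minus:
  assumes "unital_algebra F A" "unital_algebra F B" "h \<in> alg_hom F A B" "x \<in> carrier A" "y \<in> carrier A"
  shows "h (x \<ominus>\<^bsub>A\<^esub> y) = h x \<ominus>\<^bsub>B\<^esub> h y"
proof -
  interpret ring_hom_ring A B h
    using assms by (intro ring_hom_ringI2) (auto dest: unital_algebraD alg_homD)
  show ?thesis using assms by (simp add: a_minus_def)
qed

lemma hom_relations_subset:
  assumes "unital_algebra F A" "unital_algebra F P" "\<And>a. a \<in> carrier A \<Longrightarrow> j a \<in> carrier P"
  shows "hom_relations F A P j \<subseteq> carrier P"
proof -
  interpret A: ring A by (rule unital_algebraD(2)[OF assms(1)])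
  interpret AM: Module.module F A by (rule unital_algebraD(3)[OF assms(1)])
  interpret P: ring P by (rule unital_algebraD(2)[OF assms(2)])
  interpret PM: Module.module F P by (rule unital_algebraD(3)[OF assms(2)])
  show ?thesis unfolding hom_relations_def using assms(3) by auto
qed

lemma hom_relationsI:
  "\<lbrakk>a \<in> carrier A; b \<in> carrier A\<rbrakk> \<Longrightarrow> j (a \<oplus>\<^bsub>A\<^esub> b) \<ominus>\<^bsub>P\<^esub> (j a \<oplus>\<^bsub>P\<^esub> j b) \<in> hom_relations F A P j"
  "\<lbrakk>a \<in> carrier A; b \<in> carrier A\<rbrakk> \<Longrightarrow> j (a \<otimes>\<^bsub>A\<^esub> b) \<ominus>\<^bsub>P\<^esub> (j a \<otimes>\<^bsub>P\<^esub> j b) \<in> hom_relations F A P j"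
  "\<lbrakk>c \<in> carrier F; a \<in> carrier A\<rbrakk> \<Longrightarrow> j (c \<odot>\<^bsub>A\<^esub> a) \<ominus>\<^bsub>P\<^esub> (c \<odot>\<^bsub>P\<^esub> j a) \<in> hom_relations F A P j"
  "j \<one>\<^bsub>A\<^esub> \<ominus>\<^bsub>P\<^esub> \<one>\<^bsub>P\<^esub> \<in> hom_relations F A P j"
  unfolding hom_relations_def by blast+

lemma hom_relations_vanish:
  assumes "unital_algebra F A" "unital_algebra F P" "unital_algebra F C"
    and j: "\<And>a. a \<in> carrier A \<Longrightarrow> j a \<in> carrier P"
    and h: "h \<in> alg_hom F P C" and f: "f \<in> alg_hom F A C"
    and eq: "\<And>a. a \<in> carrier A \<Longrightarrow> h (j a) = f a"
    and r: "r \<in> hom_relations F A P j"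
  shows "h r = \<zero>\<^bsub>C\<^esub>"
proof -
  interpret A: ring A by (rule unital_algebraD(2)[OF assms(1)])
  interpret AM: Module.module F A by (rule unital_algebraD(3)[OF assms(1)])
  interpret P: ring P by (rule unital_algebraD(2)[OF assms(2)])
  interpret PM: Module.module F P by (rule unital_algebraD(3)[OF assms(2)])
  interpret C: ring C by (rule unital_algebraD(2)[OF assms(3)])
  interpret CM: Module.module F C by (rule unital_algebraD(3)[OF assms(3)])
  have zero: "h (x \<ominus>\<^bsub>P\<^esub> y) = \<zero>\<^bsub>C\<^esub>" if "x \<in> carrier P" "y \<in> carrier P" "h x = h y" for x y
    using that alg_homD(2)[OF h]
    by (simp add: alg_hom_minus[OF assms(2,3) h] minus_eq_zero_iff[OF C.abelian_group_axioms])
  show ?thesis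
    using r unfolding hom_relations_def
    by (auto intro!: zero simp: j eq alg_homD(3-6)[OF h] alg_homD(3-6)[OF f])
qed

locale free_product_on =
  fixes F :: "('f, 'm) ring_scheme" and A :: "('f, 'a) module" and B :: "('f, 'b) module"
  assumes A: "unital_algebra F A" and B: "unital_algebra F B"
begin

abbreviation J where "J \<equiv> fp_ideal F A B"
abbreviation T where "T \<equiv> free_product F A B"

sublocale free_algebra_on F "carrier A <+> carrier B"
  using A unital_algebraD by (auto simp: free_algebra_on_def)

sublocale P: ring P by (rule ring_free_algebra)
sublocale PM: Module.module F P using unital_algebra_free_algebra by (rule unital_algebraD)

definition proj where "proj p = J +>\<^bsub>P\<^esub> p"

abbreviation relations where
  "relations \<equiv> hom_relations F A P (\<lambda>a. gen F (Inl a)) \<union> hom_relations F B P (\<lambda>b. gen F (Inr b))"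

lemma relations_subset: "relations \<subseteq> carrier P"
  using hom_relations_subset[OF A unital_algebra_free_algebra, of "\<lambda>a. gen F (Inl a)"]
    hom_relations_subset[OF B unital_algebra_free_algebra, of "\<lambda>b. gen F (Inr b)"] gen_closed
  by auto

sublocale J: ideal J P
  unfolding fp_ideal_def fp_free_def by (rule P.genideal_ideal[OF relations_subset])

lemma relations_subset_ideal: "relations \<subseteq> J"
  unfolding fp_ideal_def fp_free_def by (rule P.genideal_self[OF relations_subset])

lemma proj_eq_iff:
  assumes "p \<in> carrier P" "q \<in> carrier P"
  shows "proj p = proj q \<longleftrightarrow> p \<ominus>\<^bsub>P\<^esub> q \<in> J"
proof
  assume "proj p = proj q"
  then have "p \<in> J +>\<^bsub>P\<^esub> q"
    using J.a_rcos_self[OF assms(1)] by (simp add: proj_def)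
  then show "p \<ominus>\<^bsub>P\<^esub> q \<in> J"
    using J.a_rcos_module[OF assms(2,1)] by (simp add: a_minus_def)
next
  assume "p \<ominus>\<^bsub>P\<^esub> q \<in> J"
  then have "p \<in> J +>\<^bsub>P\<^esub> q"
    using J.a_rcos_module[OF assms(2,1)] by (simp add: a_minus_def)
  then show "proj p = proj q"
    using P.a_repr_independence[OF _ assms(2) J.a_subgroup] unfolding proj_def by blast
qed

lemma carrier_T: "carrier T = proj ` carrier P"
  by (auto simp: free_product_def fp_free_def Let_def FactRing_simps proj_def)

lemma proj_ops:
  assumes "p \<in> carrier P" "q \<in> carrier P"
  shows "proj p \<oplus>\<^bsub>T\<^esub> proj q = proj (p \<oplus>\<^bsub>P\<^esub> q)" "proj p \<otimes>\<^bsub>T\<^esub> proj q = proj (p \<otimes>\<^bsub>P\<^esub> q)"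
  using assms
  by (auto simp: free_product_def fp_free_def Let_def FactRing_simps proj_def J.rcoset_mult_add J.a_rcos_sum)

lemma proj_consts: "\<one>\<^bsub>T\<^esub> = proj \<one>\<^bsub>P\<^esub>" "\<zero>\<^bsub>T\<^esub> = proj \<zero>\<^bsub>P\<^esub>"
  by (auto simp: free_product_def fp_free_def Let_def FactRing_simps proj_def J.a_subset)

text \<open>Scalars act by ring elements, c p = (c 1) p, so a ring ideal is stable under them and
  the quotient is again an algebra.\<close>

lemma smult_ideal: "c \<in> carrier F \<Longrightarrow> p \<in> J \<Longrightarrow> c \<odot>\<^bsub>P\<^esub> p \<in> J"
proof -
  assume *: "c \<in> carrier F" "p \<in> J"
  then have p: "p \<in> carrier P" by simp
  have "c \<odot>\<^bsub>P\<^esub> p = (c \<odot>\<^bsub>P\<^esub> \<one>\<^bsub>P\<^esub>) \<otimes>\<^bsub>P\<^esub> p"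
    using * p by (simp add: unital_algebra.smult_mult_left[OF unital_algebra_free_algebra])
  then show ?thesis using * by (simp add: J.I_l_closed)
qed

text \<open>The scalar action on a coset is defined as a union over its representatives; all of them
  give the same coset, so the union is that coset.\<close>

lemma proj_smult:
  assumes c: "c \<in> carrier F" and p: "p \<in> carrier P"
  shows "c \<odot>\<^bsub>T\<^esub> proj p = proj (c \<odot>\<^bsub>P\<^esub> p)"
proof -
  have const: "proj (c \<odot>\<^bsub>P\<^esub> q) = proj (c \<odot>\<^bsub>P\<^esub> p)" if "q \<in> proj p" for q
  proof -
    have q: "q \<in> carrier P"
      using that p J.a_subset P.a_r_coset_subset_G unfolding proj_def by blast
    then have "q \<ominus>\<^bsub>P\<^esub> p \<in> J"
      using that J.a_rcos_module[OF p q] by (simp add: proj_def a_minus_def)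
    then have "c \<odot>\<^bsub>P\<^esub> (q \<ominus>\<^bsub>P\<^esub> p) \<in> J" using c by (simp add: smult_ideal)
    moreover have "c \<odot>\<^bsub>P\<^esub> (q \<ominus>\<^bsub>P\<^esub> p) = c \<odot>\<^bsub>P\<^esub> q \<ominus>\<^bsub>P\<^esub> c \<odot>\<^bsub>P\<^esub> p"
      using c p q by (simp add: a_minus_def PM.smult_r_distr PM.smult_r_minus)
    ultimately show ?thesis using c p q by (simp add: proj_eq_iff)
  qed
  have "p \<in> proj p" using p by (simp add: proj_def J.a_rcos_self)
  then have "(\<Union>q\<in>proj p. proj (c \<odot>\<^bsub>P\<^esub> q)) = proj (c \<odot>\<^bsub>P\<^esub> p)"
    by (intro SUP_eq_const const) blast
  then show ?thesis
    by (simp add: free_product_def fp_free_def Let_def proj_def)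
qed

lemma ring_T: "ring T"
proof (intro ringI abelian_groupI monoidI)
  fix X assume "X \<in> carrier T"
  then obtain p where "p \<in> carrier P" "X = proj p" by (auto simp: carrier_T)
  then show "\<exists>Y\<in>carrier T. Y \<oplus>\<^bsub>T\<^esub> X = \<zero>\<^bsub>T\<^esub>"
    by (intro bexI[of _ "proj (\<ominus>\<^bsub>P\<^esub> p)"]) (auto simp: carrier_T proj_ops proj_consts P.l_neg)
qed (auto simp: carrier_T proj_ops proj_consts P.a_ac P.m_assoc P.l_distr P.r_distr)

lemma unital_algebra_free_product: "unital_algebra F T"
proof (rule unital_algebraI[OF _ ring_T])
  show "field F" using A by (rule unital_algebraD)
qed (auto simp: carrier_T proj_ops proj_smult PM.smult_l_distr PM.smult_r_distr PM.smult_assoc1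
    unital_algebra.smult_mult_left[OF unital_algebra_free_algebra]
    unital_algebra.smult_mult_right[OF unital_algebra_free_algebra])

lemma proj_hom: "restrict proj (carrier P) \<in> alg_hom F P T"
  by (rule alg_homI) (auto simp: carrier_T proj_ops proj_smult proj_consts)

text \<open>By \<open>proj_eq_iff\<close>, each relation in \<open>J\<close> becomes one of the
  equations of a homomorphism after projection.\<close>

lemma restrict_proj_comp_hom:
  assumes U: "unital_algebra F U" and j [simp]: "\<And>a. a \<in> carrier U \<Longrightarrow> j a \<in> carrier P"
    and rel: "hom_relations F U P j \<subseteq> J"
  shows "(\<lambda>a\<in>carrier U. proj (j a)) \<in> alg_hom F U T"
proof -
  interpret U: ring U using U unital_algebraD by blast
  interpret UM: Module.module F U using U unital_algebraD by blast
  note rel' = hom_relationsI[THEN subsetD[OF rel]]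
  show ?thesis
    by (intro alg_homI) (auto simp: carrier_T proj_ops proj_smult proj_consts proj_eq_iff rel')
qed

lemma incl1_hom: "incl1 F A B \<in> alg_hom F A T"
  unfolding incl1_def fp_free_def proj_def[symmetric]
  using relations_subset_ideal gen_closed by (intro restrict_proj_comp_hom A) auto

lemma incl2_hom: "incl2 F A B \<in> alg_hom F B T"
  unfolding incl2_def fp_free_def proj_def[symmetric]
  using relations_subset_ideal gen_closed by (intro restrict_proj_comp_hom B) auto

lemma incl1_eq: "a \<in> carrier A \<Longrightarrow> incl1 F A B a = proj (gen F (Inl a))"
  by (simp add: incl1_def proj_def fp_free_def)

lemma incl2_eq: "b \<in> carrier B \<Longrightarrow> incl2 F A B b = proj (gen F (Inr b))"
  by (simp add: incl2_def proj_def fp_free_def)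

text \<open>Pulled back along the surjective projection, both maps live on the free algebra, whose
  generators are the elements of the two summands.\<close>

lemma free_product_hom_eqI:
  assumes C: "unital_algebra F C" and h: "h \<in> alg_hom F T C" "h' \<in> alg_hom F T C"
    and "\<And>a. a \<in> carrier A \<Longrightarrow> h (incl1 F A B a) = h' (incl1 F A B a)"
    and "\<And>b. b \<in> carrier B \<Longrightarrow> h (incl2 F A B b) = h' (incl2 F A B b)"
  shows "h = h'"
proof (rule alg_hom_eqI[OF h])
  have "compose (carrier P) h (restrict proj (carrier P)) = compose (carrier P) h' (restrict proj (carrier P))"
    using assms gen_closed
    by (intro free_algebra_hom_eqI[OF C] compose_alg_hom[OF unital_algebra_free_algebra proj_hom])
      (auto simp: compose_eq incl1_eq incl2_eq)
  then have "h (proj p) = h' (proj p)" if "p \<in> carrier P" for p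
    using that by (auto dest: fun_cong[of _ _ p] simp: compose_eq)
  then show "h x = h' x" if "x \<in> carrier T" for x
    using that by (auto simp: carrier_T)
qed

section \<open>Universal property of the free product\<close>

context
  fixes C :: "('f, 'c) module" and f g
  assumes C: "unital_algebra F C" and f: "f \<in> alg_hom F A C" and g: "g \<in> alg_hom F B C"
begin

interpretation C: ring C using C unital_algebraD by blast

definition lift where "lift = free_ext F (carrier A <+> carrier B) C (case_sum f g)"

lemma lift_hom: "lift \<in> alg_hom F P C"
  and lift_gen: "x \<in> carrier A <+> carrier B \<Longrightarrow> lift (gen F x) = case_sum f g x"
  unfolding lift_def using alg_homD(2)[OF f] alg_homD(2)[OF g]
  by (auto intro!: free_ext_hom[OF C] free_ext_gen[OF C])

text \<open>The kernel of \<open>lift\<close> is an ideal that contains the relations, hence also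
  the ideal generated by them.\<close>

lemma lift_ideal: "r \<in> J \<Longrightarrow> lift r = \<zero>\<^bsub>C\<^esub>"
proof -
  interpret ring_hom_ring P C lift
    using lift_hom alg_homD(1) by (intro ring_hom_ringI2) (auto intro: P.ring_axioms C.ring_axioms)
  have vanish: "lift r = \<zero>\<^bsub>C\<^esub>" if "r \<in> relations" for r
    using that
  proof
    assume "r \<in> hom_relations F A P (\<lambda>a. gen F (Inl a))"
    then show ?thesis
      by (rule hom_relations_vanish[OF A unital_algebra_free_algebra C _ lift_hom f, rotated 2])
        (simp_all add: gen_closed InlI lift_gen)
  next
    assume "r \<in> hom_relations F B P (\<lambda>b. gen F (Inr b))"
    then show ?thesis
      by (rule hom_relations_vanish[OF B unital_algebra_free_algebra C _ lift_hom g, rotated 2])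
        (simp_all add: gen_closed InrI lift_gen)
  qed
  have "relations \<subseteq> a_kernel P C lift"
    unfolding a_kernel_def'
    by (intro subsetI CollectI conjI vanish subsetD[OF relations_subset])
  then have "J \<subseteq> a_kernel P C lift"
    unfolding fp_ideal_def fp_free_def by (intro P.genideal_minimal kernel_is_ideal)
  then show "r \<in> J \<Longrightarrow> lift r = \<zero>\<^bsub>C\<^esub>"
    unfolding a_kernel_def' by blast
qed

text \<open>The value at a coset is computed from a chosen representative;
  \<open>factor_proj\<close> shows independence of the choice.\<close>

definition factor where
  "factor = (\<lambda>x\<in>carrier T. lift (SOME p. p \<in> carrier P \<and> x = proj p))"

lemma factor_proj: "p \<in> carrier P \<Longrightarrow> factor (proj p) = lift p"
proof -
  assume p: "p \<in> carrier P"
  define q where "q = (SOME q. q \<in> carrier P \<and> proj p = proj q)"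
  have q: "q \<in> carrier P" "proj p = proj q"
    using someI[of "\<lambda>q. q \<in> carrier P \<and> proj p = proj q" p] p unfolding q_def by auto
  then have "lift (p \<ominus>\<^bsub>P\<^esub> q) = \<zero>\<^bsub>C\<^esub>" using p by (intro lift_ideal) (simp add: proj_eq_iff)
  then have "lift p = lift q"
    using p q alg_homD(2)[OF lift_hom]
    by (simp add: alg_hom_minus[OF unital_algebra_free_algebra C lift_hom] minus_eq_zero_iff[OF C.abelian_group_axioms])
  then show ?thesis using p by (simp add: factor_def carrier_T q_def)
qed

lemma factor_hom: "factor \<in> alg_hom F T C"
proof (rule alg_homI)
  show "factor \<in> extensional (carrier T)" by (simp add: factor_def)
qed (auto simp: carrier_T proj_ops proj_smult proj_consts factor_proj alg_homD[OF lift_hom])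

lemma copair_unique_existence:
  "\<exists>!h. h \<in> alg_hom F T C \<and>
     compose (carrier A) h (incl1 F A B) = f \<and> compose (carrier B) h (incl2 F A B) = g"
proof (rule ex_ex1I)
  have "compose (carrier A) factor (incl1 F A B) = f"
  proof (rule extensionalityI[OF compose_extensional alg_homD(7)[OF f]])
    fix a assume "a \<in> carrier A"
    then show "compose (carrier A) factor (incl1 F A B) a = f a"
      by (simp add: compose_eq incl1_eq factor_proj gen_closed lift_gen InlI)
  qed
  moreover have "compose (carrier B) factor (incl2 F A B) = g"
  proof (rule extensionalityI[OF compose_extensional alg_homD(7)[OF g]])
    fix b assume "b \<in> carrier B"
    then show "compose (carrier B) factor (incl2 F A B) b = g b"
      by (simp add: compose_eq incl2_eq factor_proj gen_closed lift_gen InrI)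
  qed
  ultimately show "\<exists>h. h \<in> alg_hom F T C \<and>
     compose (carrier A) h (incl1 F A B) = f \<and> compose (carrier B) h (incl2 F A B) = g"
    using factor_hom by blast
next
  fix h h'
  assume *: "h \<in> alg_hom F T C \<and>
      compose (carrier A) h (incl1 F A B) = f \<and> compose (carrier B) h (incl2 F A B) = g"
    "h' \<in> alg_hom F T C \<and>
      compose (carrier A) h' (incl1 F A B) = f \<and> compose (carrier B) h' (incl2 F A B) = g"
  then have "h (incl1 F A B a) = h' (incl1 F A B a)" if "a \<in> carrier A" for a
    using that by (metis compose_eq)
  moreover have "h (incl2 F A B b) = h' (incl2 F A B b)" if "b \<in> carrier B" for b
    using * that by (metis compose_eq)
  ultimately show "h = h'"
    using * by (intro free_product_hom_eqI[OF C]) auto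
qed

lemma copair_hom: "copair F A B C f g \<in> alg_hom F T C"
  and copair_incl1: "a \<in> carrier A \<Longrightarrow> copair F A B C f g (incl1 F A B a) = f a"
  and copair_incl2: "b \<in> carrier B \<Longrightarrow> copair F A B C f g (incl2 F A B b) = g b"
proof -
  let ?h = "copair F A B C f g"
  have *: "?h \<in> alg_hom F T C" "compose (carrier A) ?h (incl1 F A B) = f"
    "compose (carrier B) ?h (incl2 F A B) = g"
    using theI'[OF copair_unique_existence] by (simp_all add: copair_def)
  then show "?h \<in> alg_hom F T C" by blast
  show "?h (incl1 F A B a) = f a" if "a \<in> carrier A"
    using fun_cong[OF *(2), of a] that by (simp add: compose_eq)
  show "?h (incl2 F A B b) = g b" if "b \<in> carrier B"
    using fun_cong[OF *(3), of b] that by (simp add: compose_eq)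
qed

end

end

lemmas free_product_algebra = free_product_on.unital_algebra_free_product[OF free_product_on.intro]
lemmas incl1_alg_hom = free_product_on.incl1_hom[OF free_product_on.intro]
lemmas incl2_alg_hom = free_product_on.incl2_hom[OF free_product_on.intro]
lemmas free_product_hom_eq = free_product_on.free_product_hom_eqI[OF free_product_on.intro]
lemmas copair_alg_hom = free_product_on.copair_hom[OF free_product_on.intro]
lemmas copair_incl = free_product_on.copair_incl1[OF free_product_on.intro]
  free_product_on.copair_incl2[OF free_product_on.intro]

lemma coprod_map_alg_hom:
  assumes "unital_algebra F A" "unital_algebra F B" "unital_algebra F C" "unital_algebra F D"
    and "f \<in> alg_hom F A C" "g \<in> alg_hom F B D"
  shows "coprod_map F A B C D f g \<in> alg_hom F (free_product F A B) (free_product F C D)"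
    and "a \<in> carrier A \<Longrightarrow> coprod_map F A B C D f g (incl1 F A B a) = incl1 F C D (f a)"
    and "b \<in> carrier B \<Longrightarrow> coprod_map F A B C D f g (incl2 F A B b) = incl2 F C D (g b)"
proof -
  have f: "compose (carrier A) (incl1 F C D) f \<in> alg_hom F A (free_product F C D)"
    using assms by (intro compose_alg_hom[where B = C] incl1_alg_hom)
  have g: "compose (carrier B) (incl2 F C D) g \<in> alg_hom F B (free_product F C D)"
    using assms by (intro compose_alg_hom[where B = D] incl2_alg_hom)
  note T = free_product_algebra[OF assms(3,4)]
  show "coprod_map F A B C D f g \<in> alg_hom F (free_product F A B) (free_product F C D)"
    unfolding coprod_map_def by (rule copair_alg_hom[OF assms(1,2) T f g])
  show "a \<in> carrier A \<Longrightarrow> coprod_map F A B C D f g (incl1 F A B a) = incl1 F C D (f a)"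
    unfolding coprod_map_def by (simp add: copair_incl(1)[OF assms(1,2) T f g] compose_eq)
  show "b \<in> carrier B \<Longrightarrow> coprod_map F A B C D f g (incl2 F A B b) = incl2 F C D (g b)"
    unfolding coprod_map_def by (simp add: copair_incl(2)[OF assms(1,2) T f g] compose_eq)
qed

lemma folding_alg_hom:
  assumes "unital_algebra F A"
  shows "folding F A \<in> alg_hom F (free_product F A A) A"
    and "a \<in> carrier A \<Longrightarrow> folding F A (incl1 F A A a) = a"
    and "a \<in> carrier A \<Longrightarrow> folding F A (incl2 F A A a) = a"
proof -
  note id = alg_id_hom[OF assms]
  show "folding F A \<in> alg_hom F (free_product F A A) A"
    unfolding folding_def by (rule copair_alg_hom[OF assms assms assms id id])
  show "a \<in> carrier A \<Longrightarrow> folding F A (incl1 F A A a) = a"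
    "a \<in> carrier A \<Longrightarrow> folding F A (incl2 F A A a) = a"
    unfolding folding_def by (simp_all add: copair_incl[OF assms assms assms id id]) (simp_all add: alg_id_def)
qed

section \<open>Naturality of the operations on series\<close>

lemma ring_hom_finsum:
  assumes "ring R" "ring S" "h \<in> ring_hom R S" "\<And>i. i \<in> I \<Longrightarrow> f i \<in> carrier R"
  shows "h (finsum R f I) = finsum S (\<lambda>i. h (f i)) I"
proof -
  interpret R: ring R by fact
  interpret S: ring S by fact
  show ?thesis using assms(4)
  proof (induction I rule: infinite_finite_induct)
    case (insert i I)
    then show ?case
      using ring_hom_closed[OF assms(3)] by (simp add: Pi_def ring_hom_add[OF assms(3)])
  qed (simp_all add: ring_hom_zero[OF assms(3,1,2)])
qed

context
  fixes R :: "('a, 'm) ring_scheme" and S :: "('b, 'n) ring_scheme" and h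
  assumes R: "ring R" and S: "ring S" and h: "h \<in> ring_hom R S"
begin

interpretation R: ring R by (rule R)
interpretation S: ring S by (rule S)

lemma ring_hom_series_power:
  assumes "\<And>i. b i \<in> carrier R"
  shows "h (series_power R b m n) = series_power S (\<lambda>i. h (b i)) m n"
proof (induction m arbitrary: n)
  case 0
  show ?case by (simp add: ring_hom_one[OF h] ring_hom_zero[OF h R S])
next
  case (Suc m)
  have "h (series_power R b (Suc m) n) = (\<Oplus>\<^bsub>S\<^esub>i\<in>{..n}. h (b i \<otimes>\<^bsub>R\<^esub> series_power R b m (n - i)))"
    unfolding series_power.simps using assms by (intro ring_hom_finsum[OF R S h]) simp
  then show ?case
    using assms by (simp add: ring_hom_mult[OF h] Suc)
qed

lemma ring_hom_diff_carrier: "a \<in> diff_carrier R \<Longrightarrow> (\<lambda>n. h (a n)) \<in> diff_carrier S"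
  by (auto simp: diff_carrier_def ring_hom_closed[OF h] ring_hom_one[OF h])

lemma ring_hom_diff_mult:
  assumes "a \<in> diff_carrier R" "b \<in> diff_carrier R"
  shows "(\<lambda>n. h (diff_mult R a b n)) = diff_mult S (\<lambda>n. h (a n)) (\<lambda>n. h (b n))"
proof
  fix n
  note [simp] = assms[THEN R.diff_carrierD(1)] assms[THEN ring_hom_diff_carrier, THEN S.diff_carrierD(1)]
  have "h (diff_mult R a b n) = (\<Oplus>\<^bsub>S\<^esub>m\<in>{..n}. h (a m \<otimes>\<^bsub>R\<^esub> series_power R b (Suc m) (n - m)))"
    by (simp add: R.diff_mult_eq ring_hom_finsum[OF R S h] del: series_power.simps)
  then show "h (diff_mult R a b n) = diff_mult S (\<lambda>n. h (a n)) (\<lambda>n. h (b n)) n"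
    by (simp add: S.diff_mult_eq ring_hom_mult[OF h] ring_hom_series_power del: series_power.simps)
qed

text \<open>Since \<open>h\<close> preserves composition, the image of a / b solves the equation
  whose only solution is the quotient of the images.\<close>

lemma ring_hom_rdiv_Diff:
  assumes ab: "a \<in> diff_carrier R" "b \<in> diff_carrier R"
  shows "(\<lambda>n. h (rdiv (Diff R) a b n)) = rdiv (Diff S) (\<lambda>n. h (a n)) (\<lambda>n. h (b n))"
proof -
  have "rdiv (Diff R) a b \<in> diff_carrier R" "diff_mult R (rdiv (Diff R) a b) b = a"
    by (simp_all add: R.rdiv_Diff_eq[OF ab] R.rdiv_series_closed[OF ab] R.rdiv_series_mult[OF ab])
  then show ?thesis
    using ring_hom_diff_mult[of "rdiv (Diff R) a b" b] ab
    by (intro S.rdiv_Diff_unique[symmetric] ring_hom_diff_carrier) simp_all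
qed

lemma ring_hom_ldiv_Diff:
  assumes ab: "a \<in> diff_carrier R" "b \<in> diff_carrier R"
  shows "(\<lambda>n. h (ldiv (Diff R) a b n)) = ldiv (Diff S) (\<lambda>n. h (a n)) (\<lambda>n. h (b n))"
proof -
  have "ldiv (Diff R) a b \<in> diff_carrier R" "diff_mult R a (ldiv (Diff R) a b) = b"
    by (simp_all add: R.ldiv_Diff_eq[OF ab] R.ldiv_series_closed[OF ab] R.mult_ldiv_series[OF ab])
  then show ?thesis
    using ring_hom_diff_mult[of a "ldiv (Diff R) a b"] ab
    by (intro S.ldiv_Diff_unique[symmetric] ring_hom_diff_carrier) simp_all
qed

end

section \<open>The composition in terms of compositions of integers\<close>

text \<open>The words of a composite: an a-letter (1, n) followed by b-letters supplied by some of
  the n + 1 factors, or a single b-letter, which stems from the leading coefficient of the left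
  operand.\<close>

lemma word_subst_letter_coeff_Cons:
  "word_subst (letter_coeff 1) (letter_coeff 2) (x # w) =
    (if fst x = 1 \<and> (\<forall>y\<in>set w. fst y = 2) then int ((snd x + 1) choose length w) else 0) +
    (if fst x = 2 \<and> w = [] then 1 else 0)"
proof -
  let ?B = "\<lambda>i. conv_pow (letter_coeff 2) (word_weight (take i (x # w)) + 1) (drop i (x # w))"
  have "word_subst (letter_coeff 1) (letter_coeff 2) (x # w)
      = letter_coeff 1 [] * ?B 0 + (\<Sum>i\<le>length w. letter_coeff 1 (x # take i w) * ?B (Suc i))"
    unfolding word_subst_def length_Cons by (simp only: sum.atMost_Suc_shift take_0 take_Suc_Cons)
  also have "(\<Sum>i\<le>length w. letter_coeff 1 (x # take i w) * ?B (Suc i))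
      = (\<Sum>i\<in>{0}. letter_coeff 1 (x # take i w) * ?B (Suc i))"
    by (rule sum.mono_neutral_right) (auto simp: letter_coeff_Cons)
  also have "letter_coeff 1 [] * ?B 0 = (if fst x = 2 \<and> w = [] then 1 else 0)"
    by (auto simp: letter_coeff_def conv_pow_letter_coeff simp del: conv_pow.simps)
  finally show ?thesis
    by (auto simp: letter_coeff_Cons conv_pow_letter_coeff word_weight_def simp del: conv_pow.simps)
qed

context ring
begin

definition mult_formula :: "(nat \<Rightarrow> 'a) \<Rightarrow> (nat \<Rightarrow> 'a) \<Rightarrow> nat \<Rightarrow> nat \<Rightarrow> 'a" where
  "mult_formula a b n l = (\<Oplus>ns\<in>compositions n (l + 1).
     [((ns ! 0 + 1) choose l)] \<cdot> (a (ns ! 0) \<otimes> lprod R (map b (tl ns))))"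

text \<open>Brings composition into the shape of \<open>FdB_comult\<close>. Among words with at
  least two letters, only the label sequence 1 2 ... 2 survives.\<close>

lemma diff_mult_eq_formula:
  assumes ab: "a \<in> diff_carrier R" "b \<in> diff_carrier R" and n: "n \<ge> 1"
  shows "diff_mult R a b n = a n \<oplus> b n \<oplus> (\<Oplus>l\<in>{1..n - 1}. mult_formula a b n l)"
proof -
  note [simp] = ab[THEN diff_carrierD(1)] pair_value_closed[OF ab] word_closed[OF pair_value_closed[OF ab]]
  define p where "p = word_subst (letter_coeff 1) (letter_coeff 2)"
  define t where "t l = (\<Oplus>ns\<in>compositions n (l + 1). \<Oplus>es\<in>Eseq (l + 1).
    [p (zip es ns)] \<cdot> lprod R (map (pair_value a b) (zip es ns)))" for l
  have t_closed: "t l \<in> carrier R" for l by (auto simp: t_def)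
  have "diff_mult R a b = word_series R (pair_value a b) p"
    using diff_mult_word_series[of "pair_value a b" "letter_coeff 1" "letter_coeff 2", OF pair_value_closed[OF ab]]
    unfolding p_def word_series_letter_coeff_1[OF ab] word_series_letter_coeff_2[OF ab] .
  then have "diff_mult R a b n = (\<Oplus>l\<in>{0..n - 1}. t l)"
    unfolding t_def by (simp only:) (rule word_series_eq_finsum_zip[OF pair_value_closed[OF ab] n])
  also have "\<dots> = t 0 \<oplus> (\<Oplus>l\<in>{1..n - 1}. t l)"
    by (rule finsum_atLeastAtMost_0) (auto simp: t_closed)
  \<comment> \<open>In words of one letter both labels occur, which is the linear part of the
    formula.\<close>
  also have "t 0 = a n \<oplus> b n"
  proof -
    have "Eseq (Suc 0) = {[1], [2]}"
      by (auto simp: Eseq_def length_Suc_conv)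
    then show ?thesis using n
      by (simp add: t_def compositions_1 p_def word_subst_letter_coeff_Cons[simplified] lprod_Cons)
        (simp add: pair_value_def pick_def)
  qed
  also have "(\<Oplus>l\<in>{1..n - 1}. t l) = (\<Oplus>l\<in>{1..n - 1}. mult_formula a b n l)"
  proof (intro add.finprod_cong' refl)
    fix l assume l: "l \<in> {1..n - 1}"
    show "t l = mult_formula a b n l"
      unfolding t_def mult_formula_def
    proof (intro add.finprod_cong' refl)
      fix ns assume "ns \<in> compositions n (l + 1)"
      then obtain m ms where ms: "ns = m # ms" "length ms = l"
        by (cases ns) (auto simp: compositions_def)
      let ?f = "\<lambda>es. [p (zip es ns)] \<cdot> lprod R (map (pair_value a b) (zip es ns))"
      have P: "map (pair_value a b) (zip (replicate l 2) ms) = map b ms"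
        by (rule nth_equalityI) (auto simp: ms pair_value_def pick_def)
      have "finsum R ?f (Eseq (l + 1)) = ?f (1 # replicate l 2)"
      proof (rule finsum_eq_single)
        show "1 # replicate l 2 \<in> Eseq (l + 1)" by (auto simp: Eseq_def)
        fix es assume es: "es \<in> Eseq (l + 1)" "es \<noteq> 1 # replicate l 2"
        then obtain e es' where es': "es = e # es'" "length es' = l"
          by (cases es) (auto simp: Eseq_def)
        have "p (zip es ns) = 0"
        proof (cases "e = 1")
          case True
          with es es' have "es' \<noteq> replicate l 2" by auto
          then obtain i where i: "i < l" "es' ! i \<noteq> 2"
            using es'(2) by (metis nth_equalityI length_replicate nth_replicate)
          then have "(es' ! i, ms ! i) \<in> set (zip es' ms)"
            using es' ms by (auto simp: set_zip)
          then show ?thesis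
            using i True by (auto simp: p_def es' ms word_subst_letter_coeff_Cons[simplified])
        next
          case False
          moreover have "zip es' ms \<noteq> []" using l es' ms by auto
          ultimately show ?thesis
            by (simp add: p_def es' ms word_subst_letter_coeff_Cons[simplified])
        qed
        then show "?f es = \<zero>" by simp
      qed auto
      also have "p (zip (1 # replicate l 2) ns) = int ((m + 1) choose l)"
        using ms by (auto simp: p_def word_subst_letter_coeff_Cons[simplified] dest: set_zip_leftD)
      also have "lprod R (map (pair_value a b) (zip (1 # replicate l 2) ns)) = a m \<otimes> lprod R (map b ms)"
        by (simp add: ms lprod_Cons P) (simp add: pair_value_def pick_def)
      finally show "finsum R ?f (Eseq (l + 1))
          = [((ns ! 0 + 1) choose l)] \<cdot> (a (ns ! 0) \<otimes> lprod R (map b (tl ns)))"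
        by (simp add: ms add_pow_int_ge)
    qed (auto intro!: add.nat_pow_closed m_closed lprod_closed)
  qed (auto simp: mult_formula_def intro!: finsum_closed add.nat_pow_closed m_closed lprod_closed)
  finally show ?thesis by (simp add: t_closed)
qed

context
  fixes a a' b b' :: "nat \<Rightarrow> 'a"
  assumes eq: "\<And>n. n \<ge> 1 \<Longrightarrow> a n = a' n" "\<And>n. n \<ge> 1 \<Longrightarrow> b n = b' n"
    and closed [simp]: "\<And>n. a' n \<in> carrier R" "\<And>n. b' n \<in> carrier R"
begin

lemma map_tl_cong: "ns \<in> compositions n l \<Longrightarrow> map b (tl ns) = map b' (tl ns)"
  by (cases ns) (auto simp: compositions_def eq)

text \<open>Compositions have positive parts, so the formulas do not see index 0. There
  \<open>gen1\<close> and \<open>gen2\<close> have no specified value, whereas the universal series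
  have leading coefficient 1.\<close>

lemma mult_formula_cong: "mult_formula a b n l = mult_formula a' b' n l"
  unfolding mult_formula_def
  by (intro add.finprod_cong' refl)
    (auto simp: map_tl_cong eq compositions_nth simp del: One_nat_def
      intro!: finsum_closed add.nat_pow_closed m_closed lprod_closed)

lemma rdiv_formula_cong: "rdiv_formula a b n l = rdiv_formula a' b' n l"
  unfolding rdiv_formula_def
  by (intro add.finprod_cong' refl)
    (auto simp: map_tl_cong eq compositions_nth simp del: One_nat_def
      intro!: finsum_closed add.int_pow_closed m_closed lprod_closed)

lemma ldiv_formula_cong: "ldiv_formula a b n l = ldiv_formula a' b' n l"
  unfolding ldiv_formula_def
proof (intro add.finprod_cong' refl)
  fix ns es assume ns: "ns \<in> compositions n (l + 1)"
  then have "map (\<lambda>i. pick a b (es ! i) (ns ! i)) [0..<l] = map (\<lambda>i. pick a' b' (es ! i) (ns ! i)) [0..<l]"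
    by (auto simp: pick_def eq compositions_nth simp del: One_nat_def)
  moreover have "b (ns ! l) \<ominus> a (ns ! l) = b' (ns ! l) \<ominus> a' (ns ! l)"
    using ns by (simp add: eq compositions_nth del: One_nat_def)
  ultimately show "[((-1) ^ l * esign es * int (dcoeff_e es (take l ns)))] \<cdot>
           (lprod R (map (\<lambda>i. pick a b (es ! i) (ns ! i)) [0..<l]) \<otimes> (b (ns ! l) \<ominus> a (ns ! l)))
    = [((-1) ^ l * esign es * int (dcoeff_e es (take l ns)))] \<cdot>
           (lprod R (map (\<lambda>i. pick a' b' (es ! i) (ns ! i)) [0..<l]) \<otimes> (b' (ns ! l) \<ominus> a' (ns ! l)))"
    by (simp only:)
qed (auto intro!: finsum_closed add.int_pow_closed m_closed lprod_closed simp: pick_def)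

end

end

section \<open>Re-association followed by folding\<close>

lemma assoc_right_alg_hom:
  assumes A: "unital_algebra F A" and B: "unital_algebra F B" and C: "unital_algebra F C"
  defines "AB \<equiv> free_product F A B" and "BC \<equiv> free_product F B C"
  shows "assoc_right F A B C \<in> alg_hom F (free_product F AB C) (free_product F A BC)"
    and "a \<in> carrier A \<Longrightarrow> assoc_right F A B C (incl1 F AB C (incl1 F A B a)) = incl1 F A BC a"
    and "b \<in> carrier B \<Longrightarrow>
      assoc_right F A B C (incl1 F AB C (incl2 F A B b)) = incl2 F A BC (incl1 F B C b)"
    and "c \<in> carrier C \<Longrightarrow> assoc_right F A B C (incl2 F AB C c) = incl2 F A BC (incl2 F B C c)"
proof -
  note AB = free_product_algebra[OF A B, folded AB_def]
  note BC = free_product_algebra[OF B C, folded BC_def]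
  note T = free_product_algebra[OF A BC]
  note i = incl1_alg_hom[OF A BC]
  note j = compose_alg_hom[OF B incl1_alg_hom[OF B C, folded BC_def] incl2_alg_hom[OF A BC]]
  note k = compose_alg_hom[OF C incl2_alg_hom[OF B C, folded BC_def] incl2_alg_hom[OF A BC]]
  note ij = copair_alg_hom[OF A B T i j, folded AB_def]
  note eq = assoc_right_def[of F A B C, unfolded Let_def, folded AB_def BC_def]
  show "assoc_right F A B C \<in> alg_hom F (free_product F AB C) (free_product F A BC)"
    unfolding eq by (rule copair_alg_hom[OF AB C T ij k])
  have mem: "a \<in> carrier A \<Longrightarrow> incl1 F A B a \<in> carrier AB" "b \<in> carrier B \<Longrightarrow> incl2 F A B b \<in> carrier AB"
    using alg_homD(2)[OF incl1_alg_hom[OF A B]] alg_homD(2)[OF incl2_alg_hom[OF A B]]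
    by (auto simp: AB_def)
  note incl = copair_incl(1)[OF AB C T ij k] copair_incl(2)[OF AB C T ij k]
    copair_incl(1)[OF A B T i j] copair_incl(2)[OF A B T i j]
  show "a \<in> carrier A \<Longrightarrow> assoc_right F A B C (incl1 F AB C (incl1 F A B a)) = incl1 F A BC a"
    "b \<in> carrier B \<Longrightarrow> assoc_right F A B C (incl1 F AB C (incl2 F A B b)) = incl2 F A BC (incl1 F B C b)"
    "c \<in> carrier C \<Longrightarrow> assoc_right F A B C (incl2 F AB C c) = incl2 F A BC (incl2 F B C c)"
    unfolding eq by (simp_all add: incl mem compose_eq)
qed

lemma assoc_left_alg_hom:
  assumes A: "unital_algebra F A" and B: "unital_algebra F B" and C: "unital_algebra F C"
  defines "AB \<equiv> free_product F A B" and "BC \<equiv> free_product F B C"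
  shows "assoc_left F A B C \<in> alg_hom F (free_product F A BC) (free_product F AB C)"
    and "a \<in> carrier A \<Longrightarrow> assoc_left F A B C (incl1 F A BC a) = incl1 F AB C (incl1 F A B a)"
    and "b \<in> carrier B \<Longrightarrow>
      assoc_left F A B C (incl2 F A BC (incl1 F B C b)) = incl1 F AB C (incl2 F A B b)"
    and "c \<in> carrier C \<Longrightarrow> assoc_left F A B C (incl2 F A BC (incl2 F B C c)) = incl2 F AB C c"
proof -
  note AB = free_product_algebra[OF A B, folded AB_def]
  note BC = free_product_algebra[OF B C, folded BC_def]
  note T = free_product_algebra[OF AB C]
  note i = compose_alg_hom[OF A incl1_alg_hom[OF A B, folded AB_def] incl1_alg_hom[OF AB C]]
  note j = compose_alg_hom[OF B incl2_alg_hom[OF A B, folded AB_def] incl1_alg_hom[OF AB C]]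
  note k = incl2_alg_hom[OF AB C]
  note jk = copair_alg_hom[OF B C T j k, folded BC_def]
  note eq = assoc_left_def[of F A B C, unfolded Let_def, folded AB_def BC_def]
  show "assoc_left F A B C \<in> alg_hom F (free_product F A BC) (free_product F AB C)"
    unfolding eq by (rule copair_alg_hom[OF A BC T i jk])
  have mem: "b \<in> carrier B \<Longrightarrow> incl1 F B C b \<in> carrier BC" "c \<in> carrier C \<Longrightarrow> incl2 F B C c \<in> carrier BC"
    using alg_homD(2)[OF incl1_alg_hom[OF B C]] alg_homD(2)[OF incl2_alg_hom[OF B C]]
    by (auto simp: BC_def)
  note incl = copair_incl(1)[OF A BC T i jk] copair_incl(2)[OF A BC T i jk]
    copair_incl(1)[OF B C T j k] copair_incl(2)[OF B C T j k]
  show "a \<in> carrier A \<Longrightarrow> assoc_left F A B C (incl1 F A BC a) = incl1 F AB C (incl1 F A B a)"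
    "b \<in> carrier B \<Longrightarrow> assoc_left F A B C (incl2 F A BC (incl1 F B C b)) = incl1 F AB C (incl2 F A B b)"
    "c \<in> carrier C \<Longrightarrow> assoc_left F A B C (incl2 F A BC (incl2 F B C c)) = incl2 F AB C c"
    unfolding eq by (simp_all add: incl mem compose_eq)
qed

context
  fixes F :: "('f, 'm) ring_scheme" and H :: "('f, 'h) module"
  assumes H: "unital_algebra F H"
begin

abbreviation (input) "HH \<equiv> free_product F H H"

lemma HH: "unital_algebra F HH"
  by (rule free_product_algebra[OF H H])

lemma incl_closed:
  "a \<in> carrier H \<Longrightarrow> incl1 F H H a \<in> carrier HH" "a \<in> carrier H \<Longrightarrow> incl2 F H H a \<in> carrier HH"
  using alg_homD(2)[OF incl1_alg_hom[OF H H]] alg_homD(2)[OF incl2_alg_hom[OF H H]] by auto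

text \<open>Re-association followed by folding the last two copies of \<open>H\<close>. The lemmas
  \<open>collapse_right_incl1\<close> and \<open>collapse_right_incl2\<close> identify this map as
  <id, i_2>.\<close>

definition collapse_right where
  "collapse_right = compose (carrier (free_product F HH H))
     (coprod_map F H HH H H (alg_id H) (folding F H)) (assoc_right F H H H)"

definition collapse_left where
  "collapse_left = compose (carrier (free_product F H HH))
     (coprod_map F HH H H H (folding F H) (alg_id H)) (assoc_left F H H H)"

lemma collapse_right_hom: "collapse_right \<in> alg_hom F (free_product F HH H) HH"
  unfolding collapse_right_def
  by (intro compose_alg_hom[where B = "free_product F H HH"] free_product_algebra HH H
      assoc_right_alg_hom coprod_map_alg_hom alg_id_hom folding_alg_hom)

lemma collapse_left_hom: "collapse_left \<in> alg_hom F (free_product F H HH) HH"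
  unfolding collapse_left_def
  by (intro compose_alg_hom[where B = "free_product F HH H"] free_product_algebra HH H
      assoc_left_alg_hom coprod_map_alg_hom alg_id_hom folding_alg_hom)

lemmas coprod_map_id_folding =
  coprod_map_alg_hom(2,3)[OF H HH H H alg_id_hom[OF H] folding_alg_hom(1)[OF H]]
lemmas coprod_map_folding_id =
  coprod_map_alg_hom(2,3)[OF HH H H H folding_alg_hom(1)[OF H] alg_id_hom[OF H]]

lemma collapse_right_incl2: "c \<in> carrier H \<Longrightarrow> collapse_right (incl2 F HH H c) = incl2 F H H c"
  using alg_homD(2)[OF incl2_alg_hom[OF HH H]]
  by (simp add: collapse_right_def compose_eq assoc_right_alg_hom[OF H H H] incl_closed
      coprod_map_id_folding folding_alg_hom[OF H])

lemma collapse_left_incl1: "c \<in> carrier H \<Longrightarrow> collapse_left (incl1 F H HH c) = incl1 F H H c"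
  using alg_homD(2)[OF incl1_alg_hom[OF H HH]]
  by (simp add: collapse_left_def compose_eq assoc_left_alg_hom[OF H H H] incl_closed
      coprod_map_folding_id folding_alg_hom[OF H])

text \<open>It suffices to compare on the two copies of \<open>H\<close> inside the first summand:
  the first copy is left alone, and the second is folded onto the second copy of the target.\<close>

lemma collapse_right_incl1:
  assumes t: "t \<in> carrier HH"
  shows "collapse_right (incl1 F HH H t) = t"
proof -
  have "compose (carrier HH) collapse_right (incl1 F HH H) = alg_id HH"
  proof (rule free_product_hom_eq[OF H H HH])
    show "compose (carrier HH) collapse_right (incl1 F HH H) \<in> alg_hom F HH HH"
      by (intro compose_alg_hom[OF HH incl1_alg_hom[OF HH H] collapse_right_hom])
    show "alg_id HH \<in> alg_hom F HH HH" by (rule alg_id_hom[OF HH])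
    fix a assume a: "a \<in> carrier H"
    then show "compose (carrier HH) collapse_right (incl1 F HH H) (incl1 F H H a) = alg_id HH (incl1 F H H a)"
      "compose (carrier HH) collapse_right (incl1 F HH H) (incl2 F H H a) = alg_id HH (incl2 F H H a)"
      using alg_homD(2)[OF incl1_alg_hom[OF HH H]]
      by (simp_all add: collapse_right_def compose_eq assoc_right_alg_hom[OF H H H] incl_closed
          coprod_map_id_folding folding_alg_hom[OF H])
        (simp_all add: alg_id_def incl_closed)
  qed
  from fun_cong[OF this, of t] show ?thesis
    using t by (simp add: compose_eq alg_id_def)
qed

lemma collapse_left_incl2:
  assumes t: "t \<in> carrier HH"
  shows "collapse_left (incl2 F H HH t) = t"
proof -
  have "compose (carrier HH) collapse_left (incl2 F H HH) = alg_id HH"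
  proof (rule free_product_hom_eq[OF H H HH])
    show "compose (carrier HH) collapse_left (incl2 F H HH) \<in> alg_hom F HH HH"
      by (intro compose_alg_hom[OF HH incl2_alg_hom[OF H HH] collapse_left_hom])
    show "alg_id HH \<in> alg_hom F HH HH" by (rule alg_id_hom[OF HH])
    fix a assume a: "a \<in> carrier H"
    then show "compose (carrier HH) collapse_left (incl2 F H HH) (incl1 F H H a) = alg_id HH (incl1 F H H a)"
      "compose (carrier HH) collapse_left (incl2 F H HH) (incl2 F H H a) = alg_id HH (incl2 F H H a)"
      using alg_homD(2)[OF incl2_alg_hom[OF H HH]]
      by (simp_all add: collapse_left_def compose_eq assoc_left_alg_hom[OF H H H] incl_closed
          coprod_map_folding_id folding_alg_hom[OF H])
        (simp_all add: alg_id_def incl_closed)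
  qed
  from fun_cong[OF this, of t] show ?thesis
    using t by (simp add: compose_eq alg_id_def)
qed

text \<open>\<open>K\<close> is the map <\<delta>, i_2>. The long composite of the right-hand coloop
  axioms thus becomes a single map out of the coproduct applied after \<open>D\<close>.\<close>

lemma compose_collapse_right:
  assumes "\<delta> \<in> alg_hom F H HH" "D \<in> alg_hom F H HH"
  obtains K where "K \<in> alg_hom F HH HH"
    and "compose (carrier H) K (incl1 F H H) = \<delta>"
    and "compose (carrier H) K (incl2 F H H) = incl2 F H H"
    and "compose (carrier H) (coprod_map F H HH H H (alg_id H) (folding F H))
      (compose (carrier H) (assoc_right F H H H)
        (compose (carrier H) (coprod_map F H H HH H \<delta> (alg_id H)) D)) = compose (carrier H) K D"
proof
  note cm = coprod_map_alg_hom[OF H H HH H assms(1) alg_id_hom[OF H]]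
  let ?K = "compose (carrier HH) collapse_right (coprod_map F H H HH H \<delta> (alg_id H))"
  show "?K \<in> alg_hom F HH HH"
    by (intro compose_alg_hom[OF HH cm(1) collapse_right_hom])
  show "compose (carrier H) ?K (incl1 F H H) = \<delta>"
    by (rule extensionalityI[OF compose_extensional alg_homD(7)[OF assms(1)]])
      (simp add: compose_eq incl_closed cm collapse_right_incl1 alg_homD(2)[OF assms(1)])
  show "compose (carrier H) ?K (incl2 F H H) = incl2 F H H"
    by (rule extensionalityI[OF compose_extensional alg_homD(7)[OF incl2_alg_hom[OF H H]]])
      (simp add: compose_eq incl_closed cm(3) collapse_right_incl2, simp add: alg_id_def collapse_right_incl2)
  show "compose (carrier H) (coprod_map F H HH H H (alg_id H) (folding F H))
      (compose (carrier H) (assoc_right F H H H)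
        (compose (carrier H) (coprod_map F H H HH H \<delta> (alg_id H)) D)) = compose (carrier H) ?K D"
    by (rule extensionalityI[OF compose_extensional compose_extensional])
      (simp add: compose_eq alg_homD(2)[OF assms(2)] collapse_right_def alg_homD(2)[OF cm(1)])
qed

lemma compose_collapse_left:
  assumes "\<delta> \<in> alg_hom F H HH" "D \<in> alg_hom F H HH"
  obtains K where "K \<in> alg_hom F HH HH"
    and "compose (carrier H) K (incl1 F H H) = incl1 F H H"
    and "compose (carrier H) K (incl2 F H H) = \<delta>"
    and "compose (carrier H) (coprod_map F HH H H H (folding F H) (alg_id H))
      (compose (carrier H) (assoc_left F H H H)
        (compose (carrier H) (coprod_map F H H H HH (alg_id H) \<delta>) D)) = compose (carrier H) K D"
proof
  note cm = coprod_map_alg_hom[OF H H H HH alg_id_hom[OF H] assms(1)]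
  let ?K = "compose (carrier HH) collapse_left (coprod_map F H H H HH (alg_id H) \<delta>)"
  show "?K \<in> alg_hom F HH HH"
    by (intro compose_alg_hom[OF HH cm(1) collapse_left_hom])
  show "compose (carrier H) ?K (incl2 F H H) = \<delta>"
    by (rule extensionalityI[OF compose_extensional alg_homD(7)[OF assms(1)]])
      (simp add: compose_eq incl_closed cm collapse_left_incl2 alg_homD(2)[OF assms(1)])
  show "compose (carrier H) ?K (incl1 F H H) = incl1 F H H"
    by (rule extensionalityI[OF compose_extensional alg_homD(7)[OF incl1_alg_hom[OF H H]]])
      (simp add: compose_eq incl_closed cm(2) collapse_left_incl1, simp add: alg_id_def collapse_left_incl1)
  show "compose (carrier H) (coprod_map F HH H H H (folding F H) (alg_id H))
      (compose (carrier H) (assoc_left F H H H)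
        (compose (carrier H) (coprod_map F H H H HH (alg_id H) \<delta>) D)) = compose (carrier H) ?K D"
    by (rule extensionalityI[OF compose_extensional compose_extensional])
      (simp add: compose_eq alg_homD(2)[OF assms(2)] collapse_left_def alg_homD(2)[OF cm(1)])
qed

text \<open>\<open>K\<close> is the map <\<alpha>, \<beta>>, so a convolution is a co-operation
  followed by a map out of the coproduct.\<close>

lemma compose_folding_coprod_map:
  assumes A: "unital_algebra F A" and \<alpha>: "\<alpha> \<in> alg_hom F H A" and \<beta>: "\<beta> \<in> alg_hom F H A"
    and D: "D \<in> alg_hom F H HH"
  obtains K where "K \<in> alg_hom F HH A"
    and "compose (carrier H) K (incl1 F H H) = \<alpha>" and "compose (carrier H) K (incl2 F H H) = \<beta>"
    and "convolution F H A D \<alpha> \<beta> = compose (carrier H) K D"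
proof
  note cm = coprod_map_alg_hom[OF H H A A \<alpha> \<beta>]
  let ?K = "compose (carrier HH) (folding F A) (coprod_map F H H A A \<alpha> \<beta>)"
  show "?K \<in> alg_hom F HH A"
    by (intro compose_alg_hom[OF HH cm(1)] folding_alg_hom A)
  show "compose (carrier H) ?K (incl1 F H H) = \<alpha>"
    by (rule extensionalityI[OF compose_extensional alg_homD(7)[OF \<alpha>]])
      (simp add: compose_eq incl_closed cm folding_alg_hom[OF A] alg_homD(2)[OF \<alpha>])
  show "compose (carrier H) ?K (incl2 F H H) = \<beta>"
    by (rule extensionalityI[OF compose_extensional alg_homD(7)[OF \<beta>]])
      (simp add: compose_eq incl_closed cm folding_alg_hom[OF A] alg_homD(2)[OF \<beta>])
  show "convolution F H A D \<alpha> \<beta> = compose (carrier H) ?K D"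
    unfolding convolution_def
    by (rule extensionalityI[OF compose_extensional compose_extensional])
      (simp add: compose_eq alg_homD(2)[OF D])
qed

end

section \<open>The co-operations on the universal series\<close>

abbreviation FdB_coproduct :: "('f, 'm) ring_scheme \<Rightarrow> ('f, 'f FdB2) module" where
  "FdB_coproduct F \<equiv> free_product F (FdB F) (FdB F)"

context
  fixes F :: "('f, 'm) ring_scheme"
  assumes F: "field F"
begin

interpretation free_algebra_on F "{1 :: nat..}"
  using F by (simp add: free_algebra_on_def)

lemma FdB_algebra: "unital_algebra F (FdB F)"
  unfolding FdB_def by (rule unital_algebra_free_algebra)

lemma FdB_gen_closed: "n \<ge> 1 \<Longrightarrow> gen F n \<in> carrier (FdB F)"
  unfolding FdB_def by (rule gen_closed) simp

lemma FdB_coproduct_algebra: "unital_algebra F (FdB_coproduct F)"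
  by (rule free_product_algebra[OF FdB_algebra FdB_algebra])

lemma FdB_free_ext:
  assumes "unital_algebra F A" "\<And>n. n \<ge> 1 \<Longrightarrow> v n \<in> carrier A"
  shows "free_ext F {1..} A v \<in> alg_hom F (FdB F) A" "n \<ge> 1 \<Longrightarrow> free_ext F {1..} A v (gen F n) = v n"
  unfolding FdB_def using free_ext_hom[OF assms(1)] free_ext_gen[OF assms(1)] assms(2)
  by (simp_all del: One_nat_def)

lemma hom_to_series_closed:
  assumes "unital_algebra F A" "\<alpha> \<in> alg_hom F (FdB F) A"
  shows "hom_to_series F A \<alpha> \<in> diff_carrier A"
proof -
  interpret A: ring A using assms unital_algebraD by blast
  show ?thesis
    using alg_homD(2)[OF assms(2)] FdB_gen_closed by (auto simp: diff_carrier_def hom_to_series_def)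
qed

lemma hom_to_series_inj:
  assumes "unital_algebra F A" "\<alpha> \<in> alg_hom F (FdB F) A" "\<beta> \<in> alg_hom F (FdB F) A"
    and "hom_to_series F A \<alpha> = hom_to_series F A \<beta>"
  shows "\<alpha> = \<beta>"
proof (rule free_algebra_hom_eqI[OF assms(1)])
  fix n :: nat assume "n \<in> {1..}"
  then show "\<alpha> (gen F n) = \<beta> (gen F n)"
    using fun_cong[OF assms(4), of n] by (simp add: hom_to_series_def split: if_splits)
qed (use assms in \<open>auto simp: FdB_def\<close>)

lemma series_to_hom_hom:
  assumes "unital_algebra F A" "a \<in> diff_carrier A"
  shows "series_to_hom F A a \<in> alg_hom F (FdB F) A" "n \<ge> 1 \<Longrightarrow> series_to_hom F A a (gen F n) = a n"
    "hom_to_series F A (series_to_hom F A a) = a"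
  using FdB_free_ext[OF assms(1), of a] assms(2)
  by (auto simp: series_to_hom_def hom_to_series_def diff_carrier_def)

lemma hom_to_series_compose:
  assumes "f \<in> alg_hom F A B"
  shows "hom_to_series F B (compose (carrier (FdB F)) f \<alpha>) = (\<lambda>n. f (hom_to_series F A \<alpha> n))"
  using FdB_gen_closed alg_homD(5)[OF assms] by (auto simp: hom_to_series_def compose_eq)

text \<open>The two universal series: any pair of series over an algebra is their image under the
  map out of the coproduct that the pair induces.\<close>

definition series1 where "series1 = hom_to_series F (FdB_coproduct F) (incl1 F (FdB F) (FdB F))"
definition series2 where "series2 = hom_to_series F (FdB_coproduct F) (incl2 F (FdB F) (FdB F))"

lemma series12_closed: "series1 \<in> diff_carrier (FdB_coproduct F)" "series2 \<in> diff_carrier (FdB_coproduct F)"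
  unfolding series1_def series2_def
  by (intro hom_to_series_closed FdB_coproduct_algebra incl1_alg_hom incl2_alg_hom FdB_algebra)+

lemma gen12_eq: "n \<ge> 1 \<Longrightarrow> gen1 F n = series1 n" "n \<ge> 1 \<Longrightarrow> gen2 F n = series2 n"
  by (simp_all add: gen1_def gen2_def series1_def series2_def hom_to_series_def)

interpretation T: ring "FdB_coproduct F" by (rule unital_algebraD(2)[OF FdB_coproduct_algebra])

lemmas series12_coeff_closed = series12_closed[THEN T.diff_carrierD(1)]

text \<open>The value prescribed on the n-th generator is the n-th coefficient of the composite of
  the universal series. In this way a co-operation is an element of \<open>Diff\<close> over the
  free product, as in the Yoneda lemma.\<close>

lemma FdB_comult_gen:
  "FdB_comult F \<in> alg_hom F (FdB F) (FdB_coproduct F)" "hom_to_series F (FdB_coproduct F) (FdB_comult F) = diff_mult (FdB_coproduct F) series1 series2"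
proof -
  note closed = T.diff_carrierD[OF T.diff_mult_closed[OF series12_closed]]
  define v where "v n = gen1 F n \<oplus>\<^bsub>(FdB_coproduct F)\<^esub> gen2 F n \<oplus>\<^bsub>(FdB_coproduct F)\<^esub>
    (\<Oplus>\<^bsub>(FdB_coproduct F)\<^esub>l\<in>{1..n - 1}. T.mult_formula (gen1 F) (gen2 F) n l)" for n
  have v: "v n = diff_mult (FdB_coproduct F) series1 series2 n" if "n \<ge> 1" for n
    using that T.mult_formula_cong[of "gen1 F" series1 "gen2 F" series2] gen12_eq series12_coeff_closed
    by (simp add: v_def T.diff_mult_eq_formula[OF series12_closed])
  have eq: "FdB_comult F = free_ext F {1..} (FdB_coproduct F) v"
    unfolding FdB_comult_def Let_def v_def[abs_def] T.mult_formula_def ..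
  show "FdB_comult F \<in> alg_hom F (FdB F) (FdB_coproduct F)"
    unfolding eq by (rule FdB_free_ext[OF FdB_coproduct_algebra]) (simp add: v closed)
  show "hom_to_series F (FdB_coproduct F) (FdB_comult F) = diff_mult (FdB_coproduct F) series1 series2"
  proof
    fix n show "hom_to_series F (FdB_coproduct F) (FdB_comult F) n = diff_mult (FdB_coproduct F) series1 series2 n"
      using FdB_free_ext(2)[OF FdB_coproduct_algebra, of v n] v closed
      by (cases "n = 0") (auto simp: hom_to_series_def eq)
  qed
qed

lemma FdB_rcodiv_gen:
  "FdB_rcodiv F \<in> alg_hom F (FdB F) (FdB_coproduct F)" "hom_to_series F (FdB_coproduct F) (FdB_rcodiv F) = rdiv (Diff (FdB_coproduct F)) series1 series2"
proof -
  note closed = T.diff_carrierD[OF T.rdiv_series_closed[OF series12_closed]]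
  define v where "v n = (\<Oplus>\<^bsub>(FdB_coproduct F)\<^esub>l\<in>{0..n - 1}. T.rdiv_formula (gen1 F) (gen2 F) n l)" for n
  have v: "v n = T.rdiv_series series1 series2 n" if "n \<ge> 1" for n
    using that T.rdiv_formula_cong[of "gen1 F" series1 "gen2 F" series2] gen12_eq series12_coeff_closed
    by (simp add: v_def T.rdiv_series_eq_formula)
  have eq: "FdB_rcodiv F = free_ext F {1..} (FdB_coproduct F) v"
    unfolding FdB_rcodiv_def Let_def v_def[abs_def] T.rdiv_formula_def ..
  show "FdB_rcodiv F \<in> alg_hom F (FdB F) (FdB_coproduct F)"
    unfolding eq by (rule FdB_free_ext[OF FdB_coproduct_algebra]) (simp add: v closed)
  show "hom_to_series F (FdB_coproduct F) (FdB_rcodiv F) = rdiv (Diff (FdB_coproduct F)) series1 series2"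
    unfolding T.rdiv_Diff_eq[OF series12_closed]
  proof
    fix n show "hom_to_series F (FdB_coproduct F) (FdB_rcodiv F) n = T.rdiv_series series1 series2 n"
      using FdB_free_ext(2)[OF FdB_coproduct_algebra, of v n] v closed
      by (cases "n = 0") (auto simp: hom_to_series_def eq)
  qed
qed

lemma FdB_lcodiv_gen:
  "FdB_lcodiv F \<in> alg_hom F (FdB F) (FdB_coproduct F)" "hom_to_series F (FdB_coproduct F) (FdB_lcodiv F) = ldiv (Diff (FdB_coproduct F)) series1 series2"
proof -
  note closed = T.diff_carrierD[OF T.ldiv_series_closed[OF series12_closed]]
  define v where "v n = (gen2 F n \<ominus>\<^bsub>(FdB_coproduct F)\<^esub> gen1 F n) \<oplus>\<^bsub>(FdB_coproduct F)\<^esub>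
    (\<Oplus>\<^bsub>(FdB_coproduct F)\<^esub>l\<in>{1..n - 1}. T.ldiv_formula (gen1 F) (gen2 F) n l)" for n
  have v: "v n = T.ldiv_series series1 series2 n" if "n \<ge> 1" for n
    using that T.ldiv_formula_cong[of "gen1 F" series1 "gen2 F" series2] gen12_eq series12_coeff_closed
    by (simp add: v_def T.ldiv_series_eq)
  have eq: "FdB_lcodiv F = free_ext F {1..} (FdB_coproduct F) v"
    unfolding FdB_lcodiv_def Let_def v_def[abs_def] T.ldiv_formula_def ..
  show "FdB_lcodiv F \<in> alg_hom F (FdB F) (FdB_coproduct F)"
    unfolding eq by (rule FdB_free_ext[OF FdB_coproduct_algebra]) (simp add: v closed)
  show "hom_to_series F (FdB_coproduct F) (FdB_lcodiv F) = ldiv (Diff (FdB_coproduct F)) series1 series2"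
    unfolding T.ldiv_Diff_eq[OF series12_closed]
  proof
    fix n show "hom_to_series F (FdB_coproduct F) (FdB_lcodiv F) n = T.ldiv_series series1 series2 n"
      using FdB_free_ext(2)[OF FdB_coproduct_algebra, of v n] v closed
      by (cases "n = 0") (auto simp: hom_to_series_def eq)
  qed
qed

lemma FdB_counit_gen:
  "FdB_counit F \<in> alg_hom F (FdB F) (base_algebra F)" "n \<ge> 1 \<Longrightarrow> FdB_counit F (gen F n) = \<zero>\<^bsub>F\<^esub>"
  using FdB_free_ext[OF base_algebra[OF F], of "\<lambda>n. \<zero>\<^bsub>F\<^esub>"]
  by (simp_all add: FdB_counit_def) (simp_all add: base_algebra_def)

section \<open>Co-operations followed by a map out of the coproduct\<close>

context
  fixes S :: "('f, 's) module" and K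
  assumes S: "unital_algebra F S" and K: "K \<in> alg_hom F (FdB_coproduct F) S"
begin

lemmas K_ring_hom = T.ring_axioms unital_algebraD(2)[OF S] alg_homD(1)[OF K]

text \<open>\<open>K\<close> acts on coefficients by a ring homomorphism, which commutes with
  composition of series. So after \<open>K\<close> the comultiplication composes the two series that
  \<open>K\<close> induces on the summands.\<close>

lemma hom_to_series_comult:
  "hom_to_series F S (compose (carrier (FdB F)) K (FdB_comult F))
    = diff_mult S (hom_to_series F S (compose (carrier (FdB F)) K (incl1 F (FdB F) (FdB F))))
        (hom_to_series F S (compose (carrier (FdB F)) K (incl2 F (FdB F) (FdB F))))"
  using ring_hom_diff_mult[OF K_ring_hom series12_closed]
  by (simp add: hom_to_series_compose[OF K] FdB_comult_gen series1_def[symmetric] series2_def[symmetric])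

lemma hom_to_series_rcodiv:
  "hom_to_series F S (compose (carrier (FdB F)) K (FdB_rcodiv F))
    = rdiv (Diff S) (hom_to_series F S (compose (carrier (FdB F)) K (incl1 F (FdB F) (FdB F))))
        (hom_to_series F S (compose (carrier (FdB F)) K (incl2 F (FdB F) (FdB F))))"
  using ring_hom_rdiv_Diff[OF K_ring_hom series12_closed]
  by (simp add: hom_to_series_compose[OF K] FdB_rcodiv_gen series1_def[symmetric] series2_def[symmetric])

lemma hom_to_series_lcodiv:
  "hom_to_series F S (compose (carrier (FdB F)) K (FdB_lcodiv F))
    = ldiv (Diff S) (hom_to_series F S (compose (carrier (FdB F)) K (incl1 F (FdB F) (FdB F))))
        (hom_to_series F S (compose (carrier (FdB F)) K (incl2 F (FdB F) (FdB F))))"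
  using ring_hom_ldiv_Diff[OF K_ring_hom series12_closed]
  by (simp add: hom_to_series_compose[OF K] FdB_lcodiv_gen series1_def[symmetric] series2_def[symmetric])

end

end

context
  fixes F :: "('f, 'm) ring_scheme"
  assumes F: "field F"
begin

lemmas FH = FdB_algebra[OF F]
lemmas FT = FdB_coproduct_algebra[OF F]
lemmas FI = base_algebra[OF F]

interpretation T: ring "FdB_coproduct F" by (rule unital_algebraD(2)[OF FT])
interpretation LT: loop "Diff (FdB_coproduct F)" by (rule T.loop_Diff)

lemma series12_carrier: "series1 F \<in> carrier (Diff (FdB_coproduct F))" "series2 F \<in> carrier (Diff (FdB_coproduct F))"
  using series12_closed[OF F] by (simp_all add: T.carrier_Diff)

lemma counit_series:
  assumes S: "unital_algebra F S" and k: "k \<in> alg_hom F (base_algebra F) S"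
  shows "hom_to_series F S (compose (carrier (FdB F)) k (FdB_counit F)) = \<one>\<^bsub>Diff S\<^esub>"
proof -
  have "k \<zero>\<^bsub>F\<^esub> = \<zero>\<^bsub>S\<^esub>"
    using alg_hom_zero[OF FI S k] by (simp add: base_algebra_def)
  then show ?thesis
    by (auto simp: hom_to_series_def compose_eq FdB_gen_closed[OF F] FdB_counit_gen[OF F] Diff_def)
qed

lemma coloop_FdB: "coloop F (FdB F) (FdB_comult F) (FdB_rcodiv F) (FdB_lcodiv F) (FdB_counit F)"
proof (rule coloop.intro)
  note \<Delta> = FdB_comult_gen(1)[OF F] and \<delta>r = FdB_rcodiv_gen(1)[OF F] and \<delta>l = FdB_lcodiv_gen(1)[OF F]
    and \<epsilon> = FdB_counit_gen(1)[OF F] and id = alg_id_hom[OF FH]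
  note i1 = incl1_alg_hom[OF FH FH] and i2 = incl2_alg_hom[OF FH FH]
  note comult = FdB_comult_gen(2)[OF F] and rcodiv = FdB_rcodiv_gen(2)[OF F]
    and lcodiv = FdB_lcodiv_gen(2)[OF F]
  note s = series12_carrier and s1 = series1_def[OF F, symmetric] and s2 = series2_def[OF F, symmetric]
  show "unital_algebra F (FdB F)" "FdB_comult F \<in> alg_hom F (FdB F) (FdB_coproduct F)" "FdB_rcodiv F \<in> alg_hom F (FdB F) (FdB_coproduct F)"
    "FdB_lcodiv F \<in> alg_hom F (FdB F) (FdB_coproduct F)" "FdB_counit F \<in> alg_hom F (FdB F) (base_algebra F)"
    by (rule FH \<Delta> \<delta>r \<delta>l \<epsilon>)+
  show "compose (carrier (FdB F)) (coprod_map F (FdB F) (FdB F) (base_algebra F) (FdB F) (FdB_counit F) (alg_id (FdB F))) (FdB_comult F)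
      = incl2 F (base_algebra F) (FdB F)" (is "compose _ ?K _ = _")
  proof (rule hom_to_series_inj[OF F])
    let ?S = "free_product F (base_algebra F) (FdB F)"
    show S: "unital_algebra F ?S" by (rule free_product_algebra[OF FI FH])
    interpret S: ring ?S by (rule unital_algebraD(2)[OF S])
    note cm = coprod_map_alg_hom[OF FH FH FI FH \<epsilon> id]
    note j = incl1_alg_hom[OF FI FH] incl2_alg_hom[OF FI FH]
    show "compose (carrier (FdB F)) ?K (FdB_comult F) \<in> alg_hom F (FdB F) ?S"
      by (rule compose_alg_hom[OF FH \<Delta> cm(1)])
    show "incl2 F (base_algebra F) (FdB F) \<in> alg_hom F (FdB F) ?S" by (rule j)
    \<comment> \<open>The counit sends all generators to 0, so the first universal series becomes
      the unit of \<open>Diff\<close> and the axiom becomes the left unit law.\<close>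
    have "compose (carrier (FdB F)) ?K (incl1 F (FdB F) (FdB F)) = compose (carrier (FdB F)) (incl1 F (base_algebra F) (FdB F)) (FdB_counit F)"
      by (rule extensionalityI[OF compose_extensional compose_extensional]) (simp add: compose_eq cm)
    moreover have "compose (carrier (FdB F)) ?K (incl2 F (FdB F) (FdB F)) = incl2 F (base_algebra F) (FdB F)"
      by (rule extensionalityI[OF compose_extensional alg_homD(7)[OF j(2)]])
        (simp add: compose_eq cm(3), simp add: alg_id_def)
    ultimately show "hom_to_series F ?S (compose (carrier (FdB F)) ?K (FdB_comult F))
        = hom_to_series F ?S (incl2 F (base_algebra F) (FdB F))"
      using hom_to_series_closed[OF F S j(2)]
      by (simp add: hom_to_series_comult[OF F S cm(1)] counit_series[OF S j(1)] S.diff_one_mult)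
  qed
  show "compose (carrier (FdB F)) (coprod_map F (FdB F) (FdB F) (FdB F) (base_algebra F) (alg_id (FdB F)) (FdB_counit F)) (FdB_comult F)
      = incl1 F (FdB F) (base_algebra F)" (is "compose _ ?K _ = _")
  proof (rule hom_to_series_inj[OF F])
    let ?S = "free_product F (FdB F) (base_algebra F)"
    show S: "unital_algebra F ?S" by (rule free_product_algebra[OF FH FI])
    interpret S: ring ?S by (rule unital_algebraD(2)[OF S])
    note cm = coprod_map_alg_hom[OF FH FH FH FI id \<epsilon>]
    note j = incl1_alg_hom[OF FH FI] incl2_alg_hom[OF FH FI]
    show "compose (carrier (FdB F)) ?K (FdB_comult F) \<in> alg_hom F (FdB F) ?S"
      by (rule compose_alg_hom[OF FH \<Delta> cm(1)])
    show "incl1 F (FdB F) (base_algebra F) \<in> alg_hom F (FdB F) ?S" by (rule j)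
    have "compose (carrier (FdB F)) ?K (incl2 F (FdB F) (FdB F)) = compose (carrier (FdB F)) (incl2 F (FdB F) (base_algebra F)) (FdB_counit F)"
      by (rule extensionalityI[OF compose_extensional compose_extensional]) (simp add: compose_eq cm)
    moreover have "compose (carrier (FdB F)) ?K (incl1 F (FdB F) (FdB F)) = incl1 F (FdB F) (base_algebra F)"
      by (rule extensionalityI[OF compose_extensional alg_homD(7)[OF j(1)]])
        (simp add: compose_eq cm(2), simp add: alg_id_def)
    ultimately show "hom_to_series F ?S (compose (carrier (FdB F)) ?K (FdB_comult F))
        = hom_to_series F ?S (incl1 F (FdB F) (base_algebra F))"
      using hom_to_series_closed[OF F S j(1)]
      by (simp add: hom_to_series_comult[OF F S cm(1)] counit_series[OF S j(2)] S.diff_mult_one)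
  qed
  show "compose (carrier (FdB F)) (coprod_map F (FdB F) (FdB_coproduct F) (FdB F) (FdB F) (alg_id (FdB F)) (folding F (FdB F)))
         (compose (carrier (FdB F)) (assoc_right F (FdB F) (FdB F) (FdB F))
           (compose (carrier (FdB F)) (coprod_map F (FdB F) (FdB F) (FdB_coproduct F) (FdB F) (FdB_rcodiv F) (alg_id (FdB F))) (FdB_comult F)))
        = incl1 F (FdB F) (FdB F)"
  proof -
    obtain K where K: "K \<in> alg_hom F (FdB_coproduct F) (FdB_coproduct F)" "compose (carrier (FdB F)) K (incl1 F (FdB F) (FdB F)) = FdB_rcodiv F"
      "compose (carrier (FdB F)) K (incl2 F (FdB F) (FdB F)) = incl2 F (FdB F) (FdB F)" and eq: "compose (carrier (FdB F)) (coprod_map F (FdB F) (FdB_coproduct F) (FdB F) (FdB F) (alg_id (FdB F)) (folding F (FdB F)))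
         (compose (carrier (FdB F)) (assoc_right F (FdB F) (FdB F) (FdB F))
           (compose (carrier (FdB F)) (coprod_map F (FdB F) (FdB F) (FdB_coproduct F) (FdB F) (FdB_rcodiv F) (alg_id (FdB F))) (FdB_comult F)))
        = compose (carrier (FdB F)) K (FdB_comult F)"
      using compose_collapse_right[OF FH \<delta>r \<Delta>] .
    \<comment> \<open>With x, y the universal series, \<open>K\<close> carries the pair (x, y) to (x
      / y, y), so the axiom is the loop law (x / y) y = x.\<close>
    show ?thesis unfolding eq
      by (rule hom_to_series_inj[OF F FT compose_alg_hom[OF FH \<Delta> K(1)] i1])
        (simp add: hom_to_series_comult[OF F FT K(1)] K rcodiv s1 s2 LT.rdiv_mult[OF s] flip: T.mult_Diff)
  qed
  show "compose (carrier (FdB F)) (coprod_map F (FdB F) (FdB_coproduct F) (FdB F) (FdB F) (alg_id (FdB F)) (folding F (FdB F)))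
         (compose (carrier (FdB F)) (assoc_right F (FdB F) (FdB F) (FdB F))
           (compose (carrier (FdB F)) (coprod_map F (FdB F) (FdB F) (FdB_coproduct F) (FdB F) (FdB_comult F) (alg_id (FdB F))) (FdB_rcodiv F)))
        = incl1 F (FdB F) (FdB F)"
  proof -
    obtain K where K: "K \<in> alg_hom F (FdB_coproduct F) (FdB_coproduct F)" "compose (carrier (FdB F)) K (incl1 F (FdB F) (FdB F)) = FdB_comult F"
      "compose (carrier (FdB F)) K (incl2 F (FdB F) (FdB F)) = incl2 F (FdB F) (FdB F)" and eq: "compose (carrier (FdB F)) (coprod_map F (FdB F) (FdB_coproduct F) (FdB F) (FdB F) (alg_id (FdB F)) (folding F (FdB F)))
         (compose (carrier (FdB F)) (assoc_right F (FdB F) (FdB F) (FdB F))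
           (compose (carrier (FdB F)) (coprod_map F (FdB F) (FdB F) (FdB_coproduct F) (FdB F) (FdB_comult F) (alg_id (FdB F))) (FdB_rcodiv F)))
        = compose (carrier (FdB F)) K (FdB_rcodiv F)"
      using compose_collapse_right[OF FH \<Delta> \<delta>r] .
    \<comment> \<open>Now \<open>K\<close> carries (x, y) to (x y, y), and the axiom is (x y) / y =
      x.\<close>
    show ?thesis unfolding eq
      by (rule hom_to_series_inj[OF F FT compose_alg_hom[OF FH \<delta>r K(1)] i1])
        (simp add: hom_to_series_rcodiv[OF F FT K(1)] K comult s1 s2 LT.mult_rdiv[OF s] flip: T.mult_Diff)
  qed
  show "compose (carrier (FdB F)) (coprod_map F (FdB_coproduct F) (FdB F) (FdB F) (FdB F) (folding F (FdB F)) (alg_id (FdB F)))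
         (compose (carrier (FdB F)) (assoc_left F (FdB F) (FdB F) (FdB F))
           (compose (carrier (FdB F)) (coprod_map F (FdB F) (FdB F) (FdB F) (FdB_coproduct F) (alg_id (FdB F)) (FdB_lcodiv F)) (FdB_comult F)))
        = incl2 F (FdB F) (FdB F)"
  proof -
    obtain K where K: "K \<in> alg_hom F (FdB_coproduct F) (FdB_coproduct F)" "compose (carrier (FdB F)) K (incl1 F (FdB F) (FdB F)) = incl1 F (FdB F) (FdB F)"
      "compose (carrier (FdB F)) K (incl2 F (FdB F) (FdB F)) = FdB_lcodiv F" and eq: "compose (carrier (FdB F)) (coprod_map F (FdB_coproduct F) (FdB F) (FdB F) (FdB F) (folding F (FdB F)) (alg_id (FdB F)))
         (compose (carrier (FdB F)) (assoc_left F (FdB F) (FdB F) (FdB F))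
           (compose (carrier (FdB F)) (coprod_map F (FdB F) (FdB F) (FdB F) (FdB_coproduct F) (alg_id (FdB F)) (FdB_lcodiv F)) (FdB_comult F)))
        = compose (carrier (FdB F)) K (FdB_comult F)"
      using compose_collapse_left[OF FH \<delta>l \<Delta>] .
    \<comment> \<open>Here the second series is replaced by the left quotient of y by x, and
      multiplying it by x from the left gives back y.\<close>
    show ?thesis unfolding eq
      by (rule hom_to_series_inj[OF F FT compose_alg_hom[OF FH \<Delta> K(1)] i2])
        (simp add: hom_to_series_comult[OF F FT K(1)] K lcodiv s1 s2 LT.mult_ldiv[OF s] flip: T.mult_Diff)
  qed
  show "compose (carrier (FdB F)) (coprod_map F (FdB_coproduct F) (FdB F) (FdB F) (FdB F) (folding F (FdB F)) (alg_id (FdB F)))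
         (compose (carrier (FdB F)) (assoc_left F (FdB F) (FdB F) (FdB F))
           (compose (carrier (FdB F)) (coprod_map F (FdB F) (FdB F) (FdB F) (FdB_coproduct F) (alg_id (FdB F)) (FdB_comult F)) (FdB_lcodiv F)))
        = incl2 F (FdB F) (FdB F)"
  proof -
    obtain K where K: "K \<in> alg_hom F (FdB_coproduct F) (FdB_coproduct F)" "compose (carrier (FdB F)) K (incl1 F (FdB F) (FdB F)) = incl1 F (FdB F) (FdB F)"
      "compose (carrier (FdB F)) K (incl2 F (FdB F) (FdB F)) = FdB_comult F" and eq: "compose (carrier (FdB F)) (coprod_map F (FdB_coproduct F) (FdB F) (FdB F) (FdB F) (folding F (FdB F)) (alg_id (FdB F)))
         (compose (carrier (FdB F)) (assoc_left F (FdB F) (FdB F) (FdB F))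
           (compose (carrier (FdB F)) (coprod_map F (FdB F) (FdB F) (FdB F) (FdB_coproduct F) (alg_id (FdB F)) (FdB_comult F)) (FdB_lcodiv F)))
        = compose (carrier (FdB F)) K (FdB_lcodiv F)"
      using compose_collapse_left[OF FH \<Delta> \<delta>l] .
    \<comment> \<open>Here the second series is replaced by x y, and dividing by x from the left
      gives back y.\<close>
    show ?thesis unfolding eq
      by (rule hom_to_series_inj[OF F FT compose_alg_hom[OF FH \<delta>l K(1)] i2])
        (simp add: hom_to_series_lcodiv[OF F FT K(1)] K comult s1 s2 LT.ldiv_mult[OF s] flip: T.mult_Diff)
  qed
qed

section \<open>The represented functor\<close>

context
  fixes A :: "('f, 'a) module"
  assumes A: "unital_algebra F A"
begin

interpretation A: ring A by (rule unital_algebraD(2)[OF A])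
interpretation LA: loop "Diff A" by (rule A.loop_Diff)

lemma convolution_comult:
  assumes "\<alpha> \<in> alg_hom F (FdB F) A" "\<beta> \<in> alg_hom F (FdB F) A"
  shows "convolution F (FdB F) A (FdB_comult F) \<alpha> \<beta> \<in> alg_hom F (FdB F) A"
    and "hom_to_series F A (convolution F (FdB F) A (FdB_comult F) \<alpha> \<beta>)
      = hom_to_series F A \<alpha> \<otimes>\<^bsub>Diff A\<^esub> hom_to_series F A \<beta>"
proof -
  note \<Delta> = FdB_comult_gen(1)[OF F]
  obtain K where K: "K \<in> alg_hom F (FdB_coproduct F) A" "compose (carrier (FdB F)) K (incl1 F (FdB F) (FdB F)) = \<alpha>"
      "compose (carrier (FdB F)) K (incl2 F (FdB F) (FdB F)) = \<beta>"
      "convolution F (FdB F) A (FdB_comult F) \<alpha> \<beta> = compose (carrier (FdB F)) K (FdB_comult F)"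
    using compose_folding_coprod_map[OF FH A assms \<Delta>] .
  show "convolution F (FdB F) A (FdB_comult F) \<alpha> \<beta> \<in> alg_hom F (FdB F) A"
    unfolding K by (rule compose_alg_hom[OF FH \<Delta> K(1)])
  show "hom_to_series F A (convolution F (FdB F) A (FdB_comult F) \<alpha> \<beta>)
      = hom_to_series F A \<alpha> \<otimes>\<^bsub>Diff A\<^esub> hom_to_series F A \<beta>"
    unfolding K(4) by (simp add: hom_to_series_comult[OF F A K(1)] K A.mult_Diff)
qed

lemma convolution_rcodiv:
  assumes "\<alpha> \<in> alg_hom F (FdB F) A" "\<beta> \<in> alg_hom F (FdB F) A"
  shows "convolution F (FdB F) A (FdB_rcodiv F) \<alpha> \<beta> \<in> alg_hom F (FdB F) A"
    and "hom_to_series F A (convolution F (FdB F) A (FdB_rcodiv F) \<alpha> \<beta>)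
      = rdiv (Diff A) (hom_to_series F A \<alpha>) (hom_to_series F A \<beta>)"
proof -
  note \<delta> = FdB_rcodiv_gen(1)[OF F]
  obtain K where K: "K \<in> alg_hom F (FdB_coproduct F) A" "compose (carrier (FdB F)) K (incl1 F (FdB F) (FdB F)) = \<alpha>"
      "compose (carrier (FdB F)) K (incl2 F (FdB F) (FdB F)) = \<beta>"
      "convolution F (FdB F) A (FdB_rcodiv F) \<alpha> \<beta> = compose (carrier (FdB F)) K (FdB_rcodiv F)"
    using compose_folding_coprod_map[OF FH A assms \<delta>] .
  show "convolution F (FdB F) A (FdB_rcodiv F) \<alpha> \<beta> \<in> alg_hom F (FdB F) A"
    unfolding K by (rule compose_alg_hom[OF FH \<delta> K(1)])
  show "hom_to_series F A (convolution F (FdB F) A (FdB_rcodiv F) \<alpha> \<beta>)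
      = rdiv (Diff A) (hom_to_series F A \<alpha>) (hom_to_series F A \<beta>)"
    unfolding K(4) by (simp add: hom_to_series_rcodiv[OF F A K(1)] K)
qed

lemma convolution_lcodiv:
  assumes "\<alpha> \<in> alg_hom F (FdB F) A" "\<beta> \<in> alg_hom F (FdB F) A"
  shows "convolution F (FdB F) A (FdB_lcodiv F) \<alpha> \<beta> \<in> alg_hom F (FdB F) A"
    and "hom_to_series F A (convolution F (FdB F) A (FdB_lcodiv F) \<alpha> \<beta>)
      = ldiv (Diff A) (hom_to_series F A \<alpha>) (hom_to_series F A \<beta>)"
proof -
  note \<delta> = FdB_lcodiv_gen(1)[OF F]
  obtain K where K: "K \<in> alg_hom F (FdB_coproduct F) A" "compose (carrier (FdB F)) K (incl1 F (FdB F) (FdB F)) = \<alpha>"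
      "compose (carrier (FdB F)) K (incl2 F (FdB F) (FdB F)) = \<beta>"
      "convolution F (FdB F) A (FdB_lcodiv F) \<alpha> \<beta> = compose (carrier (FdB F)) K (FdB_lcodiv F)"
    using compose_folding_coprod_map[OF FH A assms \<delta>] .
  show "convolution F (FdB F) A (FdB_lcodiv F) \<alpha> \<beta> \<in> alg_hom F (FdB F) A"
    unfolding K by (rule compose_alg_hom[OF FH \<delta> K(1)])
  show "hom_to_series F A (convolution F (FdB F) A (FdB_lcodiv F) \<alpha> \<beta>)
      = ldiv (Diff A) (hom_to_series F A \<alpha>) (hom_to_series F A \<beta>)"
    unfolding K(4) by (simp add: hom_to_series_lcodiv[OF F A K(1)] K)
qed

lemma hom_loop_simps:
  "carrier (FdB_hom_loop F A) = alg_hom F (FdB F) A"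
  "\<alpha> \<otimes>\<^bsub>FdB_hom_loop F A\<^esub> \<beta> = convolution F (FdB F) A (FdB_comult F) \<alpha> \<beta>"
  "\<one>\<^bsub>FdB_hom_loop F A\<^esub> = compose (carrier (FdB F)) (alg_unit F A) (FdB_counit F)"
  "ldiv (FdB_hom_loop F A) = convolution F (FdB F) A (FdB_lcodiv F)"
  "rdiv (FdB_hom_loop F A) = convolution F (FdB F) A (FdB_rcodiv F)"
  by (simp_all add: FdB_hom_loop_def hom_loop_def)

lemma one_hom_loop:
  "\<one>\<^bsub>FdB_hom_loop F A\<^esub> \<in> alg_hom F (FdB F) A" "hom_to_series F A \<one>\<^bsub>FdB_hom_loop F A\<^esub> = \<one>\<^bsub>Diff A\<^esub>"
  unfolding hom_loop_simps
  by (rule compose_alg_hom[OF FH FdB_counit_gen(1)[OF F] alg_unit_hom[OF A]],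
      rule counit_series[OF A alg_unit_hom[OF A]])

lemma hom_to_series_carrier: "\<alpha> \<in> alg_hom F (FdB F) A \<Longrightarrow> hom_to_series F A \<alpha> \<in> carrier (Diff A)"
  using hom_to_series_closed[OF F A] by (simp add: A.carrier_Diff)

text \<open>The laws are pulled back along the injective map \<open>hom_to_series\<close>, which
  carries the convolutions to the operations of \<open>Diff A\<close>.\<close>

lemma loop_hom_loop: "loop (FdB_hom_loop F A)"
  by (unfold_locales; unfold hom_loop_simps(1,2,4,5);
      (intro convolution_comult(1) convolution_rcodiv(1) convolution_lcodiv(1) one_hom_loop(1); assumption)?;
      (rule hom_to_series_inj[OF F A])?)
    (simp_all add: convolution_comult convolution_rcodiv convolution_lcodiv one_hom_loop
      hom_to_series_carrier LA.l_one LA.r_one LA.mult_ldiv LA.ldiv_mult LA.rdiv_mult LA.mult_rdiv)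

lemma hom_to_series_loop_iso: "hom_to_series F A \<in> loop_iso (FdB_hom_loop F A) (Diff A)"
proof -
  have "bij_betw (hom_to_series F A) (alg_hom F (FdB F) A) (carrier (Diff A))"
  proof (rule bij_betwI[where g = "series_to_hom F A"])
    show "series_to_hom F A \<in> carrier (Diff A) \<rightarrow> alg_hom F (FdB F) A"
      using series_to_hom_hom(1)[OF F A] by (auto simp: A.carrier_Diff)
    show "series_to_hom F A (hom_to_series F A \<alpha>) = \<alpha>" if "\<alpha> \<in> alg_hom F (FdB F) A" for \<alpha>
      using that hom_to_series_closed[OF F A that]
      by (intro hom_to_series_inj[OF F A]) (simp_all add: series_to_hom_hom[OF F A])
    show "hom_to_series F A (series_to_hom F A a) = a" if "a \<in> carrier (Diff A)" for a
      using that by (intro series_to_hom_hom(3)[OF F A]) (simp add: A.carrier_Diff)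
  qed (simp add: hom_to_series_carrier)
  then show ?thesis
    by (auto simp: loop_iso_def hom_def hom_loop_simps(1,2,4,5) hom_to_series_carrier one_hom_loop(2)
        convolution_comult convolution_rcodiv convolution_lcodiv)
qed

lemma division_formulas:
  assumes "a \<in> carrier (Diff A)" "b \<in> carrier (Diff A)" and n: "n \<ge> 1"
  shows "rdiv (Diff A) a b n
      = convolution F (FdB F) A (FdB_rcodiv F) (series_to_hom F A a) (series_to_hom F A b) (gen F n)"
    and "rdiv (Diff A) a b n = (a n \<ominus>\<^bsub>A\<^esub> b n) \<oplus>\<^bsub>A\<^esub>
            (\<Oplus>\<^bsub>A\<^esub>l\<in>{1..n - 1}. \<Oplus>\<^bsub>A\<^esub>ns\<in>compositions n (l + 1).
               [((-1) ^ l * int (dcoeff (take l ns)))] \<cdot>\<^bsub>A\<^esub>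
                 ((a (ns ! 0) \<ominus>\<^bsub>A\<^esub> b (ns ! 0)) \<otimes>\<^bsub>A\<^esub> lprod A (map b (tl ns))))"
    and "ldiv (Diff A) a b n
      = convolution F (FdB F) A (FdB_lcodiv F) (series_to_hom F A a) (series_to_hom F A b) (gen F n)"
    and "ldiv (Diff A) a b n = (b n \<ominus>\<^bsub>A\<^esub> a n) \<oplus>\<^bsub>A\<^esub>
            (\<Oplus>\<^bsub>A\<^esub>l\<in>{1..n - 1}. \<Oplus>\<^bsub>A\<^esub>ns\<in>compositions n (l + 1). \<Oplus>\<^bsub>A\<^esub>es\<in>Eseq l.
               [((-1) ^ l * esign es * int (dcoeff_e es (take l ns)))] \<cdot>\<^bsub>A\<^esub>
                 (a (ns ! 0) \<otimes>\<^bsub>A\<^esub>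
                  lprod A (map (\<lambda>i. pick a b (es ! i) (ns ! i)) [1..<l]) \<otimes>\<^bsub>A\<^esub>
                  (b (ns ! l) \<ominus>\<^bsub>A\<^esub> a (ns ! l))))"
proof -
  have ab: "a \<in> diff_carrier A" "b \<in> diff_carrier A"
    using assms by (simp_all add: A.carrier_Diff)
  note closed = ab[THEN A.diff_carrierD(1)]
  note hom = series_to_hom_hom(1)[OF F A ab(1)] series_to_hom_hom(1)[OF F A ab(2)]
  note series = series_to_hom_hom(3)[OF F A ab(1)] series_to_hom_hom(3)[OF F A ab(2)]
  show "rdiv (Diff A) a b n
      = convolution F (FdB F) A (FdB_rcodiv F) (series_to_hom F A a) (series_to_hom F A b) (gen F n)"
    using fun_cong[OF convolution_rcodiv(2)[OF hom, unfolded series], of n] n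
    by (simp add: hom_to_series_def)
  show "ldiv (Diff A) a b n
      = convolution F (FdB F) A (FdB_lcodiv F) (series_to_hom F A a) (series_to_hom F A b) (gen F n)"
    using fun_cong[OF convolution_lcodiv(2)[OF hom, unfolded series], of n] n
    by (simp add: hom_to_series_def)
  show "rdiv (Diff A) a b n = (a n \<ominus>\<^bsub>A\<^esub> b n) \<oplus>\<^bsub>A\<^esub>
            (\<Oplus>\<^bsub>A\<^esub>l\<in>{1..n - 1}. \<Oplus>\<^bsub>A\<^esub>ns\<in>compositions n (l + 1).
               [((-1) ^ l * int (dcoeff (take l ns)))] \<cdot>\<^bsub>A\<^esub>
                 ((a (ns ! 0) \<ominus>\<^bsub>A\<^esub> b (ns ! 0)) \<otimes>\<^bsub>A\<^esub> lprod A (map b (tl ns))))"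
    unfolding A.rdiv_Diff_eq[OF ab] A.rdiv_formula_def[symmetric]
    by (rule A.rdiv_series_eq[OF closed n])
  have "ldiv (Diff A) a b n = (b n \<ominus>\<^bsub>A\<^esub> a n) \<oplus>\<^bsub>A\<^esub> (\<Oplus>\<^bsub>A\<^esub>l\<in>{1..n - 1}. A.ldiv_formula a b n l)"
    unfolding A.ldiv_Diff_eq[OF ab] by (rule A.ldiv_series_eq[OF closed n])
  also have "(\<Oplus>\<^bsub>A\<^esub>l\<in>{1..n - 1}. A.ldiv_formula a b n l)
      = (\<Oplus>\<^bsub>A\<^esub>l\<in>{1..n - 1}. \<Oplus>\<^bsub>A\<^esub>ns\<in>compositions n (l + 1). \<Oplus>\<^bsub>A\<^esub>es\<in>Eseq l.
               [((-1) ^ l * esign es * int (dcoeff_e es (take l ns)))] \<cdot>\<^bsub>A\<^esub>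
                 (a (ns ! 0) \<otimes>\<^bsub>A\<^esub>
                  lprod A (map (\<lambda>i. pick a b (es ! i) (ns ! i)) [1..<l]) \<otimes>\<^bsub>A\<^esub>
                  (b (ns ! l) \<ominus>\<^bsub>A\<^esub> a (ns ! l))))"
    (is "_ = finsum A ?g _")
  proof (rule A.add.finprod_cong'[OF refl])
    fix l assume "l \<in> {1..n - 1}"
    then show "A.ldiv_formula a b n l = ?g l" by (intro A.ldiv_formula_eq closed) simp
  next
    show "?g \<in> {1..n - 1} \<rightarrow> carrier A"
    proof
      fix l assume "l \<in> {1..n - 1}"
      then have "A.ldiv_formula a b n l = ?g l" by (intro A.ldiv_formula_eq closed) simp
      then show "?g l \<in> carrier A" using A.ldiv_formula_closed[of a b n l] closed by simp
    qed
  qed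
  finally show "ldiv (Diff A) a b n = (b n \<ominus>\<^bsub>A\<^esub> a n) \<oplus>\<^bsub>A\<^esub>
            (\<Oplus>\<^bsub>A\<^esub>l\<in>{1..n - 1}. \<Oplus>\<^bsub>A\<^esub>ns\<in>compositions n (l + 1). \<Oplus>\<^bsub>A\<^esub>es\<in>Eseq l.
               [((-1) ^ l * esign es * int (dcoeff_e es (take l ns)))] \<cdot>\<^bsub>A\<^esub>
                 (a (ns ! 0) \<otimes>\<^bsub>A\<^esub>
                  lprod A (map (\<lambda>i. pick a b (es ! i) (ns ! i)) [1..<l]) \<otimes>\<^bsub>A\<^esub>
                  (b (ns ! l) \<ominus>\<^bsub>A\<^esub> a (ns ! l))))" .
qed

end

end

section \<open>Functoriality of \<open>Diff\<close> and naturality of the representation\<close>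

lemma Diff_map_hom:
  assumes A: "unital_algebra F A" and B: "unital_algebra F B" and f: "f \<in> alg_hom F A B"
  shows "Diff_map A f \<in> hom (Diff A) (Diff B)"
proof -
  interpret A: ring A by (rule unital_algebraD(2)[OF A])
  interpret B: ring B by (rule unital_algebraD(2)[OF B])
  note f' = A.ring_axioms B.ring_axioms alg_homD(1)[OF f]
  show ?thesis
    by (auto simp: hom_def Diff_map_def A.carrier_Diff B.carrier_Diff A.mult_Diff B.mult_Diff
        A.diff_mult_closed ring_hom_diff_carrier[OF f'] ring_hom_diff_mult[OF f'])
qed

lemma Diff_map_id: "Diff_map A (alg_id A) = (\<lambda>a\<in>carrier (Diff A). a)"
  by (auto simp: Diff_map_def alg_id_def Diff_def diff_carrier_def restrict_def fun_eq_iff)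

lemma Diff_map_compose:
  assumes "f \<in> alg_hom F A B"
  shows "Diff_map A (compose (carrier A) g f) = compose (carrier (Diff A)) (Diff_map B g) (Diff_map A f)"
proof
  fix a
  show "Diff_map A (compose (carrier A) g f) a = compose (carrier (Diff A)) (Diff_map B g) (Diff_map A f) a"
  proof (cases "a \<in> diff_carrier A")
    case True
    then have "(\<lambda>n. f (a n)) \<in> diff_carrier B" "a \<in> carrier (Diff A)"
      using alg_homD(2,5)[OF assms] by (auto simp: diff_carrier_def Diff_def)
    with True show ?thesis
      by (auto simp: Diff_map_def compose_eq) (auto simp: diff_carrier_def compose_eq)
  \<comment> \<open>Off the carrier both sides are \<open>undefined\<close>, by
    extensionality.\<close>
  qed (simp add: Diff_map_def compose_def Diff_def)
qed

lemma hom_to_series_natural: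
  assumes F: "field F" and A: "unital_algebra F A" and f: "f \<in> alg_hom F A B"
    and \<alpha>: "\<alpha> \<in> alg_hom F (FdB F) A"
  shows "hom_to_series F B (compose (carrier (FdB F)) f \<alpha>) = Diff_map A f (hom_to_series F A \<alpha>)"
  using hom_to_series_closed[OF F A \<alpha>] by (simp add: hom_to_series_compose[OF F f] Diff_map_def)

text \<open>The algebras \<open>A\<close>, \<open>B\<close>, \<open>C\<close> have independent
  carrier types, as HOL formulas cannot quantify over types; being arbitrary, they express that
  \<open>Diff\<close> is a functor on algebras and that \<open>hom_to_series\<close> is a natural
  isomorphism onto it.\<close>

theorem theorem5p4p10:
  fixes F :: "('f, 'm) ring_scheme"
    and A :: "('f, 'a) module" and B :: "('f, 'b) module" and C :: "('f, 'c) module"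
  assumes "field F"
    and "unital_algebra F A" and "unital_algebra F B" and "unital_algebra F C"
  shows
    "coloop F (FdB F) (FdB_comult F) (FdB_rcodiv F) (FdB_lcodiv F) (FdB_counit F) \<and>
     loop (Diff A) \<and>
     (\<forall>f\<in>alg_hom F A B. Diff_map A f \<in> hom (Diff A) (Diff B)) \<and>
     Diff_map A (alg_id A) = (\<lambda>a\<in>carrier (Diff A). a) \<and>
     (\<forall>f\<in>alg_hom F A B. \<forall>g\<in>alg_hom F B C.
        Diff_map A (compose (carrier A) g f)
          = compose (carrier (Diff A)) (Diff_map B g) (Diff_map A f)) \<and>
     loop (FdB_hom_loop F A) \<and>
     hom_to_series F A \<in> loop_iso (FdB_hom_loop F A) (Diff A) \<and>
     (\<forall>f\<in>alg_hom F A B. \<forall>\<alpha>\<in>alg_hom F (FdB F) A.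
        hom_to_series F B (compose (carrier (FdB F)) f \<alpha>)
          = Diff_map A f (hom_to_series F A \<alpha>)) \<and>
     (\<forall>a\<in>carrier (Diff A).
        series_to_hom F A a \<in> alg_hom F (FdB F) A \<and>
        (\<forall>n\<ge>1. series_to_hom F A a (gen F n) = a n) \<and>
        hom_to_series F A (series_to_hom F A a) = a) \<and>
     (\<forall>a\<in>carrier (Diff A). \<forall>b\<in>carrier (Diff A). \<forall>n\<ge>1.
        rdiv (Diff A) a b n
          = convolution F (FdB F) A (FdB_rcodiv F) (series_to_hom F A a) (series_to_hom F A b)
              (gen F n) \<and>
        rdiv (Diff A) a b n
          = (a n \<ominus>\<^bsub>A\<^esub> b n) \<oplus>\<^bsub>A\<^esub>
            (\<Oplus>\<^bsub>A\<^esub>l\<in>{1..n - 1}. \<Oplus>\<^bsub>A\<^esub>ns\<in>compositions n (l + 1).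
               [((-1) ^ l * int (dcoeff (take l ns)))] \<cdot>\<^bsub>A\<^esub>
                 ((a (ns ! 0) \<ominus>\<^bsub>A\<^esub> b (ns ! 0)) \<otimes>\<^bsub>A\<^esub> lprod A (map b (tl ns)))) \<and>
        ldiv (Diff A) a b n
          = convolution F (FdB F) A (FdB_lcodiv F) (series_to_hom F A a) (series_to_hom F A b)
              (gen F n) \<and>
        ldiv (Diff A) a b n
          = (b n \<ominus>\<^bsub>A\<^esub> a n) \<oplus>\<^bsub>A\<^esub>
            (\<Oplus>\<^bsub>A\<^esub>l\<in>{1..n - 1}. \<Oplus>\<^bsub>A\<^esub>ns\<in>compositions n (l + 1). \<Oplus>\<^bsub>A\<^esub>es\<in>Eseq l.
               [((-1) ^ l * esign es * int (dcoeff_e es (take l ns)))] \<cdot>\<^bsub>A\<^esub>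
                 (a (ns ! 0) \<otimes>\<^bsub>A\<^esub>
                  lprod A (map (\<lambda>i. pick a b (es ! i) (ns ! i)) [1..<l]) \<otimes>\<^bsub>A\<^esub>
                  (b (ns ! l) \<ominus>\<^bsub>A\<^esub> a (ns ! l)))))"
proof -
  note F = assms(1) and A = assms(2) and B = assms(3)
  have carrier: "carrier (Diff A) = diff_carrier A" by (simp add: Diff_def)
  have "loop (Diff A)"
    using unital_algebraD(2)[OF A] by (rule ring.loop_Diff)
  moreover have "\<forall>f\<in>alg_hom F A B. Diff_map A f \<in> hom (Diff A) (Diff B)"
    using Diff_map_hom[OF A B] by blast
  moreover have "\<forall>f\<in>alg_hom F A B. \<forall>g\<in>alg_hom F B C. Diff_map A (compose (carrier A) g f)
      = compose (carrier (Diff A)) (Diff_map B g) (Diff_map A f)"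
    using Diff_map_compose by blast
  moreover have "\<forall>f\<in>alg_hom F A B. \<forall>\<alpha>\<in>alg_hom F (FdB F) A.
      hom_to_series F B (compose (carrier (FdB F)) f \<alpha>) = Diff_map A f (hom_to_series F A \<alpha>)"
    using hom_to_series_natural[OF F A] by blast
  moreover have "\<forall>a\<in>carrier (Diff A). series_to_hom F A a \<in> alg_hom F (FdB F) A \<and>
      (\<forall>n\<ge>1. series_to_hom F A a (gen F n) = a n) \<and> hom_to_series F A (series_to_hom F A a) = a"
    unfolding carrier using series_to_hom_hom[OF F A] by blast
  ultimately show ?thesis
    by (intro conjI ballI allI impI coloop_FdB[OF F] Diff_map_id loop_hom_loop[OF F A]
        hom_to_series_loop_iso[OF F A] division_formulas[OF F A]) blast+
qed

end
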